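(* Let $q\ge 5$ be a prime power with $q\equiv\xi\pmod 3$, $\xi\in\{1,-1\}$, and let $\mathcal O_L$ be the $G_q$-orbit of the line $\ell_L$. For every point type $\mathfrak p\in\{T,3_\Gamma,1_\Gamma,0_\Gamma\}$ let $\pi(\mathfrak p)$ be the plane type given by $\pi(T)=2_{\mathcal C}$, $\pi(3_\Gamma)=3_{\mathcal C}$, $\pi(1_\Gamma)=\overline{1_{\mathcal C}}$, $\pi(0_\Gamma)=0_{\mathcal C}$. Then $\Pi_\Gamma=\Lambda_\Gamma=P_{\mathcal C}=L_{\mathcal C}=0$, and for each such $\mathfrak p$ we have $P_{\mathfrak p}=\Pi_{\pi(\mathfrak p)}$ and $L_{\mathfrak p}=\Lambda_{\pi(\mathfrak p)}$, with the following values (listed as $(P_T,P_{3_\Gamma},P_{1_\Gamma},P_{0_\Gamma};\ L_T,L_{3_\Gamma},L_{1_\Gamma},L_{0_\Gamma})$): (1) $q$ odd, $\xi=-1$: $\big(2,\tfrac{q-5}{6},\tfrac{q-1}{2},\tfrac{q+1}{3};\ q-1,\tfrac{q-5}{2},\tfrac{q-1}{2},\tfrac{q+1}{2}\big)$; (2) $q=2^{2m+1}$ ($\xi=-1$): $\big(1,\tfrac{q-2}{6},\tfrac q2,\tfrac{q+1}{3};\ q-1,q-2,q,q+1\big)$; (3) $q$ odd, $\xi=1$, $2$ a non-cube in $\mathbb F_q$: $\big(1,\tfrac{q-1-\mathcal N_q}{3},\mathcal N_q,\tfrac{2q+1-2\mathcal N_q}{3};\ \tfrac{q-1}{3},\tfrac23(q-1-\mathcal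 N_q),\tfrac23\mathcal N_q,\tfrac{2q+1-2\mathcal N_q}{3}\big)$; (4) $q$ odd, $\xi=1$, $2$ a cube in $\mathbb F_q$: $\big(4,\tfrac{q-7-\mathcal N_q}{3},\mathcal N_q,\tfrac23(q-1-\mathcal N_q);\ \tfrac{q-1}{3},\tfrac{q-7-\mathcal N_q}{6},\tfrac{\mathcal N_q}{6},\tfrac{q-1-\mathcal N_q}{6}\big)$; (5) $q=2^{2m}$ ($\xi=1$): $\big(1,\tfrac13(\tfrac q2-1-(-2)^m),\tfrac q2+(-2)^m,\tfrac13(q+1+(-2)^{m+1});\ \tfrac{q-1}{3},\tfrac23(\tfrac q2-1-(-2)^m),\tfrac23(\tfrac q2+(-2)^m),\tfrac13(q+1+(-2)^{m+1})\big)$.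
   Context: Let $\mathbb F_q$ be the field of order $q$ and $\mathrm{PG}(3,q)$ the projective space with points $\mathbf P(x_0,x_1,x_2,x_3)$. For $t\in\mathbb F_q$ put $P(t)=\mathbf P(t^3,t^2,t,1)$, and $P(\infty)=\mathbf P(1,0,0,0)$; the twisted cubic is $\mathcal C=\{P(t):t\in\mathbb F_q\cup\{\infty\}\}$ and $G_q$ is the group of projectivities of $\mathrm{PG}(3,q)$ fixing $\mathcal C$. Write $\boldsymbol\pi(c_0,c_1,c_2,c_3)$ for the plane $c_0x_0+c_1x_1+c_2x_2+c_3x_3=0$. The osculating plane at $P(t)$ is $\boldsymbol\pi(1,-3t,3t^2,-t^3)$ ($t\in\mathbb F_q$) and $\boldsymbol\pi(0,0,0,1)$ at $P(\infty)$; these $q+1$ planes are the $\Gamma$-planes. The tangent to $\mathcal C$ at $P(t)$, $t\in\mathbb F_q$, is the line through $P(t)$ and $\mathbf P(3t^2,2t,1,0)$; the tangent at $P(\infty)$ is the line through $\mathbf P(1,0,0,0)$ and $\mathbf P(0,1,0,0)$. Plane types: a $d_{\mathcal C}$-plane ($d\in\{0,2,3\}$) is a plane containing exactly $d$ points of $\mathcal C$; a $\overline{1_{\mathcal C}}$-plane is a non-$\Gamma$-plane containing exactly one point of $\mathcal C$; the orbits of $2_{\mathcal C}$-, $3_{\mathcal C}$-, $\overline{1_{\mathcal C}}$-, $0_{\mathcal C}$-planes under $G_q$ have sizes $q^2+q$, $(q^3-q)/6$, $(q^3-q)/2$, $(q^3-q)/3$. Point types (for $q\not\equiv0\pmod 3$):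 $\mathcal C$-points are points of $\mathcal C$; $T$-points are points off $\mathcal C$ on a tangent; for $\mu\in\{0,1,3\}$, $\mu_\Gamma$-points are points off $\mathcal C$ lying in exactly $\mu$ distinct $\Gamma$-planes; the orbits of $T$-, $3_\Gamma$-, $1_\Gamma$-, $0_\Gamma$-points have sizes $q^2+q$, $(q^3-q)/6$, $(q^3-q)/2$, $(q^3-q)/3$. For a $G_q$-orbit $\mathcal O$ of lines: $\Pi_\pi$ is the number of $\pi$-planes through a line of $\mathcal O$; $\Lambda_\pi$ the number of lines of $\mathcal O$ in a $\pi$-plane; $P_{\mathfrak p}$ the number of $\mathfrak p$-points on a line of $\mathcal O$; $L_{\mathfrak p}$ the number of lines of $\mathcal O$ through a $\mathfrak p$-point (each independent of the chosen line/plane/point). Here $\ell_L$ is the line through $\mathbf P(1,0,0,1)$ and $\mathbf P(0,0,1,0)$, $\mathcal O_L$ its $G_q$-orbit. It is known that the lines of $\mathcal O_L$ are external to $\mathcal C$, not in $\Gamma$-planes, neither chords nor axes, and $\#\mathcal O_L$ equals $(q^3-q)/3$ if $\xi=1$ and ($q$ even or $2$ a non-cube), $(q^3-q)/12$ if $\xi=1$, $q$ odd and $2$ a cube, $q^3-q$ if $\xi=-1$, $q$ even, and $(q^3-q)/2$ if $\xi=-1$, $q$ odd. $\mathcal N_q=\#\{\beta\in\mathbb F_q: 1+4\beta^3 \text{ is a non-square in }\mathbb F_q\}$. *)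

theory Defs
  imports "HOL-Analysis.Analysis"
begin

text \<open>Homogeneous coordinates in PG(3,q): vectors of type 'a^4 over a finite field 'a,
  coordinates indexed 0,1,2,3 (numerals of the type 4).\<close>

definition vec4 :: "'a \<Rightarrow> 'a \<Rightarrow> 'a \<Rightarrow> 'a \<Rightarrow> 'a ^ 4" where
  "vec4 a b c d = (\<chi> i. if i = 0 then a else if i = 1 then b else if i = 2 then c else d)"

definition proj :: "'a::field ^ 4 \<Rightarrow> ('a ^ 4) set" where
  "proj v = {c *s v | c. c \<noteq> 0}"

definition PG3_points :: "('a::field ^ 4) set set" where
  "PG3_points = {proj v | v. v \<noteq> 0}"

definition lin_indep2 :: "'a::field ^ 4 \<Rightarrow> 'a ^ 4 \<Rightarrow> bool" where
  "lin_indep2 u w \<longleftrightarrow> (\<forall>a b. a *s u + b *s w = 0 \<longrightarrow> a = 0 \<and> b = 0)"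

definition line_through :: "'a::field ^ 4 \<Rightarrow> 'a ^ 4 \<Rightarrow> ('a ^ 4) set set" where
  "line_through u w = {proj (a *s u + b *s w) | a b. a \<noteq> 0 \<or> b \<noteq> 0}"

definition PG3_lines :: "('a::field ^ 4) set set set" where
  "PG3_lines = {line_through u w | u w. lin_indep2 u w}"

definition plane :: "'a::field ^ 4 \<Rightarrow> ('a ^ 4) set set" where
  "plane c = {proj v | v. v \<noteq> 0 \<and> (\<Sum>i\<in>UNIV. c $ i * v $ i) = 0}"

definition PG3_planes :: "('a::field ^ 4) set set set" where
  "PG3_planes = {plane c | c. c \<noteq> 0}"

definition cubic_pt :: "'a::field \<Rightarrow> ('a ^ 4) set" where
  "cubic_pt t = proj (vec4 (t^3) (t^2) t 1)"

definition cubic_pt_inf :: "('a::field ^ 4) set" where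
  "cubic_pt_inf = proj (vec4 1 0 0 0)"

definition twisted_cubic :: "('a::field ^ 4) set set" where
  "twisted_cubic = insert cubic_pt_inf (range cubic_pt)"

definition proj_map :: "'a::field ^ 4 ^ 4 \<Rightarrow> ('a ^ 4) set \<Rightarrow> ('a ^ 4) set" where
  "proj_map A P = (\<lambda>v. A *v v) ` P"

definition Gq :: "('a::field ^ 4 ^ 4) set" where
  "Gq = {A. invertible A \<and> proj_map A ` twisted_cubic = twisted_cubic}"

definition Gamma_planes :: "('a::field ^ 4) set set set" where
  "Gamma_planes = insert (plane (vec4 0 0 0 1))
      ((\<lambda>t. plane (vec4 1 (-3*t) (3*t^2) (-(t^3)))) ` UNIV)"

definition tangent_lines :: "('a::field ^ 4) set set set" where
  "tangent_lines = insert (line_through (vec4 1 0 0 0) (vec4 0 1 0 0))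
      ((\<lambda>t. line_through (vec4 (t^3) (t^2) t 1) (vec4 (3*t^2) (2*t) 1 0)) ` UNIV)"

definition is_C_point :: "('a::field ^ 4) set \<Rightarrow> bool" where
  "is_C_point P \<longleftrightarrow> P \<in> twisted_cubic"

definition is_T_point :: "('a::field ^ 4) set \<Rightarrow> bool" where
  "is_T_point P \<longleftrightarrow> P \<in> PG3_points \<and> P \<notin> twisted_cubic \<and> (\<exists>l\<in>tangent_lines. P \<in> l)"

definition is_Gamma_point :: "nat \<Rightarrow> ('a::field ^ 4) set \<Rightarrow> bool" where
  "is_Gamma_point \<mu> P \<longleftrightarrow> P \<in> PG3_points \<and> P \<notin> twisted_cubic \<and>
     card {\<pi> \<in> Gamma_planes. P \<in> \<pi>} = \<mu>"

definition is_Gamma_plane :: "('a::field ^ 4) set set \<Rightarrow> bool" where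
  "is_Gamma_plane \<pi> \<longleftrightarrow> \<pi> \<in> Gamma_planes"

definition is_dC_plane :: "nat \<Rightarrow> ('a::field ^ 4) set set \<Rightarrow> bool" where
  "is_dC_plane d \<pi> \<longleftrightarrow> \<pi> \<in> PG3_planes \<and> card (\<pi> \<inter> twisted_cubic) = d"

definition is_1bar_plane :: "('a::field ^ 4) set set \<Rightarrow> bool" where
  "is_1bar_plane \<pi> \<longleftrightarrow> \<pi> \<in> PG3_planes \<and> \<pi> \<notin> Gamma_planes \<and> card (\<pi> \<inter> twisted_cubic) = 1"

definition ell_L :: "('a::field ^ 4) set set" where
  "ell_L = line_through (vec4 1 0 0 1) (vec4 0 0 1 0)"

definition orbit_L :: "('a::field ^ 4) set set set" where
  "orbit_L = {proj_map A ` ell_L | A. A \<in> Gq}"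

definition Pi_num :: "(('a::field ^ 4) set set \<Rightarrow> bool) \<Rightarrow> ('a ^ 4) set set \<Rightarrow> nat" where
  "Pi_num plane_type l = card {\<pi> \<in> PG3_planes. plane_type \<pi> \<and> l \<subseteq> \<pi>}"

definition Lambda_num :: "('a::field ^ 4) set set \<Rightarrow> nat" where
  "Lambda_num \<pi> = card {l \<in> orbit_L. l \<subseteq> \<pi>}"

definition P_num :: "(('a::field ^ 4) set \<Rightarrow> bool) \<Rightarrow> ('a ^ 4) set set \<Rightarrow> nat" where
  "P_num point_type l = card {P \<in> l. point_type P}"

definition L_num :: "('a::field ^ 4) set \<Rightarrow> nat" where
  "L_num P = card {l \<in> orbit_L. P \<in> l}"

definition orbit_values ::
  "(('a::field ^ 4) set \<Rightarrow> bool) \<Rightarrow> (('a ^ 4) set set \<Rightarrow> bool) \<Rightarrow> real \<Rightarrow> real \<Rightarrow> bool" where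
  "orbit_values pt pl a b \<longleftrightarrow>
     (\<forall>l\<in>orbit_L. real (P_num pt l) = a \<and> real (Pi_num pl l) = a) \<and>
     (\<forall>P\<in>PG3_points. pt P \<longrightarrow> real (L_num P) = b) \<and>
     (\<forall>\<pi>\<in>PG3_planes. pl \<pi> \<longrightarrow> real (Lambda_num \<pi>) = b)"

definition N_q :: "'a::{field,finite} itself \<Rightarrow> nat" where
  "N_q _ = card {\<beta>::'a. \<not> (\<exists>y. y^2 = 1 + 4 * \<beta>^3)}"

definition two_is_cube :: "'a::{field,finite} itself \<Rightarrow> bool" where
  "two_is_cube _ \<longleftrightarrow> (\<exists>x::'a. x^3 = 2)"

end

(*  A point v of PG(3,q) is read as the binary cubic form whose zeros on PG(1,q) are the parameters of
    the Gamma-planes through v.  The matrices preserving the twisted cubic are the scalar multiples of the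
    third symmetric powers of 2x2 matrices (normalise a matrix to fix two points of the cubic; comparing
    coefficients then makes it diagonal), so they act by linear substitution and preserve the number of
    zeros, which determines the type of a point off the cubic.  They are transitive on each type: normal
    forms do it for 2 and 3 zeros, and for 0 or 1 zeros two roots in the extension field of degree 3 or 2
    are related by a fractional linear map over the ground field, by counting dimensions.

    The symplectic polarity attached to the cubic commutes with this action, exchanges point types and
    plane types, and fixes the line l_L, hence every line of its orbit; so only points have to be counted.
    The points of l_L are the forms 1 + 3bt^2 - t^3 and one further T-point.  Their T-points satisfy
    4b^3 = -1, those with a single root t correspond to the t for which y^2 + y + t^3 has no root, and the
    remaining counts follow by counting pairs (b, t).  For q = 2^(2m) the latter count is a cubic
    character sum S, with S^2 = 4q and S = 1 mod 3.  The stabiliser of l_L is transitive on its T-points and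
    the stabiliser of one of them in it consists of the cube roots of unity, which gives the number of
    lines of the orbit through a T-point; double counting incidences gives it for the other types. *)

theory Submission
  imports Defs "HOL-Algebra.Algebraic_Closure_Type" "HOL-Number_Theory.Residues"
begin

section \<open>Binary cubic forms and their symmetries\<close>

unbundle no fps_syntax  \<comment> \<open>otherwise \<open>$\<close> is ambiguous\<close>

text \<open>Characteristic different from 3 makes the binomial coefficients 3 invertible, so a
  vector can be recovered from its form and the polarity is a bijection from points to planes. The
  number of zeros does not separate a point of the cubic (the cube of a linear form) from a
  1_Gamma-point, hence membership in the cubic is carried along as a second invariant. Exactly two
  zeros means that one is double, because two zeros in the field force the third into it; this
  identifies the T-points. The orbit size and the totals of points of each type are not assumed. The
  totals come from the factorial moments of the number of zeros. The orbit size comes from the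
  T-points, the type for which the lines of the orbit through a point can be listed explicitly. Let
  n_1 and n_2 be the numbers of b such that 1 + 3bt^2 - t^3 has one or two zeros, and k the number
  of cube roots of unity. All values are functions of q, n_1, n_2 and k, and the five cases differ
  only in the latter three.\<close>

lemma UNIV_index4: "(UNIV :: 4 set) = {0, 1, 2, 3}"
proof -
  \<comment> \<open>Numerals of the type \<open>4\<close> are residues modulo 4, so 1, 2, 3, 4 and
    0, 1, 2, 3 list the same elements.\<close>
  have four: "(4::4) = 0" by simp
  show ?thesis unfolding UNIV_4 four by blast
qed

lemma sum_index4: "sum f (UNIV :: 4 set) = f 0 + f 1 + f 2 + f 3"
  unfolding UNIV_index4 by (simp add: add.assoc)

lemma vec_eq_index4:
  "(v :: 'a ^ 4) = w \<longleftrightarrow> v $ 0 = w $ 0 \<and> v $ 1 = w $ 1 \<and> v $ 2 = w $ 2 \<and> v $ 3 = w $ 3"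
proof -
  have "(\<forall>i. P i) \<longleftrightarrow> P 0 \<and> P 1 \<and> P 2 \<and> P 3" for P :: "4 \<Rightarrow> bool"
    using UNIV_index4 by (metis UNIV_I empty_iff insert_iff)
  thus ?thesis by (simp add: vec_eq_iff)
qed

lemma vec4_nth [simp]:
  "vec4 a b c d $ 0 = a" "vec4 a b c d $ 1 = b" "vec4 a b c d $ 2 = c" "vec4 a b c d $ 3 = d"
  by (simp_all add: vec4_def)

lemma vec4_exhaust: obtains a b c d where "v = vec4 a b c d"
  by (metis vec4_nth vec_eq_index4)

lemma vec4_eq_iff [simp]: "vec4 a b c d = vec4 a' b' c' d' \<longleftrightarrow> a = a' \<and> b = b' \<and> c = c' \<and> d = d'"
  by (simp add: vec_eq_index4)

lemma vec4_arith [simp]: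
  "k *s vec4 a b c d = vec4 (k * a) (k * b) (k * c) (k * d)"
  "vec4 a b c d + vec4 a' b' c' d' = vec4 (a + a') (b + b') (c + c') (d + d')"
  "vec4 a b c d - vec4 a' b' c' d' = vec4 (a - a') (b - b') (c - c') (d - d')"
  by (simp_all add: vec_eq_index4)

lemma vec4_zero: "(0 :: 'a::zero ^ 4) = vec4 0 0 0 0"
  by (simp add: vec_eq_index4)

lemma vec4_eq_0 [simp]: "vec4 a b c d = (0 :: 'a::zero ^ 4) \<longleftrightarrow> a = 0 \<and> b = 0 \<and> c = 0 \<and> d = 0"
  by (simp add: vec4_zero)

text \<open>For s = 1 this is the equation of the osculating plane at P(t), evaluated at v; in
  homogeneous parameters the pair (1, 0) stands for the plane at infinity.\<close>

definition cubic_form :: "'a::field ^ 4 \<Rightarrow> 'a \<Rightarrow> 'a \<Rightarrow> 'a" where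
  "cubic_form v t s = v $ 0 * s^3 - 3 * v $ 1 * t * s^2 + 3 * v $ 2 * t^2 * s - v $ 3 * t^3"

text \<open>The action of the substitution (t, s) -> (at + bs, ct + ds) on the monomials t^3, t^2 s,
  t s^2, s^3; see \<open>sym3_cubic\<close>.\<close>

definition sym3 :: "'a::field \<Rightarrow> 'a \<Rightarrow> 'a \<Rightarrow> 'a \<Rightarrow> 'a ^ 4 ^ 4" where
  "sym3 a b c d = vec4
     (vec4 (a^3) (3*a^2*b) (3*a*b^2) (b^3))
     (vec4 (a^2*c) (a^2*d + 2*a*b*c) (2*a*b*d + b^2*c) (b^2*d))
     (vec4 (a*c^2) (2*a*c*d + b*c^2) (a*d^2 + 2*b*c*d) (b*d^2))
     (vec4 (c^3) (3*c^2*d) (3*c*d^2) (d^3))"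

lemma sym3_mult_vec:
  "sym3 a b c d *v vec4 x0 x1 x2 x3 = vec4
     (a^3*x0 + 3*a^2*b*x1 + 3*a*b^2*x2 + b^3*x3)
     (a^2*c*x0 + (a^2*d + 2*a*b*c)*x1 + (2*a*b*d + b^2*c)*x2 + b^2*d*x3)
     (a*c^2*x0 + (2*a*c*d + b*c^2)*x1 + (a*d^2 + 2*b*c*d)*x2 + b*d^2*x3)
     (c^3*x0 + 3*c^2*d*x1 + 3*c*d^2*x2 + d^3*x3)"
  by (simp add: vec_eq_index4 matrix_vector_mult_def sum_index4 sym3_def)

lemma sym3_comp:
  "sym3 a b c d *v (sym3 a' b' c' d' *v v) = sym3 (a*a' + b*c') (a*b' + b*d') (c*a' + d*c') (c*b' + d*d') *v v"
proof -
  obtain x0 x1 x2 x3 where v: "v = vec4 x0 x1 x2 x3" by (rule vec4_exhaust)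
  show ?thesis unfolding v sym3_mult_vec vec4_eq_iff
    by (simp add: power2_eq_square power3_eq_cube algebra_simps)
qed

text \<open>The linear expressions aW - cU and bW - dU are the point of this shape: for (U, W) = (at
  + bs, ct + ds) they collapse to (ad - bc) s and -(ad - bc) t, which gives the equivariance of the
  form.\<close>

lemma cubic_form_sym3_aux:
  "cubic_form (sym3 a b c d *v vec4 x0 x1 x2 x3) U W =
     x0 * (a*W - c*U)^3 + 3 * x1 * ((a*W - c*U)^2 * (b*W - d*U))
     + 3 * x2 * ((a*W - c*U) * (b*W - d*U)^2) + x3 * (b*W - d*U)^3"
  unfolding sym3_mult_vec cubic_form_def vec4_nth
  by (simp add: power2_eq_square power3_eq_cube algebra_simps)

lemma cubic_form_sym3:
  "cubic_form (sym3 a b c d *v v) (a*t + b * s) (c*t + d * s) = (a*d - b*c)^3 * cubic_form v t s"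
proof -
  obtain x0 x1 x2 x3 where v: "v = vec4 x0 x1 x2 x3" by (rule vec4_exhaust)
  have e: "a * (c*t + d * s) - c * (a*t + b * s) = (a*d - b*c) * s"
          "b * (c*t + d * s) - d * (a*t + b * s) = (a*d - b*c) * (- t)"
    by (simp_all add: algebra_simps)
  have "x0 * (D * s)^3 + 3 * x1 * ((D * s)^2 * (D * (-t))) + 3 * x2 * ((D * s) * (D * (-t))^2)
      + x3 * (D * (-t))^3 = D^3 * cubic_form v t s" for D
    unfolding v cubic_form_def vec4_nth by (simp add: power2_eq_square power3_eq_cube algebra_simps)
  from this[of "a*d - b*c"] show ?thesis unfolding v cubic_form_sym3_aux e .
qed

lemma sym3_scalar: "sym3 k 0 0 k *v v = k^3 *s v"
proof -
  obtain x0 x1 x2 x3 where v: "v = vec4 x0 x1 x2 x3" by (rule vec4_exhaust)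
  show ?thesis unfolding v sym3_mult_vec by (simp add: power3_eq_cube power2_eq_square)
qed

text \<open>The adjugate inverts a 2x2 matrix up to its determinant, and a scalar k acts as k^3.
  This takes the place of matrix inverses below.\<close>

lemma sym3_adj:
  "sym3 d (-b) (-c) a *v (sym3 a b c d *v v) = (a*d - b*c)^3 *s v"
  "sym3 a b c d *v (sym3 d (-b) (-c) a *v v) = (a*d - b*c)^3 *s v"
  by (simp_all add: sym3_comp algebra_simps flip: sym3_scalar)

lemma sym3_cubic: "sym3 a b c d *v vec4 (t^3) (t^2 * s) (t * s^2) (s^3) =
   vec4 ((a*t+b * s)^3) ((a*t+b * s)^2*(c*t+d * s)) ((a*t+b * s)*(c*t+d * s)^2) ((c*t+d * s)^3)"
  by (simp add: sym3_mult_vec power2_eq_square power3_eq_cube algebra_simps)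

section \<open>Points, planes and the polarity\<close>

lemma proj_self: "v \<in> proj (v :: 'a::field ^ 4)"
  unfolding proj_def by (rule CollectI, rule exI[of _ 1]) simp

lemma proj_eq_iff: "proj v = proj w \<longleftrightarrow> (\<exists>k. k \<noteq> 0 \<and> w = k *s (v :: 'a::field ^ 4))"
proof
  assume "proj v = proj w"
  then have "w \<in> proj v" using proj_self by metis
  then show "\<exists>k. k \<noteq> 0 \<and> w = k *s v" unfolding proj_def by auto
next
  assume "\<exists>k. k \<noteq> 0 \<and> w = k *s v"
  then obtain k where k: "k \<noteq> 0" "w = k *s v" by auto
  show "proj v = proj w"
  proof (intro equalityI subsetI)
    fix x assume "x \<in> proj v"
    then obtain c where c: "c \<noteq> 0" "x = c *s v" unfolding proj_def by auto
    then have "x = (c / k) *s w" using k by (simp add: vector_smult_assoc)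
    then show "x \<in> proj w" unfolding proj_def using c k by (metis (mono_tags, lifting) divide_eq_0_iff mem_Collect_eq)
  next
    fix x assume "x \<in> proj w"
    then obtain c where c: "c \<noteq> 0" "x = c *s w" unfolding proj_def by auto
    then have "x = (c * k) *s v" using k by (simp add: vector_smult_assoc)
    then show "x \<in> proj v" unfolding proj_def using c k by (metis (mono_tags, lifting) mult_eq_0_iff mem_Collect_eq)
  qed
qed

lemma proj_smult: "k \<noteq> 0 \<Longrightarrow> proj (k *s v) = proj (v :: 'a::field ^ 4)"
  using proj_eq_iff by metis

lemma PG3_pointsE: assumes "P \<in> PG3_points" obtains v where "v \<noteq> 0" "P = proj v"
  using assms unfolding PG3_points_def by auto

lemma proj_in_points_iff [simp]: "proj v \<in> PG3_points \<longleftrightarrow> v \<noteq> 0"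
proof
  assume "proj v \<in> PG3_points"
  then obtain w where "w \<noteq> 0" "proj v = proj w" by (rule PG3_pointsE)
  then show "v \<noteq> 0" using proj_eq_iff[of v w] by auto
qed (auto simp: PG3_points_def)

lemma proj_map_proj: "proj_map A (proj v) = proj (A *v v)"
proof -
  have "A *v (c *s v) = c *s (A *v v)" for c
    by (simp add: matrix_vector_mult_scaleR vec.scale)
  then show ?thesis unfolding proj_map_def proj_def by (auto simp: image_iff) metis
qed

lemma proj_in_plane_iff:
  assumes "v \<noteq> 0" shows "proj v \<in> plane c \<longleftrightarrow> (\<Sum>i\<in>UNIV. c $ i * v $ i) = 0"
proof
  assume "proj v \<in> plane c"
  then obtain w where w: "w \<noteq> 0" "(\<Sum>i\<in>UNIV. c $ i * w $ i) = 0" "proj v = proj w"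
    unfolding plane_def by auto
  then obtain k where k: "k \<noteq> 0" "w = k *s v" using proj_eq_iff by metis
  have "(\<Sum>i\<in>UNIV. c $ i * w $ i) = k * (\<Sum>i\<in>UNIV. c $ i * v $ i)"
    unfolding k by (simp add: sum_distrib_left ac_simps)
  then show "(\<Sum>i\<in>UNIV. c $ i * v $ i) = 0" using w k by simp
next
  assume "(\<Sum>i\<in>UNIV. c $ i * v $ i) = 0"
  then show "proj v \<in> plane c" unfolding plane_def using assms by auto
qed

text \<open>The parameter line PG(1,q) is the option type, with \<open>None\<close> for the point at infinity.\<close>

definition curve_vec :: "'a::field option \<Rightarrow> 'a ^ 4" where
  "curve_vec z = (case z of None \<Rightarrow> vec4 1 0 0 0 | Some t \<Rightarrow> vec4 (t^3) (t^2) t 1)"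

definition osc_vec :: "'a::field option \<Rightarrow> 'a ^ 4" where
  "osc_vec z = (case z of None \<Rightarrow> vec4 0 0 0 1 | Some t \<Rightarrow> vec4 1 (-3*t) (3*t^2) (-(t^3)))"

definition roots :: "'a::field ^ 4 \<Rightarrow> 'a option set" where
  "roots v = {z. case z of None \<Rightarrow> v $ 3 = 0 | Some t \<Rightarrow> cubic_form v t 1 = 0}"

abbreviation nroots :: "'a::field ^ 4 \<Rightarrow> nat" where "nroots v \<equiv> card (roots v)"

text \<open>The symplectic polarity of the twisted cubic. It takes each point of the cubic to its
  osculating plane, at infinity up to the sign -1.\<close>

definition polar_vec :: "'a::field ^ 4 \<Rightarrow> 'a ^ 4" where
  "polar_vec v = vec4 (v $ 3) (-3 * v $ 2) (3 * v $ 1) (- v $ 0)"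

lemma None_in_roots [simp]: "None \<in> roots v \<longleftrightarrow> v $ 3 = 0"
  and Some_in_roots [simp]: "Some t \<in> roots v \<longleftrightarrow> cubic_form v t 1 = 0"
  by (simp_all add: roots_def)

lemma range_option: "range f = insert (f None) (range (\<lambda>t. f (Some t)))"
  by (auto simp: UNIV_option_conv)

lemma twisted_cubic_eq: "twisted_cubic = range (\<lambda>z. proj (curve_vec z))"
  by (subst range_option) (simp add: twisted_cubic_def cubic_pt_def cubic_pt_inf_def curve_vec_def)

lemma Gamma_planes_eq: "Gamma_planes = range (\<lambda>z. plane (osc_vec z))"
  by (subst range_option) (simp add: Gamma_planes_def osc_vec_def)

lemma curve_vec_nonzero [simp]: "curve_vec z \<noteq> 0" and osc_vec_nonzero [simp]: "osc_vec z \<noteq> 0"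
  by (auto simp: curve_vec_def osc_vec_def split: option.splits)

lemma proj_curve_vec_inj: "inj (\<lambda>z. proj (curve_vec z))"
  by (rule injI) (auto simp: proj_eq_iff curve_vec_def split: option.splits)

lemma proj_in_Gamma_plane_iff:
  "v \<noteq> 0 \<Longrightarrow> proj v \<in> plane (osc_vec z) \<longleftrightarrow> z \<in> roots v"
  by (cases z) (auto simp: proj_in_plane_iff sum_index4 osc_vec_def cubic_form_def algebra_simps)

text \<open>The pairing behind the polarity is alternating, so a point of the cubic lies on the
  polar plane of v exactly when v lies on its osculating plane. The zeros thus count both the
  Gamma-planes through v and the cubic points on its polar plane.\<close>

lemma curve_in_polar_iff:
  "proj (curve_vec z) \<in> plane (polar_vec v) \<longleftrightarrow> z \<in> roots v"
  by (cases z)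
    (auto simp: proj_in_plane_iff sum_index4 curve_vec_def polar_vec_def cubic_form_def algebra_simps)

text \<open>The vector with entry c_i at j and -c_j at i lies on the plane c; that it lies on c' too
  is the proportionality of coordinates i and j.\<close>

lemma plane_subset_imp_proportional:
  assumes "c \<noteq> 0" "c' \<noteq> 0" "plane c \<subseteq> plane (c' :: 'a::field ^ 4)"
  obtains k where "k \<noteq> 0" "c' = k *s c"
proof -
  obtain i where i: "c $ i \<noteq> 0" using assms(1) by (auto simp: vec_eq_iff)
  have key: "c' $ j * c $ i = c' $ i * c $ j" for j
  proof (cases "j = i")
    case False
    define y :: "'a ^ 4" where "y = (\<chi> l. if l = j then c $ i else if l = i then - c $ j else 0)"
    have s: "(\<Sum>l\<in>UNIV. d $ l * y $ l) = d $ j * c $ i - d $ i * c $ j" for d :: "'a ^ 4"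
    proof -
      have "(\<Sum>l\<in>UNIV. d $ l * y $ l) = (\<Sum>l\<in>{j,i}. d $ l * y $ l)"
        by (rule sum.mono_neutral_right) (auto simp: y_def)
      then show ?thesis using False by (simp add: y_def)
    qed
    have "y \<noteq> 0" using i by (auto simp: y_def vec_eq_iff)
    moreover have "proj y \<in> plane c" using \<open>y \<noteq> 0\<close> s[of c] by (simp add: proj_in_plane_iff)
    ultimately show ?thesis using assms(3) s[of c'] proj_in_plane_iff by force
  qed auto
  define k where "k = c' $ i / c $ i"
  have e: "c' = k *s c" unfolding vec_eq_iff k_def using key i by (auto simp: field_simps)
  with assms(2) have "k \<noteq> 0" by auto
  with e show ?thesis using that by blast
qed

lemma plane_smult: "k \<noteq> 0 \<Longrightarrow> plane (k *s c) = plane (c :: 'a::field ^ 4)"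
proof -
  assume k: "k \<noteq> 0"
  have "(\<Sum>i\<in>UNIV. (k *s c) $ i * v $ i) = k * (\<Sum>i\<in>UNIV. c $ i * v $ i)" for v
    by (simp add: sum_distrib_left ac_simps)
  then show ?thesis unfolding plane_def using k by simp
qed

lemma plane_eq_iff:
  "c \<noteq> 0 \<Longrightarrow> c' \<noteq> 0 \<Longrightarrow> plane c = plane c' \<longleftrightarrow> proj c = proj (c' :: 'a::field ^ 4)"
  unfolding proj_eq_iff by (metis order_refl plane_subset_imp_proportional plane_smult)

lemma plane_osc_vec_inj:
  assumes "(3::'a::field) \<noteq> 0" shows "inj (\<lambda>z :: 'a option. plane (osc_vec z))"
  by (rule injI)
    (use assms in \<open>auto simp: plane_eq_iff proj_eq_iff osc_vec_def split: option.splits\<close>)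

lemma card_Gamma_planes_through:
  assumes "(3::'a::field) \<noteq> 0" "(v :: 'a ^ 4) \<noteq> 0"
  shows "card {\<pi> \<in> Gamma_planes. proj v \<in> \<pi>} = nroots v"
proof -
  have "{\<pi> \<in> Gamma_planes. proj v \<in> \<pi>} = (\<lambda>z. plane (osc_vec z)) ` roots v"
    unfolding Gamma_planes_eq using proj_in_Gamma_plane_iff[OF assms(2)] by auto
  then show ?thesis using card_image inj_on_subset[OF plane_osc_vec_inj[OF assms(1)]] by (metis subset_UNIV)
qed

lemma card_plane_cubic_points: "card (plane (polar_vec v) \<inter> twisted_cubic) = nroots v"
proof -
  have "plane (polar_vec v) \<inter> twisted_cubic = (\<lambda>z. proj (curve_vec z)) ` roots v"
    unfolding twisted_cubic_eq using curve_in_polar_iff by auto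
  then show ?thesis using card_image inj_on_subset[OF proj_curve_vec_inj] by (metis subset_UNIV)
qed

lemma polar_vec_eq_0_iff: "(3::'a::field) \<noteq> 0 \<Longrightarrow> polar_vec (v :: 'a ^ 4) = 0 \<longleftrightarrow> v = 0"
  by (cases v rule: vec4_exhaust) (auto simp: polar_vec_def)

lemma polar_vec_smult: "polar_vec (k *s v) = k *s polar_vec v"
  by (simp add: polar_vec_def)

lemma polar_vec_surj:
  assumes "(3::'a::field) \<noteq> 0" obtains v where "c = polar_vec (v :: 'a ^ 4)"
proof -
  have "c = polar_vec (vec4 (- (c $ 3)) (c $ 2 / 3) (- (c $ 1) / 3) (c $ 0))"
    using assms by (simp add: polar_vec_def vec_eq_index4)
  then show ?thesis using that by blast
qed

lemma polar_vec_inj: "(3::'a::field) \<noteq> 0 \<Longrightarrow> polar_vec (v :: 'a ^ 4) = polar_vec w \<longleftrightarrow> v = w"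
  by (auto simp: polar_vec_def vec_eq_index4)

lemma plane_polar_eq_iff:
  assumes "(3::'a::field) \<noteq> 0" "(v :: 'a ^ 4) \<noteq> 0" "w \<noteq> 0"
  shows "plane (polar_vec v) = plane (polar_vec w) \<longleftrightarrow> proj v = proj w"
  using assms by (simp add: plane_eq_iff polar_vec_eq_0_iff proj_eq_iff polar_vec_inj flip: polar_vec_smult)

lemma plane_polar_in_Gamma_iff:
  assumes "(3::'a::field) \<noteq> 0" "(v :: 'a ^ 4) \<noteq> 0"
  shows "plane (polar_vec v) \<in> Gamma_planes \<longleftrightarrow> proj v \<in> twisted_cubic"
proof -
  have "plane (osc_vec z) = plane (polar_vec (curve_vec z :: 'a ^ 4))" for z
  proof (cases z)
    case None
    have "polar_vec (curve_vec z :: 'a ^ 4) = (-1) *s osc_vec z" using None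
      by (simp add: polar_vec_def curve_vec_def osc_vec_def)
    then show ?thesis using plane_smult[of "-1" "osc_vec z"] by simp
  next
    case (Some t)
    have "polar_vec (curve_vec z :: 'a ^ 4) = osc_vec z" using Some
      by (simp add: polar_vec_def curve_vec_def osc_vec_def)
    then show ?thesis by simp
  qed
  then have "plane (polar_vec v) = plane (osc_vec z) \<longleftrightarrow> proj v = proj (curve_vec z)" for z
    using plane_polar_eq_iff[OF assms] by simp
  then show ?thesis unfolding Gamma_planes_eq twisted_cubic_eq by (simp add: image_iff)
qed

lemma cubic_form_scale: "cubic_form v (k*t) (k*u) = k^3 * cubic_form v t u"
  by (simp add: cubic_form_def power2_eq_square power3_eq_cube algebra_simps)

lemma cubic_form_smult: "cubic_form (k *s v) t u = k * cubic_form v t u"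
  by (simp add: cubic_form_def algebra_simps)

lemma roots_smult: "k \<noteq> 0 \<Longrightarrow> roots (k *s v) = roots v"
  by (auto simp: roots_def cubic_form_smult split: option.splits)

section \<open>Counting zeros through nonzero pairs of parameters\<close>

definition hom_zeros :: "'a::field ^ 4 \<Rightarrow> ('a \<times> 'a) set" where
  "hom_zeros v = {p. p \<noteq> (0, 0) \<and> cubic_form v (fst p) (snd p) = 0}"

text \<open>Each point of PG(1,q) is represented by q - 1 nonzero pairs. Substitutions act on pairs
  without a special case at infinity, so invariance is proved for pairs and transferred
  back.\<close>

lemma card_hom_zeros:
  "card (hom_zeros (v :: 'a::{field,finite} ^ 4)) = (CARD('a) - 1) * nroots v"
proof -
  define f :: "'a option \<times> 'a \<Rightarrow> 'a \<times> 'a"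
    where "f = (\<lambda>(z, k). case z of None \<Rightarrow> (k, 0) | Some t \<Rightarrow> (k * t, k))"
  have inj: "inj_on f (roots v \<times> (- {0}))"
    by (rule inj_onI) (auto simp: f_def split: option.splits)
  have z: "cubic_form v (k*t) k = k^3 * cubic_form v t 1" for k t
    using cubic_form_scale[of v k t 1] by simp
  have "f ` (roots v \<times> (- {0})) = hom_zeros v"
  proof (intro equalityI subsetI)
    fix p assume "p \<in> f ` (roots v \<times> (- {0}))"
    then obtain y k where "y \<in> roots v" "k \<noteq> 0" "p = f (y, k)" by auto
    then show "p \<in> hom_zeros v"
      by (cases y) (auto simp: f_def hom_zeros_def z, simp add: cubic_form_def)
  next
    fix p assume p: "p \<in> hom_zeros v"
    obtain t u where tu: "p = (t, u)" by force
    show "p \<in> f ` (roots v \<times> (- {0}))"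
    proof (cases "u = 0")
      case True
      then have "p = f (None, t)" "t \<noteq> 0" "v $ 3 = 0"
        using p tu by (auto simp: f_def hom_zeros_def cubic_form_def)
      then show ?thesis by auto
    next
      case False
      then have "p = f (Some (t/u), u)" by (simp add: f_def tu)
      moreover have "cubic_form v (t/u) 1 = 0"
        using z[of u "t/u"] p tu False by (simp add: hom_zeros_def)
      ultimately show ?thesis using False by auto
    qed
  qed
  then have "card (hom_zeros v) = card (roots v \<times> (- {0::'a}))" using card_image[OF inj] by simp
  also have "\<dots> = nroots v * (CARD('a) - 1)" by (simp add: card_cartesian_product Compl_eq_Diff_UNIV)
  finally show ?thesis by simp
qed

lemma CARD_field_gt_1: "CARD('a::{field,finite}) > 1"
proof -
  have "card {0, 1::'a} \<le> CARD('a)" by (rule card_mono) auto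
  then show ?thesis by simp
qed

text \<open>The substitution permutes the nonzero pairs, and \<open>cubic_form_sym3\<close> carries
  zeros to zeros; cancelling q - 1 gives the claim.\<close>

lemma nroots_sym3:
  assumes "a*d - b*c \<noteq> (0::'a::{field,finite})"
  shows "nroots (sym3 a b c d *v v) = nroots v"
proof -
  define f where "f = (\<lambda>(t, u). (a*t + b * u, c*t + d * u))"
  have "inj f"
  proof (rule injI)
    fix p p' assume e: "f p = f p'"
    obtain t u t' u' where p: "p = (t, u)" "p' = (t', u')" by force
    have e: "a*t + b * u = a*t' + b * u'" "c*t + d * u = c*t' + d * u'" using e by (auto simp: f_def p)
    have "(a*d - b*c) * t = d * (a*t + b * u) - b * (c*t + d * u)"
      "(a*d - b*c) * u = a * (c*t + d * u) - c * (a*t + b * u)" for t u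
      by (simp_all add: algebra_simps)
    then have "(a*d - b*c) * t = (a*d - b*c) * t'" "(a*d - b*c) * u = (a*d - b*c) * u'"
      using e by metis+
    then show "p = p'" using assms p by simp
  qed
  have s: "surj f" using \<open>inj f\<close> by (simp add: finite_UNIV_inj_surj)
  have f0: "f p = (0, 0) \<longleftrightarrow> p = (0, 0)" for p using injD[OF \<open>inj f\<close>, of p "(0,0)"] by (auto simp: f_def)
  have z: "cubic_form (sym3 a b c d *v v) (fst (f p)) (snd (f p)) = 0 \<longleftrightarrow> cubic_form v (fst p) (snd p) = 0" for p
    using assms by (simp add: f_def cubic_form_sym3 split: prod.splits)
  have "f ` hom_zeros v = hom_zeros (sym3 a b c d *v v)"
  proof (intro equalityI subsetI)
    fix p assume p: "p \<in> hom_zeros (sym3 a b c d *v v)"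
    obtain p' where p': "p = f p'" using s by (metis surjD)
    then have "p' \<in> hom_zeros v" using p z f0 unfolding hom_zeros_def by auto
    then show "p \<in> f ` hom_zeros v" using p' by auto
  next
    fix p assume "p \<in> f ` hom_zeros v"
    then obtain p' where "p = f p'" "p' \<in> hom_zeros v" by blast
    then show "p \<in> hom_zeros (sym3 a b c d *v v)" using z f0 unfolding hom_zeros_def by auto
  qed
  then have "card (hom_zeros (sym3 a b c d *v v)) = card (hom_zeros v)"
    using card_image[OF inj_on_subset[OF \<open>inj f\<close>]] by (metis subset_UNIV)
  then show ?thesis using card_hom_zeros CARD_field_gt_1[where 'a = 'a] by (metis mult_left_cancel not_gr0 zero_less_diff)
qed

lemma roots_eq: "roots v = (if v $ 3 = 0 then {None} else {}) \<union> Some ` {t. cubic_form v t 1 = 0}"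
proof -
  have "z \<in> roots v \<longleftrightarrow> z \<in> (if v $ 3 = 0 then {None} else {}) \<union> Some ` {t. cubic_form v t 1 = 0}" for z
    by (cases z) auto
  then show ?thesis by blast
qed

lemma card_roots_cubic_poly:
  assumes "a \<noteq> 0 \<or> b \<noteq> 0 \<or> c \<noteq> 0 \<or> d \<noteq> (0::'a::{field,finite})"
  shows "card {t. a + b*t + c*t^2 + d*t^3 = 0} \<le> 3" "d = 0 \<Longrightarrow> card {t. a + b*t + c*t^2 + d*t^3 = 0} \<le> 2"
proof -
  have ne: "[:a, b, c, d:] \<noteq> 0" using assms by auto
  have e: "{t. a + b*t + c*t^2 + d*t^3 = 0} = {t. poly [:a, b, c, d:] t = 0}"
    by (simp add: power2_eq_square power3_eq_cube algebra_simps)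
  have "Polynomial.degree [:a, b, c, d:] \<le> 3" by (simp add: Polynomial.degree_pCons_eq_if)
  then show "card {t. a + b*t + c*t^2 + d*t^3 = 0} \<le> 3"
    unfolding e using card_poly_roots_bound[OF ne] by linarith
  assume "d = 0"
  then have "Polynomial.degree [:a, b, c, d:] \<le> 2" by (simp add: Polynomial.degree_pCons_eq_if)
  then show "card {t. a + b*t + c*t^2 + d*t^3 = 0} \<le> 2"
    unfolding e using card_poly_roots_bound[OF ne] by linarith
qed

text \<open>If x3 = 0, infinity is a zero, but then the affine polynomial has degree at most 2, so
  the bound 3 survives.\<close>

lemma nroots_le_3:
  assumes "(3::'a::{field,finite}) \<noteq> 0" "(v :: 'a ^ 4) \<noteq> 0"
  shows "nroots v \<le> 3"
proof -
  define A where "A = {t. cubic_form v t 1 = 0}"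
  have A: "A = {t. v $ 0 + (-3 * v $ 1)*t + (3 * v $ 2)*t^2 + (- v $ 3)*t^3 = 0}"
    unfolding A_def by (simp add: cubic_form_def)
  have ne: "v $ 0 \<noteq> 0 \<or> -3 * v $ 1 \<noteq> 0 \<or> 3 * v $ 2 \<noteq> 0 \<or> - v $ 3 \<noteq> 0"
    using assms by (auto simp: vec_eq_index4)
  have c: "card A \<le> 3" "v $ 3 = 0 \<Longrightarrow> card A \<le> 2"
    unfolding A using card_roots_cubic_poly[OF ne] by auto
  show ?thesis
  proof (cases "v $ 3 = 0")
    case True
    then have "nroots v \<le> card {None :: 'a option} + card (Some ` A)"
      unfolding roots_eq A_def[symmetric] using card_Un_le[of "{None}" "Some ` A"] by simp
    then show ?thesis using c(2)[OF True] by (simp add: card_image)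
  next
    case False
    then show ?thesis using c unfolding roots_eq A_def[symmetric] by (simp add: card_image)
  qed
qed

lemma roots_curve_vec:
  "(3::'a::field) \<noteq> 0 \<Longrightarrow> roots (curve_vec z :: 'a ^ 4) = {z}"
proof -
  assume "(3::'a) \<noteq> 0"
  have "t^3 - 3 * t^2 * x + 3 * t * x^2 - x^3 = (t - x)^3" for t x :: 'a
    by (simp add: power2_eq_square power3_eq_cube algebra_simps)
  then have e: "cubic_form (vec4 (t^3) (t^2) t 1) x 1 = (t - x)^3" for t x :: 'a
    by (simp add: cubic_form_def)
  show ?thesis
    by (cases z) (auto simp: roots_def curve_vec_def e cubic_form_def[of "vec4 1 0 0 0"] split: option.splits)
qed

lemma roots_smult_curve_vec:
  "(3::'a::field) \<noteq> 0 \<Longrightarrow> proj (v :: 'a ^ 4) = proj (curve_vec z) \<Longrightarrow> roots v = {z}"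
  using roots_curve_vec roots_smult unfolding proj_eq_iff by metis

section \<open>Tangent lines and double zeros\<close>

lemma in_twisted_cubic_iff: "proj v \<in> twisted_cubic \<longleftrightarrow> (\<exists>z. proj v = proj (curve_vec z))"
  unfolding twisted_cubic_eq by auto

text \<open>The equations of the tangent at z. At a finite t the last two coordinates force the
  coefficients x3 and x2 - t x3 of the two spanning vectors; the first two coordinates are then
  determined.\<close>

definition on_tangent_at :: "'a::field ^ 4 \<Rightarrow> 'a option \<Rightarrow> bool" where
  "on_tangent_at v z = (case z of None \<Rightarrow> v $ 2 = 0 \<and> v $ 3 = 0
     | Some t \<Rightarrow> v $ 1 = 2*t * v $ 2 - t^2 * v $ 3 \<and> v $ 0 = 3*t^2 * v $ 2 - 2*t^3 * v $ 3)"

lemma proj_in_line_through_iff: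
  assumes "v \<noteq> 0"
  shows "proj v \<in> line_through u w \<longleftrightarrow> (\<exists>a b. v = a *s u + b *s w)"
proof
  assume "proj v \<in> line_through u w"
  then obtain a b where ab: "proj v = proj (a *s u + b *s w)" unfolding line_through_def by auto
  then have "proj (a *s u + b *s w) = proj v" ..
  then obtain k where "v = k *s (a *s u + b *s w)" unfolding proj_eq_iff by auto
  then have "v = (k * a) *s u + (k * b) *s w" by (simp add: vec_eq_iff algebra_simps)
  then show "\<exists>a b. v = a *s u + b *s w" by blast
next
  assume "\<exists>a b. v = a *s u + b *s w"
  then obtain a b where ab: "v = a *s u + b *s w" by auto
  then have "a \<noteq> 0 \<or> b \<noteq> 0" using assms by auto
  then show "proj v \<in> line_through u w" unfolding line_through_def using ab by auto
qed

lemma tangent_line_iff: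
  assumes "v \<noteq> 0"
  shows "(\<exists>l\<in>tangent_lines. proj v \<in> l) \<longleftrightarrow> (\<exists>z. on_tangent_at v z)"
proof -
  obtain x0 x1 x2 x3 where v: "v = vec4 x0 x1 x2 x3" by (rule vec4_exhaust)
  have 1: "proj v \<in> line_through (vec4 1 0 0 0) (vec4 0 1 0 0) \<longleftrightarrow> on_tangent_at v None"
    unfolding proj_in_line_through_iff[OF assms] by (auto simp: v on_tangent_at_def)
  have 2: "proj v \<in> line_through (vec4 (t^3) (t^2) t 1) (vec4 (3*t^2) (2*t) 1 0) \<longleftrightarrow> on_tangent_at v (Some t)" for t
  proof -
    have "(\<exists>a b. v = a *s vec4 (t^3) (t^2) t 1 + b *s vec4 (3*t^2) (2*t) 1 0) \<longleftrightarrow>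
      v = x3 *s vec4 (t^3) (t^2) t 1 + (x2 - t * x3) *s vec4 (3*t^2) (2*t) 1 0"
      by (auto simp: v)
    also have "\<dots> \<longleftrightarrow> on_tangent_at v (Some t)"
      by (simp add: v on_tangent_at_def algebra_simps power2_eq_square power3_eq_cube) blast
    finally show ?thesis unfolding proj_in_line_through_iff[OF assms] .
  qed
  have "(\<exists>l\<in>tangent_lines. proj v \<in> l) \<longleftrightarrow> on_tangent_at v None \<or> (\<exists>t. on_tangent_at v (Some t))"
    unfolding tangent_lines_def using 1 2 by auto
  then show ?thesis by (metis option.exhaust)
qed

text \<open>On the tangent at a finite t the form is (t - y)^2 (x3 (t - y) + 3b) with b = x2 - t x3.
  Off the cubic b is nonzero, so the remaining zero differs from t; it is at infinity when x3 =
  0.\<close>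

lemma nroots_on_tangent:
  assumes three: "(3::'a::field) \<noteq> 0" and v: "(v :: 'a ^ 4) \<noteq> 0"
    and tan: "on_tangent_at v z" and nC: "proj v \<notin> twisted_cubic"
  shows "nroots v = 2"
proof -
  obtain x0 x1 x2 x3 where x: "v = vec4 x0 x1 x2 x3" by (rule vec4_exhaust)
  show ?thesis
  proof (cases z)
    case None
    have 0: "x2 = 0" "x3 = 0" using tan by (auto simp: None on_tangent_at_def x)
    have "x1 \<noteq> 0"
    proof
      assume "x1 = 0"
      then have "v = x0 *s curve_vec None" "x0 \<noteq> 0" using 0 x v by (auto simp: curve_vec_def)
      then have "proj v = proj (curve_vec None)" by (simp add: proj_smult)
      then show False using nC in_twisted_cubic_iff by blast
    qed
    then have "cubic_form v t 1 = 0 \<longleftrightarrow> t = x0 / (3 * x1)" for t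
      using three by (auto simp: cubic_form_def x 0 field_simps)
    then have "roots v = {None, Some (x0 / (3 * x1))}"
      unfolding roots_eq by (auto simp: x 0)
    then show ?thesis by simp
  next
    case (Some t)
    define b where "b = x2 - t * x3"
    have e: "x1 = 2*t*x2 - t^2*x3" "x0 = 3*t^2*x2 - 2*t^3*x3" using tan by (auto simp: Some on_tangent_at_def x)
    have "b \<noteq> 0"
    proof
      assume "b = 0"
      then have "v = x3 *s curve_vec (Some t)" by (simp add: curve_vec_def x e b_def power2_eq_square power3_eq_cube)
      moreover then have "x3 \<noteq> 0" using v by auto
      ultimately have "proj v = proj (curve_vec (Some t))" by (simp add: proj_smult)
      then show False using nC in_twisted_cubic_iff by blast
    qed
    have F: "cubic_form v y 1 = (t - y)^2 * (x3 * (t - y) + 3 * b)" for y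
      by (simp add: cubic_form_def x e b_def power2_eq_square power3_eq_cube algebra_simps)
    show ?thesis
    proof (cases "x3 = 0")
      case True
      then have "roots v = {None, Some t}" unfolding roots_eq F using three \<open>b \<noteq> 0\<close> by (auto simp: x)
      then show ?thesis by simp
    next
      case False
      have "x3 * (t - y) + 3 * b = 0 \<longleftrightarrow> y = t + 3 * b / x3" for y
        using False by (auto simp: field_simps)
      then have "cubic_form v y 1 = 0 \<longleftrightarrow> y = t \<or> y = t + 3 * b / x3" for y
        unfolding F by auto
      then have "roots v = {Some t, Some (t + 3 * b / x3)}" unfolding roots_eq using False by (auto simp: x)
      then show ?thesis using three \<open>b \<noteq> 0\<close> False by (simp add: card_insert_if)
    qed
  qed
qed

text \<open>Two zeros in the field leave a linear factor, so the third zero lies in the field and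
  must repeat one of them. The repeated zero is the point of contact.\<close>

lemma nroots_2_on_tangent:
  assumes three: "(3::'a::field) \<noteq> 0" and n: "nroots (v :: 'a ^ 4) = 2"
  shows "\<exists>z. on_tangent_at v z"
proof -
  obtain x0 x1 x2 x3 where x: "v = vec4 x0 x1 x2 x3" by (rule vec4_exhaust)
  obtain r1 r2 where r: "roots v = {r1, r2}" "r1 \<noteq> r2" using n by (auto simp: card_2_iff)
  show ?thesis
  proof (cases "x3 = 0")
    case True
    show ?thesis
    proof (cases "x2 = 0")
      case 2: True
      then have "on_tangent_at v None" using True by (simp add: x on_tangent_at_def)
      then show ?thesis ..
    next
      case False
      have "None \<in> roots v" using True by (simp add: x)
      then obtain t where t: "roots v = {None, Some t}"
        using r by (metis doubleton_eq_iff insertE option.exhaust singletonD)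
      have ft: "x0 - 3*x1*t + 3*x2*t^2 = 0"
        using t True Some_in_roots[of t v] by (simp add: cubic_form_def x)
      \<comment> \<open>The affine zeros have sum x1/x2, so this is the partner of t; with only one
        affine zero available it is t again.\<close>
      have "cubic_form v (x1/x2 - t) 1 = x0 - 3*x1*t + 3*x2*t^2"
        using True False by (simp add: cubic_form_def x field_simps power2_eq_square)
      then have "Some (x1/x2 - t) \<in> roots v" using ft by simp
      then have "x1/x2 - t = t" using t by auto
      then have x1: "x1 = 2*t*x2" using False by (simp add: field_simps)
      have "on_tangent_at v (Some t)" using ft True
        by (simp add: on_tangent_at_def x x1 power2_eq_square algebra_simps)
      then show ?thesis ..
    qed
  next
    case False
    then obtain t1 t2 where t: "roots v = {Some t1, Some t2}" "t1 \<noteq> t2"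
      using r None_in_roots[of v] by (cases r1; cases r2) (auto simp: x)
    have f: "x0 - 3*x1*t1 + 3*x2*t1^2 - x3*t1^3 = 0" "x0 - 3*x1*t2 + 3*x2*t2^2 - x3*t2^3 = 0"
      using t Some_in_roots[of t1 v] Some_in_roots[of t2 v] by (simp_all add: cubic_form_def x)
    have "(t2 - t1) * (- 3*x1 + 3*x2*(t1+t2) - x3*(t1^2+t1*t2+t2^2)) =
        (x0 - 3*x1*t2 + 3*x2*t2^2 - x3*t2^3) - (x0 - 3*x1*t1 + 3*x2*t1^2 - x3*t1^3)"
      by (simp add: power2_eq_square power3_eq_cube algebra_simps)
    then have "(t2 - t1) * (- 3*x1 + 3*x2*(t1+t2) - x3*(t1^2+t1*t2+t2^2)) = 0" using f by simp
    then have "- 3*x1 + 3*x2*(t1+t2) - x3*(t1^2+t1*t2+t2^2) = 0" using t(2) by (metis mult_eq_0_iff right_minus_eq)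
    then have x1: "3*x1 = 3*x2*(t1+t2) - x3*(t1^2+t1*t2+t2^2)" by (simp add: algebra_simps)
    have x0: "x0 = 3*x1*t1 - 3*x2*t1^2 + x3*t1^3" using f(1) by (simp add: algebra_simps)
    \<comment> \<open>The three zeros have sum 3 x2 / x3.\<close>
    define t3 where "t3 = 3*x2/x3 - t1 - t2"
    have x2: "3*x2 = x3*(t1+t2+t3)" using False by (simp add: t3_def field_simps)
    have "cubic_form v y 1 = x3 * (t1 - y) * (t2 - y) * (t3 - y)" for y
    proof -
      have "cubic_form v y 1 = 3*x1*(t1 - y) - 3*x2*(t1^2 - y^2) + x3*(t1^3 - y^3)"
        by (simp add: cubic_form_def x x0 algebra_simps)
      also have "\<dots> = x3 * (t1 - y) * (t2 - y) * (t3 - y)" unfolding x1 x2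
        by (simp add: power2_eq_square power3_eq_cube algebra_simps)
      finally show ?thesis .
    qed
    then have "Some t3 \<in> roots v" by simp
    then have "t3 = t1 \<or> t3 = t2" using t by auto
    \<comment> \<open>Both cases are merged by calling the repeated zero y and the other one
      w.\<close>
    then obtain y w where yw: "3*x2 = x3 * (2*y + w)" "3*x1 = 3*x2*(y+w) - x3*(y^2+y*w+w^2)"
       "x0 = 3*x1*y - 3*x2*y^2 + x3*y^3" 
    proof
      assume "t3 = t1"
      then show thesis using that[of t1 t2] x1 x2 x0 by (simp add: algebra_simps)
    next
      assume "t3 = t2"
      then show thesis using that[of t2 t1] x1 x2 f(2) by (simp add: algebra_simps)
    qed
    have "3 * x1 = 3 * (2*y*x2 - y^2*x3)"
    proof -
      have "3*x1 = x3 * (2*y + w) * (y+w) - x3*(y^2+y*w+w^2)" using yw(1,2) by simp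
      also have "\<dots> = 2*y*(x3 * (2*y + w)) - 3 * y^2*x3" by (simp add: power2_eq_square algebra_simps)
      also have "\<dots> = 3 * (2*y*x2 - y^2*x3)" unfolding yw(1)[symmetric] by (simp add: algebra_simps)
      finally show ?thesis .
    qed
    then have 1: "x1 = 2*y*x2 - y^2*x3" using three mult_left_cancel by blast
    have "on_tangent_at v (Some y)" using yw(3)
      by (simp add: on_tangent_at_def x 1 power2_eq_square power3_eq_cube algebra_simps)
    then show ?thesis ..
  qed
qed

lemma is_T_point_iff:
  assumes three: "(3::'a::field) \<noteq> 0" and v: "(v :: 'a ^ 4) \<noteq> 0"
  shows "is_T_point (proj v) \<longleftrightarrow> nroots v = 2"
proof
  assume "is_T_point (proj v)"
  then show "nroots v = 2" unfolding is_T_point_def tangent_line_iff[OF v]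
    using nroots_on_tangent[OF three v] by blast
next
  assume n: "nroots v = 2"
  have "proj v \<notin> twisted_cubic"
    using roots_smult_curve_vec[OF three, of v] n unfolding in_twisted_cubic_iff by auto
  then show "is_T_point (proj v)" unfolding is_T_point_def tangent_line_iff[OF v]
    using nroots_2_on_tangent[OF three n] v by simp
qed

lemma is_Gamma_point_iff:
  assumes three: "(3::'a::field) \<noteq> 0" and v: "(v :: 'a ^ 4) \<noteq> 0"
  shows "is_Gamma_point m (proj v) \<longleftrightarrow> proj v \<notin> twisted_cubic \<and> nroots v = m"
  unfolding is_Gamma_point_def card_Gamma_planes_through[OF assms] using v by simp

lemma nroots_cubic_point:
  "(3::'a::field) \<noteq> 0 \<Longrightarrow> proj (v::'a^4) \<in> twisted_cubic \<Longrightarrow> nroots v = 1"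
  unfolding in_twisted_cubic_iff using roots_smult_curve_vec by force

section \<open>The group of the twisted cubic\<close>

definition hom_curve :: "'a::field \<Rightarrow> 'a \<Rightarrow> 'a ^ 4" where
  "hom_curve t u = vec4 (t^3) (t^2 * u) (t * u^2) (u^3)"

lemma proj_hom_curve:
  assumes "t \<noteq> 0 \<or> u \<noteq> 0"
  obtains z where "proj (hom_curve t u) = proj (curve_vec z)"
proof (cases "u = 0")
  case True
  then have "hom_curve t u = t^3 *s curve_vec None" by (simp add: hom_curve_def curve_vec_def)
  then show ?thesis using that[of None] True assms by (simp add: proj_smult)
next
  case False
  then have "hom_curve t u = u^3 *s curve_vec (Some (t/u))"
    by (simp add: hom_curve_def curve_vec_def field_simps power2_eq_square power3_eq_cube)
  then show ?thesis using that[of "Some (t/u)"] False by (simp add: proj_smult)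
qed

lemma curve_vec_hom_curve:
  obtains t u where "t \<noteq> 0 \<or> u \<noteq> 0" "curve_vec z = hom_curve t u"
proof (cases z)
  case None
  then show ?thesis using that[of 1 0] by (simp add: curve_vec_def hom_curve_def)
next
  case (Some t)
  then show ?thesis using that[of t 1] by (simp add: curve_vec_def hom_curve_def)
qed

lemma sym3_hom_curve: "sym3 a b c d *v hom_curve t u = hom_curve (a*t + b * u) (c*t + d * u)"
  unfolding hom_curve_def by (rule sym3_cubic)

lemma sym3_inj:
  assumes "a*d - b*c \<noteq> 0" shows "inj ((*v) (sym3 a b c d))"
proof (rule injI)
  fix v w assume "sym3 a b c d *v v = sym3 a b c d *v w"
  then have "(a*d - b*c)^3 *s v = (a*d - b*c)^3 *s w" using sym3_adj(1) by metis
  then show "v = w" using assms by (simp add: vec_eq_iff)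
qed

lemma sym3_eq_0: "a*d - b*c \<noteq> 0 \<Longrightarrow> sym3 a b c d *v v = 0 \<longleftrightarrow> v = 0"
  using injD[OF sym3_inj, of a d b c v 0] by auto

lemma proj_map_inj: "inj ((*v) A) \<Longrightarrow> inj (proj_map A)"
  unfolding proj_map_def by (rule injI) (simp add: inj_image_eq_iff)

lemma sym3_in_Gq:
  assumes "a*d - b*c \<noteq> (0::'a::{field,finite})"
  shows "sym3 a b c d \<in> Gq"
proof -
  let ?M = "sym3 a b c d"
  have inv: "invertible ?M"
    using sym3_inj[OF assms] matrix_left_invertible_injective invertible_left_inverse by metis
  have nz: "a*t + b * u \<noteq> 0 \<or> c*t + d * u \<noteq> 0" if "t \<noteq> 0 \<or> u \<noteq> 0" for t u
  proof (rule ccontr)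
    assume "\<not> ?thesis"
    then have e: "a*t + b * u = 0" "c*t + d * u = 0" by auto
    have "(a*d - b*c) * t = d * (a*t + b * u) - b * (c*t + d * u)"
      "(a*d - b*c) * u = a * (c*t + d * u) - c * (a*t + b * u)"
      by (simp_all add: algebra_simps)
    then show False using e assms that by simp
  qed
  have "proj_map ?M (proj (curve_vec z)) \<in> twisted_cubic" for z
  proof -
    obtain t u where tu: "t \<noteq> 0 \<or> u \<noteq> 0" "curve_vec z = hom_curve t u" by (rule curve_vec_hom_curve)
    obtain z' where "proj (hom_curve (a*t + b * u) (c*t + d * u)) = proj (curve_vec z')"
      using proj_hom_curve[OF nz[OF tu(1)]] .
    then show ?thesis by (auto simp: proj_map_proj tu sym3_hom_curve in_twisted_cubic_iff)
  qed
  then have "proj_map ?M ` twisted_cubic \<subseteq> twisted_cubic" unfolding twisted_cubic_eq by auto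
  moreover have "inj_on (proj_map ?M) twisted_cubic"
    using proj_map_inj[OF sym3_inj[OF assms]] inj_on_subset by blast
  moreover have "finite (twisted_cubic :: ('a ^ 4) set set)" unfolding twisted_cubic_eq by simp
  ultimately have "proj_map ?M ` twisted_cubic = twisted_cubic" by (intro endo_inj_surj)
  then show ?thesis using inv by (simp add: Gq_def)
qed

lemma cubic_poly_eq_0:
  assumes q: "CARD('a::{field,finite}) \<ge> 5"
    and z: "\<And>t. t \<noteq> 0 \<Longrightarrow> a + b*t + c*t^2 + d*t^3 = (0::'a)"
  shows "a = 0 \<and> b = 0 \<and> c = 0 \<and> d = 0"
proof (rule ccontr)
  assume "\<not> ?thesis"
  then have "card {t. a + b*t + c*t^2 + d*t^3 = 0} \<le> 3" using card_roots_cubic_poly(1)[of a b c d] by auto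
  moreover have "card (- {0::'a}) \<le> card {t. a + b*t + c*t^2 + d*t^3 = 0}"
    by (rule card_mono) (use z in auto)
  moreover have "card (- {0::'a}) = CARD('a) - 1" by (simp add: Compl_eq_Diff_UNIV)
  ultimately show False using q by simp
qed

text \<open>The coordinates r0, ..., r3 of the image of P(t) satisfy r1 r3 = r2^2 and r0 r2 = r1^2.
  After removing the powers of t forced by the two fixed points, these are polynomials of degree at
  most 3 vanishing at all q - 1 >= 4 nonzero t, so their coefficients are 0.\<close>

lemma matrix_fixing_two_cubic_points:
  fixes B :: "'a::{field,finite} ^ 4 ^ 4"
  assumes q: "CARD('a) \<ge> 5"
    and inj: "inj ((*v) B)"
    and C: "\<And>z. proj (B *v curve_vec z) \<in> twisted_cubic"
    and inf: "proj (B *v curve_vec None) = proj (curve_vec None)"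
    and zero: "proj (B *v curve_vec (Some 0)) = proj (curve_vec (Some 0))"
  obtains a d k where "a \<noteq> 0" "d \<noteq> 0" "k \<noteq> 0" "\<And>v. B *v v = k *s (sym3 a 0 0 d *v v)"
proof -
  define m where "m i j = B $ i $ j" for i j
  have Bv: "B *v vec4 x0 x1 x2 x3 = vec4
     (m 0 0 * x0 + m 0 1 * x1 + m 0 2 * x2 + m 0 3 * x3)
     (m 1 0 * x0 + m 1 1 * x1 + m 1 2 * x2 + m 1 3 * x3)
     (m 2 0 * x0 + m 2 1 * x1 + m 2 2 * x2 + m 2 3 * x3)
     (m 3 0 * x0 + m 3 1 * x1 + m 3 2 * x2 + m 3 3 * x3)" for x0 x1 x2 x3
    by (simp add: vec_eq_index4 matrix_vector_mult_def sum_index4 m_def)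
  obtain k0 where "k0 \<noteq> 0" "B *v curve_vec None = k0 *s curve_vec None"
    using inf[symmetric] unfolding proj_eq_iff by auto
  then have c0: "m 1 0 = 0" "m 2 0 = 0" "m 3 0 = 0" "m 0 0 \<noteq> 0" by (auto simp: curve_vec_def Bv)
  obtain k3 where "k3 \<noteq> 0" "B *v curve_vec (Some 0) = k3 *s curve_vec (Some 0)"
    using zero[symmetric] unfolding proj_eq_iff by auto
  then have c3: "m 0 3 = 0" "m 1 3 = 0" "m 2 3 = 0" "m 3 3 \<noteq> 0" by (auto simp: curve_vec_def Bv)
  define r0 r1 r2 r3 where "r0 t = m 0 0 * t^3 + m 0 1 * t^2 + m 0 2 * t"
    and "r1 t = m 1 1 * t^2 + m 1 2 * t" and "r2 t = m 2 1 * t^2 + m 2 2 * t"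
    and "r3 t = m 3 1 * t^2 + m 3 2 * t + m 3 3" for t
  have BP: "B *v curve_vec (Some t) = vec4 (r0 t) (r1 t) (r2 t) (r3 t)" for t
    by (simp add: curve_vec_def Bv c0 c3 r0_def r1_def r2_def r3_def)
  have key: "r3 t \<noteq> 0 \<and> r1 t * r3 t = r2 t ^ 2 \<and> r0 t * r2 t = r1 t ^ 2" for t
  proof -
    obtain z where z: "proj (B *v curve_vec (Some t)) = proj (curve_vec z)"
      using C in_twisted_cubic_iff by blast
    then obtain k where k: "k \<noteq> 0" "B *v curve_vec (Some t) = k *s curve_vec z"
      using z[symmetric] unfolding proj_eq_iff by auto
    show ?thesis
    proof (cases z)
      \<comment> \<open>The last coordinate vanishes on the cubic only at infinity, which is already
        the image of infinity; hence r3 is never 0.\<close>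
      case None
      then have "proj (B *v curve_vec (Some t)) = proj (B *v curve_vec None)" using z inf by simp
      then have "proj_map B (proj (curve_vec (Some t))) = proj_map B (proj (curve_vec None))"
        by (simp add: proj_map_proj)
      then have "proj (curve_vec (Some t)) = proj (curve_vec None)" using proj_map_inj[OF inj] by (metis injD)
      then show ?thesis using proj_curve_vec_inj by (metis injD option.distinct(1))
    next
      case (Some y)
      then have "r0 t = k * y^3" "r1 t = k * y^2" "r2 t = k * y" "r3 t = k"
        using k BP[of t] by (auto simp: curve_vec_def)
      then show ?thesis using k by (simp add: power2_eq_square power3_eq_cube)
    qed
  qed
  have p1: "m 1 2 * m 3 3 + (m 1 1 * m 3 3 + m 1 2 * m 3 2 - m 2 2 ^ 2) * t
      + (m 1 1 * m 3 2 + m 1 2 * m 3 1 - 2 * m 2 1 * m 2 2) * t^2 + (m 1 1 * m 3 1 - m 2 1 ^ 2) * t^3 = 0"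
    if "t \<noteq> 0" for t
  proof -
    have "t * (m 1 2 * m 3 3 + (m 1 1 * m 3 3 + m 1 2 * m 3 2 - m 2 2 ^ 2) * t
      + (m 1 1 * m 3 2 + m 1 2 * m 3 1 - 2 * m 2 1 * m 2 2) * t^2 + (m 1 1 * m 3 1 - m 2 1 ^ 2) * t^3)
      = r1 t * r3 t - r2 t ^ 2"
      by (simp add: r1_def r2_def r3_def power2_eq_square power3_eq_cube algebra_simps)
    also have "\<dots> = 0" using key by simp
    finally show ?thesis using that by (metis mult_eq_0_iff)
  qed
  note e1 = cubic_poly_eq_0[OF q p1]
  have m12: "m 1 2 = 0" using e1 c3 by auto
  have e: "m 1 1 * m 3 3 = m 2 2 ^ 2" "m 1 1 * m 3 2 = 2 * m 2 1 * m 2 2" "m 1 1 * m 3 1 = m 2 1 ^ 2"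
    using e1 m12 by auto
  have m11: "m 1 1 \<noteq> 0"
  proof
    assume 0: "m 1 1 = 0"
    obtain w where "B *v w = vec4 0 1 0 0" using inj finite_UNIV_inj_surj[OF _ inj] by (metis finite surjD)
    moreover obtain x0 x1 x2 x3 where "w = vec4 x0 x1 x2 x3" by (rule vec4_exhaust)
    ultimately show False using Bv 0 m12 c0 c3 by auto
  qed
  have m21: "m 2 1 = 0"
  proof (rule ccontr)
    assume n: "m 2 1 \<noteq> 0"
    \<comment> \<open>The relations make m11 r3 the square of m21 t + m22, so r3 would vanish at the
      zero of that expression.\<close>
    define t where "t = - m 2 2 / m 2 1"
    have "m 1 1 * r3 t = (m 2 1 * t + m 2 2) ^ 2"
    proof -
      have "m 1 1 * r3 t = (m 1 1 * m 3 1) * t^2 + (m 1 1 * m 3 2) * t + m 1 1 * m 3 3"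
        by (simp add: r3_def algebra_simps)
      then show ?thesis unfolding e by (simp add: power2_eq_square algebra_simps)
    qed
    also have "\<dots> = 0" using n by (simp add: t_def)
    finally show False using m11 key by auto
  qed
  have m3: "m 3 1 = 0" "m 3 2 = 0" using e m11 m21 by auto
  have m22: "m 2 2 \<noteq> 0" using e m11 c3 by auto
  have p0: "m 2 2 * m 0 2 + (m 2 2 * m 0 1) * t + (m 2 2 * m 0 0 - m 1 1 ^ 2) * t^2 + 0 * t^3 = 0"
    if "t \<noteq> 0" for t
  proof -
    have "t^2 * (m 2 2 * m 0 2 + (m 2 2 * m 0 1) * t + (m 2 2 * m 0 0 - m 1 1 ^ 2) * t^2)
      = r0 t * r2 t - r1 t ^ 2"
      by (simp add: r1_def r2_def r0_def m21 m12 power2_eq_square power3_eq_cube algebra_simps)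
    also have "\<dots> = 0" using key by simp
    finally show ?thesis using that by simp
  qed
  note e0 = cubic_poly_eq_0[OF q p0]
  have m0: "m 0 1 = 0" "m 0 2 = 0" "m 2 2 * m 0 0 = m 1 1 ^ 2" using e0 m22 by auto
  \<comment> \<open>\<open>sym3 a 0 0 d\<close> has diagonal a^3, a^2 d, a d^2, d^3. For a = m11 and
    d = m22 the second entry requires k m11^2 m22 = m11.\<close>
  define k where "k = inverse (m 1 1 * m 2 2)"
  show ?thesis
  proof (rule that)
    show "m 1 1 \<noteq> 0" "m 2 2 \<noteq> 0" by fact+
    show "k \<noteq> 0" using m11 m22 by (simp add: k_def)
    fix v :: "'a ^ 4"
    obtain x0 x1 x2 x3 where v: "v = vec4 x0 x1 x2 x3" by (rule vec4_exhaust)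
    have k: "k * m 1 1 ^ 3 = m 0 0" "k * (m 1 1 ^ 2 * m 2 2) = m 1 1" "k * (m 1 1 * m 2 2 ^ 2) = m 2 2" "k * m 2 2 ^ 3 = m 3 3"
      using m11 m22 m0(3) e(1) by (simp_all add: k_def field_simps power2_eq_square power3_eq_cube)
    show "B *v v = k *s (sym3 (m 1 1) 0 0 (m 2 2) *v v)"
      unfolding v Bv sym3_mult_vec by (simp add: c0 c3 m12 m21 m3 m0 flip: mult.assoc) (metis k mult.assoc)
  qed
qed

lemma Gq_sym3:
  fixes A :: "'a::{field,finite} ^ 4 ^ 4"
  assumes q: "CARD('a) \<ge> 5" and A: "A \<in> Gq"
  obtains a b c d k where "a*d - b*c \<noteq> 0" "k \<noteq> 0" "\<And>v. A *v v = k *s (sym3 a b c d *v v)"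
proof -
  have inv: "invertible A" and AC: "proj_map A ` twisted_cubic = twisted_cubic" using A by (auto simp: Gq_def)
  have injA: "inj ((*v) A)"
    using inv matrix_left_invertible_injective invertible_left_inverse by metis
  have PA: "proj (A *v curve_vec z) \<in> twisted_cubic" for z
    using AC proj_map_proj[of A "curve_vec z"] unfolding twisted_cubic_eq by blast
  obtain z1 z2 where z: "proj (A *v curve_vec None) = proj (curve_vec z1)"
     "proj (A *v curve_vec (Some 0)) = proj (curve_vec z2)"
    using PA[of None] PA[of "Some 0"] in_twisted_cubic_iff by metis
  obtain t1 u1 where 1: "t1 \<noteq> 0 \<or> u1 \<noteq> 0" "curve_vec z1 = hom_curve t1 u1" by (rule curve_vec_hom_curve)
  obtain t2 u2 where 2: "t2 \<noteq> 0 \<or> u2 \<noteq> 0" "curve_vec z2 = hom_curve t2 u2" by (rule curve_vec_hom_curve)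
  have "z1 \<noteq> z2"
  proof
    assume "z1 = z2"
    then have "proj_map A (proj (curve_vec None)) = proj_map A (proj (curve_vec (Some 0)))"
      using z by (simp add: proj_map_proj)
    then have "proj (curve_vec None :: 'a^4) = proj (curve_vec (Some 0))" using proj_map_inj[OF injA] by (metis injD)
    then show False using proj_curve_vec_inj by (metis injD option.distinct(1))
  qed
  have det: "u2 * (- t1) - (- t2) * u1 \<noteq> 0"
  proof
    assume e: "u2 * (- t1) - (- t2) * u1 = 0"
    then have e: "t2 * u1 = t1 * u2" by (simp add: algebra_simps)
    obtain k where "k \<noteq> 0" "t2 = k * t1" "u2 = k * u1"
    proof (cases "t1 = 0")
      case True
      then show ?thesis using that[of "u2/u1"] 1 2 e by auto
    next
      case False
      then have "t2 \<noteq> 0" using 2 e by auto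
      then show ?thesis using that[of "t2/t1"] False e by (simp add: field_simps)
    qed
    then have "curve_vec z2 = k^3 *s curve_vec z1" unfolding 1 2 hom_curve_def
      by (simp add: power_mult_distrib power2_eq_square power3_eq_cube)
    then have "proj (curve_vec z2) = proj (curve_vec z1)" using \<open>k \<noteq> 0\<close> by (simp add: proj_smult)
    then show False using \<open>z1 \<noteq> z2\<close> proj_curve_vec_inj by (metis injD)
  qed
  \<comment> \<open>This substitution sends (t1, u1) to a multiple of (1, 0) and (t2, u2) to a
    multiple of (0, 1), undoing A at the two base points.\<close>
  define H where "H = sym3 u2 (- t2) u1 (- t1)"
  have HG: "H \<in> Gq" unfolding H_def by (rule sym3_in_Gq) fact
  define B where "B = H ** A"
  have Bv: "B *v v = H *v (A *v v)" for v by (simp add: B_def matrix_vector_mul_assoc)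
  have BP: "proj (B *v v) = proj_map H (proj (A *v v))" for v by (simp add: Bv proj_map_proj)
  have "inj ((*v) B)"
    using inj_compose[OF sym3_inj[OF det] injA] unfolding H_def[symmetric] by (simp add: comp_def flip: Bv)
  moreover have "proj (B *v curve_vec z) \<in> twisted_cubic" for z
    using BP PA HG unfolding Gq_def by blast
  moreover have "proj (B *v curve_vec None) = proj (curve_vec None)"
  proof -
    have "H *v curve_vec z1 = (u2*t1 - t2*u1)^3 *s curve_vec None"
      unfolding 1 H_def sym3_hom_curve by (simp add: hom_curve_def curve_vec_def algebra_simps)
    then show ?thesis unfolding BP z proj_map_proj using det by (simp add: proj_smult algebra_simps)
  qed
  moreover have "proj (B *v curve_vec (Some 0)) = proj (curve_vec (Some 0))"
  proof -
    have "H *v curve_vec z2 = (u1*t2 - t1*u2)^3 *s curve_vec (Some 0)"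
      unfolding 2 H_def sym3_hom_curve by (simp add: hom_curve_def curve_vec_def algebra_simps)
    then show ?thesis unfolding BP z proj_map_proj using det by (simp add: proj_smult algebra_simps)
  qed
  ultimately obtain a d k where k: "a \<noteq> 0" "d \<noteq> 0" "k \<noteq> 0" "\<And>v. B *v v = k *s (sym3 a 0 0 d *v v)"
    using matrix_fixing_two_cubic_points[OF q] by metis
  define D where "D = (u2 * (- t1) - (- t2) * u1)^3"
  have D: "D \<noteq> 0" using det by (simp add: D_def)
  have AD: "D *s (A *v v) = k *s (sym3 (- t1) t2 (- u1) u2 *v (sym3 a 0 0 d *v v))" for v
  proof -
    have "D *s (A *v v) = sym3 (- t1) t2 (- u1) u2 *v (B *v v)"
      using sym3_adj(1)[where a = u2 and b = "-t2" and c = u1 and d = "-t1" and v = "A *v v"] by (simp add: D_def H_def Bv)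
    then show ?thesis unfolding k by (simp add: vec.scale)
  qed
  have "A *v v = (k / D) *s (sym3 (- t1 * a) (t2 * d) (- u1 * a) (u2 * d) *v v)" for v
  proof -
    have "A *v v = inverse D *s (D *s (A *v v))" using D by (simp add: vector_smult_assoc)
    then show ?thesis unfolding AD sym3_comp by (simp add: vector_smult_assoc divide_inverse mult.commute)
  qed
  moreover have "(- t1 * a) * (u2 * d) - (t2 * d) * (- u1 * a) = (a * d) * (u2 * (- t1) - (- t2) * u1)"
    by (simp add: algebra_simps)
  ultimately show ?thesis using that[of "- t1 * a" "u2 * d" "t2 * d" "- u1 * a" "k / D"] k D det by auto
qed

section \<open>Quadratic and cubic extensions of a finite field\<close>

text \<open>Multiplication by a nonzero x permutes S - {0}; comparing products gives x^(card S - 1)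
  = 1, as in Fermat's little theorem.\<close>

lemma power_card_mult_closed:
  fixes S :: "'b::field set"
  assumes fin: "finite S" and zero: "0 \<in> S"
    and closed: "\<And>x y. x \<in> S \<Longrightarrow> y \<in> S \<Longrightarrow> x * y \<in> S" and x: "x \<in> S"
  shows "x ^ card S = x"
proof -
  define U where "U = S - {0}"
  have "finite U" using fin by (simp add: U_def)
  have c: "card S = Suc (card U)" using fin zero unfolding U_def by (rule card.remove)
  show ?thesis
  proof (cases "x = 0")
    case True
    then show ?thesis by (simp add: c)
  next
    case False
    have inj: "inj_on ((*) x) U" using False by (auto intro: inj_onI)
    have "(*) x ` U \<subseteq> U" using closed x False by (auto simp: U_def)
    then have im: "(*) x ` U = U" using inj \<open>finite U\<close> by (simp add: endo_inj_surj)
    have "(\<Prod>y\<in>U. y) = (\<Prod>y\<in>(*) x ` U. y)" using im by simp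
    also have "\<dots> = (\<Prod>y\<in>U. x * y)" using inj by (simp add: prod.reindex)
    also have "\<dots> = x ^ card U * (\<Prod>y\<in>U. y)" by (simp add: prod.distrib)
    finally have "x ^ card U = 1" using \<open>finite U\<close> by (auto simp: U_def)
    then show ?thesis by (simp add: c)
  qed
qed

lemma card_power_fixed:
  assumes "N \<ge> 2"
  shows "finite {x::'b::field. x ^ N = x}" "card {x::'b::field. x ^ N = x} \<le> N"
proof -
  let ?p = "Polynomial.monom 1 N - Polynomial.monom 1 1 :: 'b poly"
  have "poly.coeff ?p N = 1" using assms by simp
  then have ne: "?p \<noteq> 0" by (metis coeff_0 zero_neq_one)
  have e: "{x::'b. x ^ N = x} = {x. poly ?p x = 0}" by (simp add: poly_monom)
  have "Polynomial.degree ?p \<le> N"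
    by (rule order.trans[OF degree_diff_le_max]) (use assms in \<open>simp add: degree_monom_eq\<close>)
  then show "card {x::'b. x ^ N = x} \<le> N" unfolding e using card_poly_roots_bound[OF ne] by linarith
  show "finite {x::'b. x ^ N = x}" unfolding e using poly_roots_finite[OF ne] .
qed

text \<open>The N elements of S exhaust the zeros of x^N - x. Hence two extensions of the same
  degree coincide as subsets of the algebraic closure, whichever root generates them.\<close>

lemma mult_closed_eq_power_fixed:
  fixes S :: "'b::field set"
  assumes "card S = N" "N \<ge> 2" "0 \<in> S" "\<And>x y. x \<in> S \<Longrightarrow> y \<in> S \<Longrightarrow> x * y \<in> S"
  shows "S = {x. x ^ N = x}"
proof -
  have fin: "finite S" using assms(1,2) by (auto intro: card_ge_0_finite)
  have "S \<subseteq> {x. x ^ N = x}" using power_card_mult_closed[OF fin assms(3,4)] assms(1) by auto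
  then show ?thesis using card_power_fixed[OF assms(2), where 'b = 'b] assms(1) by (simp add: card_seteq)
qed

lemma quadratic_ext_eq:
  fixes b c :: "'a::{field,finite}"
  assumes irr: "\<And>t. t^2 + b*t + c \<noteq> 0"
    and \<theta>: "\<theta>^2 + to_ac b * \<theta> + to_ac c = 0"
  shows "\<theta> \<notin> range to_ac"
    and "range (\<lambda>(r, s). to_ac r + to_ac s * \<theta>) = {x. x ^ (CARD('a)^2) = x}"
proof -
  show nK: "\<theta> \<notin> range to_ac"
  proof
    assume "\<theta> \<in> range to_ac"
    then obtain t where "\<theta> = to_ac t" by auto
    then have "to_ac (t^2 + b*t + c) = 0" using \<theta> by simp
    then show False using irr to_ac_eq_0_iff by blast
  qed
  let ?f = "\<lambda>(r, s). to_ac r + to_ac s * \<theta>"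
  have inj: "inj ?f"
  proof (rule injI, clarify)
    fix r s r' s' :: 'a assume e: "to_ac r + to_ac s * \<theta> = to_ac r' + to_ac s' * \<theta>"
    have "s = s'"
    proof (rule ccontr)
      assume "s \<noteq> s'"
      have "to_ac (s - s') * \<theta> = to_ac (r' - r)" using e by (simp add: algebra_simps)
      then have "\<theta> = to_ac ((r' - r) / (s - s'))" using \<open>s \<noteq> s'\<close> by (simp add: field_simps)
      then show False using nK by blast
    qed
    then show "r = r' \<and> s = s'" using e by simp
  qed
  show "range ?f = {x. x ^ (CARD('a)^2) = x}"
  proof (rule mult_closed_eq_power_fixed)
    show "card (range ?f) = CARD('a)^2" using inj by (simp add: card_image power2_eq_square)
    have "2 * 2 \<le> CARD('a) * CARD('a)" using CARD_field_gt_1[where 'a = 'a] by (intro mult_mono) auto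
    then show "2 \<le> CARD('a)^2" unfolding power2_eq_square by simp
    show "0 \<in> range ?f" by (rule range_eqI[of _ _ "(0, 0)"]) simp
    fix x y assume "x \<in> range ?f" "y \<in> range ?f"
    then obtain r s r' s' where xy: "x = to_ac r + to_ac s * \<theta>" "y = to_ac r' + to_ac s' * \<theta>" by auto
    have t2: "\<theta>^2 = - to_ac c - to_ac b * \<theta>" using \<theta> by (simp add: algebra_simps eq_neg_iff_add_eq_0)
    have "x * y = to_ac (r*r') + to_ac (r* s' + s*r') * \<theta> + to_ac (s* s') * \<theta>^2"
      by (simp add: xy power2_eq_square algebra_simps)
    also have "\<dots> = ?f (r*r' - s* s'*c, r* s' + s*r' - s* s'*b)"
      unfolding t2 by (simp add: algebra_simps)
    finally show "x * y \<in> range ?f" by blast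
  qed
qed

text \<open>A root phi of the second polynomial lies in the span of 1 and a root theta of the first:
  phi = beta + alpha theta. Expanding the equation of phi in the basis 1, theta gives the two
  relations.\<close>

lemma irreducible_quadratics_affine_equiv:
  fixes b c b' c' :: "'a::{field,finite}"
  assumes irr: "\<And>t. t^2 + b*t + c \<noteq> 0" "\<And>t. t^2 + b'*t + c' \<noteq> 0"
  obtains \<alpha> \<beta> where "\<alpha> \<noteq> 0" "2*\<beta> + b' = \<alpha>*b" "\<beta>^2 + b'*\<beta> + c' = \<alpha>^2*c"
proof -
  have root: "\<exists>\<theta>. \<theta>^2 + to_ac r * \<theta> + to_ac s = 0" for r s :: 'a
  proof -
    have "\<exists>\<theta>. poly [:to_ac s, to_ac r, 1:] \<theta> = 0" by (rule alg_closed_imp_poly_has_root) simp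
    then show ?thesis by (simp add: power2_eq_square algebra_simps)
  qed
  obtain \<theta> where \<theta>: "\<theta>^2 + to_ac b * \<theta> + to_ac c = 0" using root by blast
  obtain \<phi> where \<phi>: "\<phi>^2 + to_ac b' * \<phi> + to_ac c' = 0" using root by blast
  note T = quadratic_ext_eq[OF irr(1) \<theta>] and P = quadratic_ext_eq[OF irr(2) \<phi>]
  have "\<phi> \<in> range (\<lambda>(r, s). to_ac r + to_ac s * \<phi>)" by (rule range_eqI[of _ _ "(0, 1)"]) simp
  then have "\<phi> \<in> range (\<lambda>(r, s). to_ac r + to_ac s * \<theta>)" unfolding T(2) P(2) .
  then obtain \<beta> \<alpha> where \<phi>e: "\<phi> = to_ac \<beta> + to_ac \<alpha> * \<theta>" by auto
  have \<alpha>: "\<alpha> \<noteq> 0" using \<phi>e P(1) by auto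
  have t2: "\<theta>^2 = - to_ac c - to_ac b * \<theta>" using \<theta> by (simp add: algebra_simps eq_neg_iff_add_eq_0)
  have "0 = to_ac (\<beta>^2 + b'*\<beta> + c') + to_ac (2*\<alpha>*\<beta> + b'*\<alpha>) * \<theta> + to_ac (\<alpha>^2) * \<theta>^2"
    using \<phi> unfolding \<phi>e by (simp add: power2_eq_square algebra_simps)
  also have "\<dots> = to_ac (\<beta>^2 + b'*\<beta> + c' - \<alpha>^2*c) + to_ac (\<alpha> * (2*\<beta> + b' - \<alpha>*b)) * \<theta>"
    unfolding t2 by (simp add: power2_eq_square algebra_simps)
  finally have z: "to_ac (\<beta>^2 + b'*\<beta> + c' - \<alpha>^2*c) + to_ac (\<alpha> * (2*\<beta> + b' - \<alpha>*b)) * \<theta> = 0" ..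
  have w: "2*\<beta> + b' - \<alpha>*b = 0"
  proof (rule ccontr)
    assume n: "2*\<beta> + b' - \<alpha>*b \<noteq> 0"
    define m where "m = \<alpha> * (2*\<beta> + b' - \<alpha>*b)"
    have "m \<noteq> 0" using n \<alpha> by (simp add: m_def)
    then have "\<theta> = to_ac (- (\<beta>^2 + b'*\<beta> + c' - \<alpha>^2*c) / m)"
      using z unfolding m_def[symmetric] by (simp add: field_simps eq_neg_iff_add_eq_0)
    then show False using T(1) by blast
  qed
  then have "to_ac (\<beta>^2 + b'*\<beta> + c' - \<alpha>^2*c) = 0" using z by (simp only: mult_zero_right to_ac_0 mult_zero_left add_0_right)
  then have "\<beta>^2 + b'*\<beta> + c' = \<alpha>^2*c" by (metis to_ac_eq_0_iff right_minus_eq)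
  then show ?thesis using that[OF \<alpha>, of \<beta>] w by simp
qed

lemma cubic_ext_eq:
  fixes e0 e1 e2 :: "'a::{field,finite}"
  assumes irr: "\<And>t. t^3 \<noteq> e0 + e1*t + e2*t^2"
    and \<theta>: "\<theta>^3 = to_ac e0 + to_ac e1 * \<theta> + to_ac e2 * \<theta>^2"
  shows "\<theta> \<notin> range to_ac"
    and "to_ac r + to_ac s * \<theta> + to_ac t * \<theta>^2 = 0 \<longleftrightarrow> r = 0 \<and> s = 0 \<and> t = 0"
    and "range (\<lambda>(r, s, t). to_ac r + to_ac s * \<theta> + to_ac t * \<theta>^2) = {x. x ^ (CARD('a)^3) = x}"
proof -
  show nK: "\<theta> \<notin> range to_ac"
  proof
    assume "\<theta> \<in> range to_ac"
    then obtain t where "\<theta> = to_ac t" by auto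
    then have "to_ac (t^3) = to_ac (e0 + e1*t + e2*t^2)" using \<theta> by simp
    then show False using irr to_ac_eq_iff by blast
  qed
  have lin: "s = 0 \<and> r = 0" if "to_ac r + to_ac s * \<theta> = 0" for r s
  proof -
    have "s = 0"
    proof (rule ccontr)
      assume "s \<noteq> 0"
      then have "\<theta> = to_ac (- r / s)" using that by (simp add: field_simps eq_neg_iff_add_eq_0)
      then show False using nK by blast
    qed
    then show ?thesis using that by simp
  qed
  have ind: "to_ac r + to_ac s * \<theta> + to_ac t * \<theta>^2 = 0 \<longleftrightarrow> r = 0 \<and> s = 0 \<and> t = 0" for r s t
  proof
    assume z: "to_ac r + to_ac s * \<theta> + to_ac t * \<theta>^2 = 0"
    have "t = 0"
    proof (rule ccontr)
      assume t: "t \<noteq> 0"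
      define p m where "p = - s / t" and "m = - r / t"
      have t2: "\<theta>^2 = to_ac m + to_ac p * \<theta>"
        using z t by (simp add: p_def m_def field_simps eq_neg_iff_add_eq_0)
      have "\<theta>^3 = \<theta> * (to_ac m + to_ac p * \<theta>)" unfolding t2[symmetric] by (simp add: power2_eq_square power3_eq_cube)
      also have "\<dots> = to_ac m * \<theta> + to_ac p * \<theta>^2" by (simp add: power2_eq_square algebra_simps)
      finally have "to_ac (p * m - e0 - e2 * m) + to_ac (p^2 + m - e1 - e2 * p) * \<theta> = 0"
        using \<theta> unfolding t2 by (simp add: power2_eq_square algebra_simps)
      then have e: "p^2 + m - e1 - e2 * p = 0" "p * m - e0 - e2 * m = 0" using lin by blast+
      \<comment> \<open>If theta satisfied t^2 = m + pt, dividing the cubic by this quadratic would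
        leave the factor t - (e2 - p), hence a zero in the ground field.\<close>
      have "(e2 - p)^3 - (e0 + e1*(e2 - p) + e2*(e2 - p)^2) = (p * m - e0 - e2 * m) + (e2 - p) * (p^2 + m - e1 - e2 * p)"
        by (simp add: power2_eq_square power3_eq_cube algebra_simps)
      then have "(e2 - p)^3 = e0 + e1*(e2 - p) + e2*(e2 - p)^2" unfolding e by simp
      then show False using irr by blast
    qed
    then show "r = 0 \<and> s = 0 \<and> t = 0" using z lin[of r s] by simp
  qed simp
  then show "to_ac r + to_ac s * \<theta> + to_ac t * \<theta>^2 = 0 \<longleftrightarrow> r = 0 \<and> s = 0 \<and> t = 0" .
  let ?f = "\<lambda>(r, s, t). to_ac r + to_ac s * \<theta> + to_ac t * \<theta>^2"
  have inj: "inj ?f"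
  proof (rule injI)
    fix p p' assume e: "?f p = ?f p'"
    obtain r s t where p: "p = (r, s, t)" by (metis prod_cases3)
    obtain r' s' t' where p': "p' = (r', s', t')" by (metis prod_cases3)
    have "to_ac r + to_ac s * \<theta> + to_ac t * \<theta>^2 = to_ac r' + to_ac s' * \<theta> + to_ac t' * \<theta>^2"
      using e by (simp add: p p')
    then have "to_ac (r - r') + to_ac (s - s') * \<theta> + to_ac (t - t') * \<theta>^2 = 0" by (simp add: algebra_simps)
    then show "p = p'" unfolding ind p p' by simp
  qed
  show "range ?f = {x. x ^ (CARD('a)^3) = x}"
  proof (rule mult_closed_eq_power_fixed)
    show "card (range ?f) = CARD('a)^3" using inj by (simp add: card_image power3_eq_cube)
    have "2 * 2 * 2 \<le> CARD('a) * CARD('a) * CARD('a)" using CARD_field_gt_1[where 'a = 'a] by (intro mult_mono) auto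
    then show "2 \<le> CARD('a)^3" unfolding power3_eq_cube by simp
    show "0 \<in> range ?f" by (rule range_eqI[of _ _ "(0, 0, 0)"]) simp
    fix x y assume "x \<in> range ?f" "y \<in> range ?f"
    then obtain r s t r' s' t' where xy: "x = to_ac r + to_ac s * \<theta> + to_ac t * \<theta>^2"
      "y = to_ac r' + to_ac s' * \<theta> + to_ac t' * \<theta>^2" by auto
    have t4: "\<theta>^4 = to_ac (e0*e2) + to_ac (e0 + e1*e2) * \<theta> + to_ac (e1 + e2*e2) * \<theta>^2"
    proof -
      have "\<theta>^4 = \<theta> * \<theta>^3" by (simp add: eval_nat_numeral)
      also have "\<dots> = to_ac e0 * \<theta> + to_ac e1 * \<theta>^2 + to_ac e2 * \<theta>^3"
        by (subst \<theta>) (simp add: power2_eq_square power3_eq_cube algebra_simps)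
      also have "\<dots> = to_ac (e0*e2) + to_ac (e0 + e1*e2) * \<theta> + to_ac (e1 + e2*e2) * \<theta>^2"
        unfolding \<theta> by (simp add: algebra_simps)
      finally show ?thesis .
    qed
    define A0 A1 A2 A3 A4 where "A0 = r*r'" and "A1 = r* s' + s*r'" and "A2 = r*t' + s* s' + t*r'"
      and "A3 = s*t' + t* s'" and "A4 = t*t'"
    have "x * y = to_ac A0 + to_ac A1 * \<theta> + to_ac A2 * \<theta>^2 + to_ac A3 * \<theta>^3 + to_ac A4 * \<theta>^4"
      by (simp add: xy A0_def A1_def A2_def A3_def A4_def eval_nat_numeral algebra_simps)
    also have "\<dots> = ?f (A0 + A3*e0 + A4*(e0*e2), A1 + A3*e1 + A4*(e0 + e1*e2), A2 + A3*e2 + A4*(e1 + e2*e2))"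
      unfolding t4 \<theta> by (simp add: algebra_simps)
    finally show "x * y \<in> range ?f" by blast
  qed
qed

text \<open>The expressions a theta + b + (c theta + d) phi have q^4 parameter tuples but values in
  a set of at most q^3 elements, so two tuples collide and their difference is the relation. A zero
  determinant would put phi into the ground field.\<close>

lemma cubic_roots_moebius:
  fixes \<theta> \<phi> :: "'a::{field,finite} alg_closure"
  assumes irr: "\<And>t. t^3 \<noteq> e0 + e1*t + e2*t^2" "\<And>t. t^3 \<noteq> f0 + f1*t + f2*t^2"
    and \<theta>: "\<theta>^3 = to_ac e0 + to_ac e1 * \<theta> + to_ac e2 * \<theta>^2"
    and \<phi>: "\<phi>^3 = to_ac f0 + to_ac f1 * \<phi> + to_ac f2 * \<phi>^2"
  obtains a b c d where "a*d - b*c \<noteq> 0" "to_ac a * \<theta> + to_ac b = (to_ac c * \<theta> + to_ac d) * \<phi>"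
proof -
  note T = cubic_ext_eq[OF irr(1) \<theta>] and P = cubic_ext_eq[OF irr(2) \<phi>]
  define S where "S = {x :: 'a alg_closure. x ^ (CARD('a)^3) = x}"
  let ?g = "\<lambda>(r, s, t). to_ac r + to_ac s * \<theta> + to_ac t * \<theta>^2"
  have S: "S = range ?g" using T(3) by (simp add: S_def)
  have add: "x + y \<in> S" if xS: "x \<in> S" and yS: "y \<in> S" for x y
  proof -
    obtain r s t where "x = ?g (r, s, t)" using xS unfolding S by force
    moreover obtain r' s' t' where "y = ?g (r', s', t')" using yS unfolding S by force
    ultimately have "x + y = ?g (r + r', s + s', t + t')" by (simp add: algebra_simps)
    then show ?thesis unfolding S by blast
  qed
  have mult: "x * y \<in> S" if "x \<in> S" "y \<in> S" for x y using that by (simp add: S_def power_mult_distrib)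
  have K: "to_ac r \<in> S" for r unfolding S by (rule range_eqI[of _ _ "(r, 0, 0)"]) simp
  have \<theta>S: "\<theta> \<in> S" unfolding S by (rule range_eqI[of _ _ "(0, 1, 0)"]) simp
  have \<phi>S: "\<phi> \<in> S" unfolding S_def P(3)[symmetric] by (rule range_eqI[of _ _ "(0, 1, 0)"]) simp
  let ?f = "\<lambda>(a, b, c, d). to_ac a * \<theta> + to_ac b + (to_ac c * \<theta> + to_ac d) * \<phi>"
  have fS: "range ?f \<subseteq> S" using add mult K \<theta>S \<phi>S by auto
  have "finite S" unfolding S by simp
  have "card S \<le> CARD('a)^3" unfolding S
    by (rule order.trans[OF card_image_le]) (simp_all add: power3_eq_cube)
  then have "card (range ?f) \<le> CARD('a)^3" using card_mono[OF \<open>finite S\<close> fS] by linarith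
  moreover have "CARD('a)^3 < CARD('a \<times> 'a \<times> 'a \<times> 'a)"
    using CARD_field_gt_1[where 'a = 'a] by (simp add: power3_eq_cube)
  ultimately have "card (range ?f) \<noteq> CARD('a \<times> 'a \<times> 'a \<times> 'a)" by linarith
  then have "\<not> inj ?f" using card_image by blast
  then obtain p p' where pp: "p \<noteq> p'" "?f p = ?f p'" unfolding inj_def by blast
  obtain a0 b0 c0 d0 where p: "p = (a0, b0, c0, d0)" by (metis prod_cases4)
  obtain a1 b1 c1 d1 where p': "p' = (a1, b1, c1, d1)" by (metis prod_cases4)
  define a b c d where "a = a0 - a1" and "b = b0 - b1" and "c = c1 - c0" and "d = d1 - d0"
  have nz: "a \<noteq> 0 \<or> b \<noteq> 0 \<or> c \<noteq> 0 \<or> d \<noteq> 0" using pp p p' by (auto simp: a_def b_def c_def d_def)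
  have rel: "to_ac a * \<theta> + to_ac b = (to_ac c * \<theta> + to_ac d) * \<phi>"
    using pp(2) by (simp add: p p' a_def b_def c_def d_def algebra_simps)
  have lin: "s = 0 \<and> r = 0" if "to_ac s * \<theta> + to_ac r = 0" for r s
    using T(2)[of r s 0] that by (simp add: add.commute)
  have "a*d - b*c \<noteq> 0"
  proof
    assume det: "a*d - b*c = 0"
    have cd: "c \<noteq> 0 \<or> d \<noteq> 0" using rel lin[of a b] nz by auto
    then have nz: "to_ac c * \<theta> + to_ac d \<noteq> 0" using lin[of c d] by auto
    obtain m where "a = m * c" "b = m * d"
    proof (cases "c = 0")
      case True
      then show ?thesis using that[of "b/d"] cd det by auto
    next
      case False
      then show ?thesis using that[of "a/c"] det by (auto simp: field_simps)
    qed
    then have "(to_ac c * \<theta> + to_ac d) * to_ac m = (to_ac c * \<theta> + to_ac d) * \<phi>" using rel by (simp add: algebra_simps)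
    then have "\<phi> = to_ac m" using nz by simp
    then show False using P(1) by blast
  qed
  then show ?thesis using that rel by blast
qed

section \<open>Transitivity on points of each type\<close>

text \<open>The scalar k makes this a relation between points, stated on representatives.\<close>

definition sym3_equiv :: "'a::field ^ 4 \<Rightarrow> 'a ^ 4 \<Rightarrow> bool" where
  "sym3_equiv v w \<longleftrightarrow> (\<exists>a b c d k. a*d - b*c \<noteq> 0 \<and> k \<noteq> 0 \<and> sym3 a b c d *v v = k *s w)"

lemma sym3_equivI: "a*d - b*c \<noteq> 0 \<Longrightarrow> k \<noteq> 0 \<Longrightarrow> sym3 a b c d *v v = k *s w \<Longrightarrow> sym3_equiv v w"
  unfolding sym3_equiv_def by blast

lemma sym3_equiv_smult: "k \<noteq> 0 \<Longrightarrow> v = k *s w \<Longrightarrow> sym3_equiv v w"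
  using sym3_scalar[of 1 v] by (intro sym3_equivI[of 1 1 0 0 k]) simp_all

lemma sym3_equiv_trans:
  assumes "sym3_equiv u v" "sym3_equiv v w" shows "sym3_equiv u w"
proof -
  obtain a b c d k where 1: "a*d - b*c \<noteq> 0" "k \<noteq> 0" "sym3 a b c d *v u = k *s v"
    using assms(1) unfolding sym3_equiv_def by blast
  obtain a' b' c' d' k' where 2: "a'*d' - b'*c' \<noteq> 0" "k' \<noteq> 0" "sym3 a' b' c' d' *v v = k' *s w"
    using assms(2) unfolding sym3_equiv_def by blast
  have "sym3 a' b' c' d' *v (sym3 a b c d *v u) = (k * k') *s w"
    unfolding 1 by (simp add: vec.scale 2 vector_smult_assoc)
  then have 3: "sym3 (a'*a + b'*c) (a'*b + b'*d) (c'*a + d'*c) (c'*b + d'*d) *v u = (k * k') *s w"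
    by (simp add: sym3_comp)
  have "(a'*a + b'*c) * (c'*b + d'*d) - (a'*b + b'*d) * (c'*a + d'*c) = (a'*d' - b'*c') * (a*d - b*c)"
    by (simp add: algebra_simps)
  then show ?thesis using 1 2 by (intro sym3_equivI[OF _ _ 3]) auto
qed

lemma sym3_equiv_sym:
  assumes "sym3_equiv v w" shows "sym3_equiv w v"
proof -
  obtain a b c d k where 1: "a*d - b*c \<noteq> 0" "k \<noteq> 0" "sym3 a b c d *v v = k *s w"
    using assms unfolding sym3_equiv_def by blast
  have "k *s (sym3 d (-b) (-c) a *v w) = (a*d - b*c)^3 *s v"
    using sym3_adj(1)[of d b c a v] unfolding 1 by (simp add: vec.scale)
  then have "inverse k *s (k *s (sym3 d (-b) (-c) a *v w)) = inverse k *s ((a*d - b*c)^3 *s v)" by simp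
  then have "sym3 d (-b) (-c) a *v w = ((a*d - b*c)^3 / k) *s v"
    using 1(2) by (simp add: vector_smult_assoc divide_inverse mult.commute)
  then show ?thesis using 1 by (intro sym3_equivI[of d a "-b" "-c" "(a*d - b*c)^3 / k"]) (simp_all add: algebra_simps)
qed

lemma sym3_equivE:
  assumes "sym3_equiv v w"
  obtains a b c d k where "a*d - b*c \<noteq> 0" "k \<noteq> 0" "sym3 a b c d *v v = k *s w"
  using assms unfolding sym3_equiv_def by blast

lemma sym3_equiv_nonzero:
  assumes "sym3_equiv v w" shows "w \<noteq> 0 \<longleftrightarrow> v \<noteq> 0"
  using assms
proof (rule sym3_equivE)
  fix a b c d k assume *: "a*d - b*c \<noteq> 0" "k \<noteq> 0" "sym3 a b c d *v v = k *s w"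
  show ?thesis using sym3_eq_0[OF *(1), of v] unfolding *(3) using *(2) by simp
qed

lemma sym3_equiv_nroots:
  assumes "sym3_equiv v (w :: 'a::{field,finite} ^ 4)" shows "nroots w = nroots v"
  using assms
proof (rule sym3_equivE)
  fix a b c d k assume *: "a*d - b*c \<noteq> 0" "k \<noteq> 0" "sym3 a b c d *v v = k *s w"
  show ?thesis using nroots_sym3[OF *(1), of v] unfolding *(3) roots_smult[OF *(2)] .
qed

lemma Gq_twisted_cubic_iff:
  assumes "A \<in> Gq" shows "proj (A *v v) \<in> twisted_cubic \<longleftrightarrow> proj v \<in> twisted_cubic"
proof -
  have "invertible A" using assms by (simp add: Gq_def)
  then have "inj ((*v) A)"
    using matrix_left_invertible_injective invertible_left_inverse by metis
  then have "inj (proj_map A)" by (rule proj_map_inj)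
  moreover have "proj_map A ` twisted_cubic = twisted_cubic" using assms by (simp add: Gq_def)
  ultimately show ?thesis unfolding proj_map_proj[symmetric] by (metis inj_image_mem_iff)
qed

lemma sym3_equiv_twisted_cubic:
  assumes "sym3_equiv v (w :: 'a::{field,finite} ^ 4)"
  shows "proj w \<in> twisted_cubic \<longleftrightarrow> proj v \<in> twisted_cubic"
  using assms
proof (rule sym3_equivE)
  fix a b c d k assume *: "a*d - b*c \<noteq> 0" "k \<noteq> 0" "sym3 a b c d *v v = k *s w"
  show ?thesis using Gq_twisted_cubic_iff[OF sym3_in_Gq[OF *(1)], of v] unfolding *(3) proj_smult[OF *(2)] .
qed

section \<open>Normal forms for forms with a zero\<close>

lemma sym3_equiv_translate:
  "sym3_equiv (vec4 x0 x1 x2 x3)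
    (vec4 (x0 + 3*b*x1 + 3*b^2*x2 + b^3*x3) (x1 + 2*b*x2 + b^2*x3) (x2 + b*x3) x3)"
  by (rule sym3_equivI[of 1 1 b 0 1]) (simp_all add: sym3_mult_vec)

lemma sym3_equiv_swap: "sym3_equiv (vec4 x0 x1 x2 x3) (vec4 x3 x2 x1 x0)"
  by (rule sym3_equivI[of 0 0 1 1 1]) (simp_all add: sym3_mult_vec)

text \<open>The target is the form 3t^2 s, with double zero 0 and simple zero at infinity. A finite
  double zero is translated to 0 and swapped to infinity, which reduces to the tangent at infinity;
  there the simple zero is translated to 0 and a final swap exchanges the two.\<close>

lemma two_roots_equiv:
  assumes three: "(3::'a::{field,finite}) \<noteq> 0" and n: "nroots (v :: 'a ^ 4) = 2" and v: "v \<noteq> 0"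
  shows "sym3_equiv v (vec4 0 0 1 0)"
proof -
  have A: "sym3_equiv (vec4 x0 x1 0 0) (vec4 0 0 1 0)" if "nroots (vec4 x0 x1 0 0 :: 'a ^ 4) = 2"
      "vec4 x0 x1 0 0 \<noteq> (0 :: 'a ^ 4)" for x0 x1 :: 'a
  proof -
    have "x1 \<noteq> 0"
    proof
      assume "x1 = 0"
      then have "vec4 x0 x1 0 0 = x0 *s curve_vec None" "x0 \<noteq> 0" using that(2) by (auto simp: curve_vec_def)
      then show False using that(1) roots_curve_vec[OF three] roots_smult[of x0 "curve_vec None"] by simp
    qed
    have "sym3_equiv (vec4 x0 x1 0 0) (vec4 0 x1 0 0)"
      using sym3_equiv_translate[of x0 x1 0 0 "- x0 / (3*x1)"] three \<open>x1 \<noteq> 0\<close> by simp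
    moreover have "sym3_equiv (vec4 0 x1 0 0) (vec4 0 0 x1 0)" by (rule sym3_equiv_swap)
    moreover have "sym3_equiv (vec4 0 0 x1 0) (vec4 0 0 1 0)"
      using \<open>x1 \<noteq> 0\<close> by (intro sym3_equiv_smult[of x1]) simp_all
    ultimately show ?thesis using sym3_equiv_trans by blast
  qed
  obtain z where z: "on_tangent_at v z" using nroots_2_on_tangent[OF three n] by blast
  obtain x0 x1 x2 x3 where x: "v = vec4 x0 x1 x2 x3" by (rule vec4_exhaust)
  show ?thesis
  proof (cases z)
    case None
    then have "v = vec4 x0 x1 0 0" using z by (simp add: x on_tangent_at_def)
    then show ?thesis using A[of x0 x1] n v by simp
  next
    case (Some t)
    then have e: "x1 = 2*t*x2 - t^2*x3" "x0 = 3*t^2*x2 - 2*t^3*x3" using z by (simp_all add: x on_tangent_at_def)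
    have 1: "sym3_equiv v (vec4 0 0 (x2 - t*x3) x3)"
      using sym3_equiv_translate[of x0 x1 x2 x3 "- t"] unfolding x e
      by (simp add: power2_eq_square power3_eq_cube algebra_simps)
    have 2: "sym3_equiv v (vec4 x3 (x2 - t*x3) 0 0)" using 1 sym3_equiv_swap sym3_equiv_trans by blast
    have "sym3_equiv (vec4 x3 (x2 - t*x3) 0 0) (vec4 0 0 1 0)"
      by (rule A) (use sym3_equiv_nroots[OF 2] sym3_equiv_nonzero[OF 2] n v in simp_all)
    then show ?thesis using 2 sym3_equiv_trans by blast
  qed
qed

lemma root_to_infinity:
  assumes n: "nroots (v :: 'a::{field,finite} ^ 4) \<noteq> 0"
  obtains x0 x1 x2 where "sym3_equiv v (vec4 x0 x1 x2 0)"
proof -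
  obtain x0 x1 x2 x3 where x: "v = vec4 x0 x1 x2 x3" by (rule vec4_exhaust)
  obtain z where z: "z \<in> roots v" using n by (metis card.empty ex_in_conv)
  show ?thesis
  proof (cases z)
    case None
    then have "v = vec4 x0 x1 x2 0" using z x by simp
    then show ?thesis using that sym3_equiv_smult[of 1 v v] by simp
  next
    case (Some t)
    \<comment> \<open>The map y -> 1/(y - t) sends the zero t to infinity.\<close>
    have "sym3_equiv v (sym3 0 1 1 (-t) *v v)" by (rule sym3_equivI[of 0 "-t" 1 1 1]) simp_all
    moreover have "(sym3 0 1 1 (-t) *v v) $ 3 = 0"
      using z Some by (simp add: x sym3_mult_vec cubic_form_def algebra_simps)
    ultimately show ?thesis using that by (metis vec4_exhaust vec4_nth(4))
  qed
qed

text \<open>With x2 = x3 = 0 the point would lie on the tangent at infinity.\<close>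

lemma leading_coeff_nonzero:
  assumes three: "(3::'a::{field,finite}) \<noteq> 0" and "vec4 x0 x1 x2 0 \<noteq> (0 :: 'a ^ 4)"
    and "proj (vec4 x0 x1 x2 0 :: 'a ^ 4) \<notin> twisted_cubic" "nroots (vec4 x0 x1 x2 0 :: 'a ^ 4) \<noteq> 2"
  shows "x2 \<noteq> 0"
  using nroots_on_tangent[OF three assms(2), of None] assms(3,4) by (auto simp: on_tangent_at_def)

text \<open>The target is the form 3ts(t - s), with zeros 0, 1 and infinity. One zero is moved to
  infinity, a second to 0, and scaling by x2/y1 takes the third one, y1/x2, to 1.\<close>

lemma three_roots_equiv:
  assumes three: "(3::'a::{field,finite}) \<noteq> 0" and n: "nroots (v :: 'a ^ 4) = 3" and v: "v \<noteq> 0"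
  shows "sym3_equiv v (vec4 0 1 1 0)"
proof -
  have nC: "proj v \<notin> twisted_cubic" using nroots_cubic_point[OF three] n by fastforce
  obtain x0 x1 x2 where x: "sym3_equiv v (vec4 x0 x1 x2 0)" using root_to_infinity[of v] n by auto
  have x2: "x2 \<noteq> 0"
    by (rule leading_coeff_nonzero[OF three, of x0 x1])
      (use sym3_equiv_nonzero[OF x] sym3_equiv_twisted_cubic[OF x] sym3_equiv_nroots[OF x] n v nC in simp_all)
  obtain t where t: "Some t \<in> roots (vec4 x0 x1 x2 0)"
  proof -
    have "\<not> roots (vec4 x0 x1 x2 0) \<subseteq> {None}"
      using card_mono[of "{None}" "roots (vec4 x0 x1 x2 0)"] sym3_equiv_nroots[OF x] n by auto
    then show ?thesis using that by (metis insert_iff option.exhaust subsetI)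
  qed
  have "sym3_equiv (vec4 x0 x1 x2 0) (vec4 0 (x1 - 2*t*x2) x2 0)"
    using sym3_equiv_translate[of x0 x1 x2 0 "- t"] t by (simp add: cubic_form_def algebra_simps)
  then have y: "sym3_equiv v (vec4 0 (x1 - 2*t*x2) x2 0)" using x sym3_equiv_trans by blast
  define y1 where "y1 = x1 - 2*t*x2"
  note y = y[folded y1_def]
  have "y1 \<noteq> 0"
  proof
    assume "y1 = 0"
    then have "on_tangent_at (vec4 0 y1 x2 0) (Some 0)" by (simp add: on_tangent_at_def)
    then have "nroots (vec4 0 y1 x2 0) = 2" using nroots_on_tangent[OF three]
      sym3_equiv_nonzero[OF y] sym3_equiv_twisted_cubic[OF y] v nC by blast
    then show False using sym3_equiv_nroots[OF y] n by simp
  qed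
  then have "sym3_equiv (vec4 0 y1 x2 0) (vec4 0 1 1 0)" using x2
    by (intro sym3_equivI[of "x2/y1" 1 0 0 "x2^2/y1"]) (simp_all add: sym3_mult_vec field_simps power2_eq_square)
  then show ?thesis using y sym3_equiv_trans by blast
qed

text \<open>With its zero at infinity the form is 3m(t^2 + bt + c), where the quadratic is
  irreducible. Affine substitutions fix infinity and relate any two such quadratics.\<close>

lemma one_root_equiv:
  assumes three: "(3::'a::{field,finite}) \<noteq> 0" and n: "nroots (v :: 'a ^ 4) = 1" "nroots w = 1"
    and v: "v \<noteq> 0" "w \<noteq> 0" and nC: "proj v \<notin> twisted_cubic" "proj w \<notin> twisted_cubic"
  shows "sym3_equiv v w"
proof -
  have normal: "\<exists>b c m. m \<noteq> 0 \<and> sym3_equiv v (vec4 (3*m*c) (-m*b) m 0) \<and> (\<forall>t. t^2 + b*t + c \<noteq> 0)"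
    if n: "nroots v = 1" and v: "v \<noteq> 0" and nC: "proj v \<notin> twisted_cubic" for v :: "'a ^ 4"
  proof -
    obtain x0 x1 x2 where x: "sym3_equiv v (vec4 x0 x1 x2 0)" using root_to_infinity[of v] n by auto
    have x2: "x2 \<noteq> 0"
      by (rule leading_coeff_nonzero[OF three, of x0 x1])
        (use sym3_equiv_nonzero[OF x] sym3_equiv_twisted_cubic[OF x] sym3_equiv_nroots[OF x] n v nC in simp_all)
    have "roots (vec4 x0 x1 x2 0) = {None}"
    proof -
      obtain z where "roots (vec4 x0 x1 x2 0) = {z}" using sym3_equiv_nroots[OF x] n card_1_singletonE by metis
      moreover have "None \<in> roots (vec4 x0 x1 x2 0)" by simp
      ultimately show ?thesis by auto
    qed
    then have r: "cubic_form (vec4 x0 x1 x2 0) t 1 \<noteq> 0" for t using Some_in_roots by blast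
    define b c where "b = - x1/x2" and "c = x0 / (3*x2)"
    have "t^2 + b*t + c \<noteq> 0" for t
      using r[of t] x2 three by (auto simp: cubic_form_def b_def c_def field_simps)
    moreover have "vec4 x0 x1 x2 0 = vec4 (3*x2*c) (-x2*b) x2 0" using x2 three by (simp add: b_def c_def)
    ultimately show ?thesis using x x2 by metis
  qed
  obtain b c m where 1: "m \<noteq> 0" "sym3_equiv v (vec4 (3*m*c) (-m*b) m 0)" "\<And>t. t^2 + b*t + c \<noteq> 0"
    using normal[OF n(1) v(1) nC(1)] by blast
  obtain b' c' m' where 2: "m' \<noteq> 0" "sym3_equiv w (vec4 (3*m'*c') (-m'*b') m' 0)" "\<And>t. t^2 + b'*t + c' \<noteq> 0"
    using normal[OF n(2) v(2) nC(2)] by blast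
  obtain \<alpha> \<beta> where \<alpha>: "\<alpha> \<noteq> 0" "2*\<beta> + b' = \<alpha>*b" "\<beta>^2 + b'*\<beta> + c' = \<alpha>^2*c"
    by (rule irreducible_quadratics_affine_equiv[OF 1(3) 2(3)])
  have c': "c' = \<alpha>^2*c - \<beta>^2 - b'*\<beta>" and b': "b' = \<alpha>*b - 2*\<beta>" using \<alpha> by (simp_all add: algebra_simps)
  have "sym3_equiv (vec4 (3*m*c) (-m*b) m 0) (vec4 (3*m'*c') (-m'*b') m' 0)"
    using 1(1) 2(1) \<alpha>(1) unfolding c' b'
    by (intro sym3_equivI[of \<alpha> 1 \<beta> 0 "\<alpha>*m/m'"])
       (simp_all add: sym3_mult_vec field_simps power2_eq_square power3_eq_cube)
  then show ?thesis using 1(2) 2(2) sym3_equiv_trans sym3_equiv_sym by blast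
qed

section \<open>Irreducible cubic forms through the algebraic closure\<close>

definition ac_vec :: "'a::field ^ 4 \<Rightarrow> 'a alg_closure ^ 4" where
  "ac_vec v = vec4 (to_ac (v $ 0)) (to_ac (v $ 1)) (to_ac (v $ 2)) (to_ac (v $ 3))"

lemma ac_vec_sym3:
  "ac_vec (sym3 a b c d *v v) = sym3 (to_ac a) (to_ac b) (to_ac c) (to_ac d) *v ac_vec v"
proof -
  obtain x0 x1 x2 x3 where x: "v = vec4 x0 x1 x2 x3" by (rule vec4_exhaust)
  show ?thesis unfolding x ac_vec_def sym3_mult_vec vec4_nth by simp
qed

text \<open>The fractional linear map taking theta to phi pulls w back to a form w' that also
  vanishes at theta. The combination of v and w' without a t^3 term vanishes at theta too; since 1,
  theta, theta^2 are independent over the ground field, v and w' are proportional.\<close>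

lemma no_root_equiv:
  assumes three: "(3::'a::{field,finite}) \<noteq> 0" and n: "nroots (v :: 'a ^ 4) = 0" "nroots w = 0"
  shows "sym3_equiv v w"
proof -
  have normal: "v $ 3 \<noteq> 0 \<and> (\<exists>e0 e1 e2. (\<forall>t. t^3 \<noteq> e0 + e1*t + e2*t^2) \<and>
     (\<forall>\<theta>. cubic_form (ac_vec v) \<theta> 1 = 0 \<longleftrightarrow> \<theta>^3 = to_ac e0 + to_ac e1 * \<theta> + to_ac e2 * \<theta>^2))"
    if n: "nroots v = 0" for v :: "'a ^ 4"
  proof -
    have r: "roots v = {}" using n by simp
    then have x3: "v $ 3 \<noteq> 0" using None_in_roots by blast
    define e0 e1 e2 where "e0 = v $ 0 / v $ 3" and "e1 = -3 * v $ 1 / v $ 3" and "e2 = 3 * v $ 2 / v $ 3"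
    have e: "v $ 0 = v $ 3 * e0" "3 * v $ 1 = - (v $ 3 * e1)" "3 * v $ 2 = v $ 3 * e2"
      using x3 by (simp_all add: e0_def e1_def e2_def)
    have f: "cubic_form v t 1 = v $ 3 * (e0 + e1*t + e2*t^2 - t^3)" for t
    proof -
      have "cubic_form v t 1 = v $ 0 - (3 * v $ 1) * t + (3 * v $ 2) * t^2 - v $ 3 * t^3"
        by (simp add: cubic_form_def)
      then show ?thesis unfolding e by (simp add: algebra_simps)
    qed
    have "t^3 \<noteq> e0 + e1*t + e2*t^2" for t
    proof
      assume "t^3 = e0 + e1*t + e2*t^2"
      then have "Some t \<in> roots v" by (simp add: f)
      then show False using r by simp
    qed
    moreover have "cubic_form (ac_vec v) \<theta> 1 = to_ac (v $ 3) * (to_ac e0 + to_ac e1 * \<theta> + to_ac e2 * \<theta>^2 - \<theta>^3)" for \<theta>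
    proof -
      have "to_ac (3 * v $ 1) = to_ac (- (v $ 3 * e1))" "to_ac (3 * v $ 2) = to_ac (v $ 3 * e2)" using e by metis+
      then have "3 * to_ac (v $ 1) = - (to_ac (v $ 3) * to_ac e1)" "3 * to_ac (v $ 2) = to_ac (v $ 3) * to_ac e2" by simp_all
      then show ?thesis by (simp add: cubic_form_def ac_vec_def e(1) algebra_simps)
    qed
    ultimately show ?thesis using x3 by (metis eq_iff_diff_eq_0 mult_eq_0_iff to_ac_eq_0_iff)
  qed
  have root: "\<exists>\<theta> :: 'a alg_closure. \<theta>^3 = to_ac e0 + to_ac e1 * \<theta> + to_ac e2 * \<theta>^2" for e0 e1 e2 :: 'a
  proof -
    have "\<exists>\<theta>. poly [:- to_ac e0, - to_ac e1, - to_ac e2, 1:] \<theta> = 0" by (rule alg_closed_imp_poly_has_root) simp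
    then show ?thesis by (simp add: power2_eq_square power3_eq_cube algebra_simps eq_neg_iff_add_eq_0)
  qed
  obtain e0 e1 e2 where e: "\<And>t. t^3 \<noteq> e0 + e1*t + e2*t^2"
     "\<And>\<theta>. cubic_form (ac_vec v) \<theta> 1 = 0 \<longleftrightarrow> \<theta>^3 = to_ac e0 + to_ac e1 * \<theta> + to_ac e2 * \<theta>^2"
    using normal[OF n(1)] by blast
  obtain f0 f1 f2 where f: "\<And>t. t^3 \<noteq> f0 + f1*t + f2*t^2"
     "\<And>\<theta>. cubic_form (ac_vec w) \<theta> 1 = 0 \<longleftrightarrow> \<theta>^3 = to_ac f0 + to_ac f1 * \<theta> + to_ac f2 * \<theta>^2"
    using normal[OF n(2)] by blast
  obtain \<theta> where \<theta>: "\<theta>^3 = to_ac e0 + to_ac e1 * \<theta> + to_ac e2 * \<theta>^2" using root by blast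
  obtain \<phi> where \<phi>: "\<phi>^3 = to_ac f0 + to_ac f1 * \<phi> + to_ac f2 * \<phi>^2" using root by blast
  obtain a b c d where g: "a*d - b*c \<noteq> 0" "to_ac a * \<theta> + to_ac b = (to_ac c * \<theta> + to_ac d) * \<phi>"
    by (rule cubic_roots_moebius[OF e(1) f(1) \<theta> \<phi>])
  define w' where "w' = sym3 d (-b) (-c) a *v w"
  have eq: "sym3_equiv w w'" using g(1)
    by (intro sym3_equivI[of d a "-b" "-c" 1]) (simp_all add: w'_def algebra_simps)
  then have n': "nroots w' = 0" using sym3_equiv_nroots n(2) by metis
  define D where "D = to_ac a * to_ac d - to_ac b * to_ac c"
  have "D = to_ac (a*d - b*c)" by (simp add: D_def)
  then have D: "D \<noteq> 0" using g(1) to_ac_eq_0_iff by metis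
  have w'0: "cubic_form (ac_vec w') \<theta> 1 = 0"
  proof -
    define T U where "T = to_ac a * \<theta> + to_ac b" and "U = to_ac c * \<theta> + to_ac d"
    have e: "to_ac d * T + (- to_ac b) * U = D * \<theta>" "(- to_ac c) * T + to_ac a * U = D * 1"
      by (simp_all add: D_def T_def U_def algebra_simps)
    have "D^3 * cubic_form (ac_vec w') \<theta> 1 = cubic_form (ac_vec w') (to_ac d * T + (- to_ac b) * U) ((- to_ac c) * T + to_ac a * U)"
      unfolding e cubic_form_scale ..
    also have "\<dots> = (to_ac d * to_ac a - (- to_ac b) * (- to_ac c))^3 * cubic_form (ac_vec w) T U"
      unfolding w'_def ac_vec_sym3 to_ac_minus by (rule cubic_form_sym3)
    also have "cubic_form (ac_vec w) T U = cubic_form (ac_vec w) (U * \<phi>) (U * 1)"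
      using g(2) by (simp add: T_def U_def)
    also have "\<dots> = 0" unfolding cubic_form_scale using f(2) \<phi> by simp
    finally show ?thesis using D by simp
  qed
  define u where "u = w' $ 3 *s v - v $ 3 *s w'"
  have u3: "u $ 3 = 0" by (simp add: u_def)
  have "cubic_form (ac_vec u) \<theta> 1 = to_ac (w' $ 3) * cubic_form (ac_vec v) \<theta> 1 - to_ac (v $ 3) * cubic_form (ac_vec w') \<theta> 1"
    by (simp add: u_def cubic_form_def ac_vec_def algebra_simps)
  also have "\<dots> = 0" using w'0 e(2) \<theta> by simp
  finally have "to_ac (u $ 0) + to_ac (-3 * u $ 1) * \<theta> + to_ac (3 * u $ 2) * \<theta>^2 = 0"
    by (simp add: cubic_form_def ac_vec_def u3)
  then have "u $ 0 = 0 \<and> -3 * u $ 1 = 0 \<and> 3 * u $ 2 = 0" using cubic_ext_eq(2)[OF e(1) \<theta>] by blast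
  then have "u = 0" using three u3 by (simp add: vec_eq_index4)
  then have uv: "w' $ 3 *s v = v $ 3 *s w'" by (simp add: u_def)
  have nz: "w' $ 3 \<noteq> 0" "v $ 3 \<noteq> 0" using normal n n' by blast+
  have "v = inverse (w' $ 3) *s (w' $ 3 *s v)" using nz by (simp add: vector_smult_assoc)
  then have "v = (v $ 3 / w' $ 3) *s w'" unfolding uv by (simp add: vector_smult_assoc divide_inverse mult.commute)
  then have "sym3_equiv v w'" using nz by (intro sym3_equiv_smult[of "v $ 3 / w' $ 3"]) auto
  then show ?thesis using eq sym3_equiv_sym sym3_equiv_trans by blast
qed

lemma sym3_equiv_same_type:
  assumes three: "(3::'a::{field,finite}) \<noteq> 0"
    and v: "(v :: 'a ^ 4) \<noteq> 0" "w \<noteq> 0" and nC: "proj v \<notin> twisted_cubic" "proj w \<notin> twisted_cubic"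
    and n: "nroots v = nroots w"
  shows "sym3_equiv v w"
proof -
  have "nroots v \<le> 3" using nroots_le_3[OF three v(1)] .
  then consider "nroots v = 0" | "nroots v = 1" | "nroots v = 2" | "nroots v = 3" by linarith
  then show ?thesis
  proof cases
    case 1
    then show ?thesis using no_root_equiv[OF three] n by simp
  next
    case 2
    then show ?thesis using one_root_equiv[OF three _ _ v nC] n by simp
  next
    case 3
    then show ?thesis using two_roots_equiv[OF three] n v sym3_equiv_trans sym3_equiv_sym by metis
  next
    case 4
    then show ?thesis using three_roots_equiv[OF three] n v sym3_equiv_trans sym3_equiv_sym by metis
  qed
qed

section \<open>The number of points of each type\<close>

definition form_at :: "'a::field ^ 4 \<Rightarrow> 'a option \<Rightarrow> 'a" where
  "form_at v z = (case z of None \<Rightarrow> v $ 3 | Some t \<Rightarrow> cubic_form v t 1)"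

lemma in_roots_iff: "z \<in> roots v \<longleftrightarrow> form_at v z = 0"
  by (cases z) (simp_all add: form_at_def)

lemma form_at_diff: "form_at (v - w) z = form_at v z - form_at w z"
  by (cases z) (simp_all add: form_at_def cubic_form_def algebra_simps)

text \<open>A cubic form is determined by its values at four points of the parameter line, and these values
  are arbitrary because both sides of this correspondence are equally large.\<close>

lemma card_forms_with_roots:
  fixes xs :: "'a::{field,finite} option list"
  assumes three: "(3::'a) \<noteq> 0" and q: "CARD('a) \<ge> 3"
    and xs: "distinct xs" "length xs = k" "k \<le> 4"
  shows "card {v :: 'a ^ 4. set xs \<subseteq> roots v} = CARD('a) ^ (4 - k)"
proof -
  \<comment> \<open>The list is completed to four distinct parameters, which exist because there are
    q + 1 >= 4 of them.\<close>
  have "4 - k \<le> card (- set xs)"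
    using q xs by (simp add: Compl_eq_Diff_UNIV card_Diff_subset distinct_card card_UNIV_option)
  then obtain Z where Z: "Z \<subseteq> - set xs" "card Z = 4 - k" by (meson obtain_subset_with_card_n)
  have "finite Z" by simp
  then obtain ys where ys: "set ys = Z" "distinct ys" using finite_distinct_list by blast
  have ly: "length ys = 4 - k" using ys Z distinct_card by metis
  define zs where "zs = xs @ ys"
  have zs: "distinct zs" "length zs = 4" using xs ys Z ly by (auto simp: zs_def)
  define f where "f v = map (form_at v) zs" for v :: "'a ^ 4"
  have "inj f"
  proof (rule injI)
    fix v w assume "f v = f w"
    then have "set zs \<subseteq> roots (v - w)" by (auto simp: f_def in_roots_iff form_at_diff)
    then have "card (set zs) \<le> nroots (v - w)" by (intro card_mono) auto
    then have "4 \<le> nroots (v - w)" using zs distinct_card by metis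
    then show "v = w" using nroots_le_3[OF three, of "v - w"] by force
  qed
  have cl: "card {l :: 'a list. length l = n} = CARD('a) ^ n" and fl: "finite {l :: 'a list. length l = n}" for n
    using card_lists_length_eq[of "UNIV :: 'a set" n] finite_lists_length_eq[of "UNIV :: 'a set" n] by simp_all
  have "range f = {l. length l = 4}"
  proof (rule card_subset_eq)
    show "finite {l :: 'a list. length l = 4}" by (rule fl)
    show "range f \<subseteq> {l. length l = 4}" by (auto simp: f_def zs)
    show "card (range f) = card {l :: 'a list. length l = 4}" using \<open>inj f\<close> by (simp add: card_image cl)
  qed
  then have surj: "\<exists>v. f v = l" if "length l = 4" for l using that by (metis (mono_tags) imageE mem_Collect_eq)
  let ?V = "{v :: 'a ^ 4. set xs \<subseteq> roots v}"
  have rep: "map (form_at v) xs = replicate k 0" if "v \<in> ?V" for v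
  proof -
    have "map (form_at v) xs = map (\<lambda>_. 0) xs" using that by (auto simp: in_roots_iff)
    then show ?thesis using xs(2) by (simp add: map_replicate_const)
  qed
  have "bij_betw (\<lambda>v. map (form_at v) ys) ?V {l. length l = 4 - k}"
    unfolding bij_betw_def
  proof
    show "inj_on (\<lambda>v. map (form_at v) ys) ?V"
    proof (rule inj_onI)
      fix v w assume "v \<in> ?V" "w \<in> ?V" "map (form_at v) ys = map (form_at w) ys"
      then have "f v = f w" using rep by (simp add: f_def zs_def)
      then show "v = w" using \<open>inj f\<close> injD by metis
    qed
    show "(\<lambda>v. map (form_at v) ys) ` ?V = {l. length l = 4 - k}"
    proof (intro equalityI subsetI)
      fix l :: "'a list" assume "l \<in> {l. length l = 4 - k}"
      then have "length (replicate k 0 @ l) = 4" using xs by simp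
      then obtain v where v: "f v = replicate k 0 @ l" using surj by blast
      then have "map (form_at v) xs = replicate k 0" "map (form_at v) ys = l"
        using xs(2) by (auto simp: f_def zs_def append_eq_append_conv)
      moreover from this(1) have "v \<in> ?V"
        by (auto simp: in_roots_iff) (metis in_set_replicate in_set_conv_nth length_map nth_map nth_mem)
      ultimately show "l \<in> (\<lambda>v. map (form_at v) ys) ` ?V" by blast
    qed (simp add: ly image_iff, metis length_map ly)
  qed
  then show ?thesis using bij_betw_same_card cl by metis
qed

definition form_count :: "'a::{field,finite} itself \<Rightarrow> nat \<Rightarrow> nat" where
  "form_count _ m = card {v :: 'a ^ 4. v \<noteq> 0 \<and> nroots v = m}"

lemma sum_over_forms:
  fixes f :: "nat \<Rightarrow> nat"
  assumes three: "(3::'a::{field,finite}) \<noteq> 0"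
  shows "(\<Sum>v\<in>-{0 :: 'a ^ 4}. f (nroots v)) = (\<Sum>m\<le>3. form_count TYPE('a) m * f m)"
proof -
  have "(\<Sum>v\<in>-{0 :: 'a ^ 4}. f (nroots v)) = (\<Sum>m\<le>3. \<Sum>v\<in>{v \<in> -{0 :: 'a ^ 4}. nroots v = m}. f (nroots v))"
    by (rule sum.group[symmetric]) (use nroots_le_3[OF three] in auto)
  also have "\<dots> = (\<Sum>m\<le>3. \<Sum>v\<in>{v \<in> -{0 :: 'a ^ 4}. nroots v = m}. f m)"
    by (intro sum.cong) auto
  also have "\<dots> = (\<Sum>m\<le>3. form_count TYPE('a) m * f m)" by (simp add: form_count_def)
  finally show ?thesis .
qed

lemma card_distinct_lists:
  assumes "finite A"
  shows "card {xs. length xs = k \<and> distinct xs \<and> set xs \<subseteq> A} = (if k \<le> card A then \<Prod>{card A - k + 1..card A} else 0)"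
proof (cases "k \<le> card A")
  case True
  then show ?thesis using card_lists_distinct_length_eq[OF assms] by simp
next
  case False
  have "{xs. length xs = k \<and> distinct xs \<and> set xs \<subseteq> A} = {}"
  proof -
    have "length xs \<le> card A" if "distinct xs" "set xs \<subseteq> A" for xs
      using card_mono[OF assms that(2)] distinct_card[OF that(1)] by simp
    then show ?thesis using False by auto
  qed
  then show ?thesis unfolding \<open>{xs. length xs = k \<and> distinct xs \<and> set xs \<subseteq> A} = {}\<close> using False by simp
qed

text \<open>The k-th factorial moment of the number of zeros, by counting pairs of a nonzero form
  and a list of k distinct zeros in two ways. For m < k truncated subtraction would turn the falling
  factorial into m! instead of 0, hence the case distinction.\<close>

lemma root_moment:
  assumes three: "(3::'a::{field,finite}) \<noteq> 0" and q: "CARD('a) \<ge> 3" and k: "k \<le> 3"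
  shows "(\<Sum>m\<le>3. form_count TYPE('a) m * (if k \<le> m then \<Prod>{m - k + 1..m} else 0))
     = (CARD('a) ^ (4 - k) - 1) * \<Prod>{CARD('a) + 1 - k + 1..CARD('a) + 1}"
proof -
  let ?t = "{xs :: 'a option list. length xs = k \<and> distinct xs}"
  have c: "card {v \<in> -{0 :: 'a ^ 4}. set xs \<subseteq> roots v} = CARD('a) ^ (4 - k) - 1" if "xs \<in> ?t" for xs
  proof -
    have "{v \<in> -{0 :: 'a ^ 4}. set xs \<subseteq> roots v} = {v. set xs \<subseteq> roots v} - {0}" by auto
    moreover have "z \<in> roots (0 :: 'a ^ 4)" for z by (cases z) (simp_all add: cubic_form_def)
    then have "(0 :: 'a ^ 4) \<in> {v. set xs \<subseteq> roots v}" by blast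
    ultimately show ?thesis using card_forms_with_roots[OF three q, of xs k] that k by simp
  qed
  have ft: "finite ?t" and ct: "card ?t = \<Prod>{CARD('a) + 1 - k + 1..CARD('a) + 1}"
  proof -
    show "finite ?t"
      by (rule finite_subset[OF _ finite_lists_length_eq[of "UNIV :: 'a option set" k]]) auto
    show "card ?t = \<Prod>{CARD('a) + 1 - k + 1..CARD('a) + 1}"
      using card_distinct_lists[of "UNIV :: 'a option set" k] k q by (simp add: card_UNIV_option)
  qed
  have "(\<Sum>m\<le>3. form_count TYPE('a) m * (if k \<le> m then \<Prod>{m - k + 1..m} else 0)) =
     (\<Sum>v\<in>-{0 :: 'a ^ 4}. if k \<le> nroots v then \<Prod>{nroots v - k + 1..nroots v} else 0)"
    by (rule sum_over_forms[OF three, symmetric])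
  also have "\<dots> = (\<Sum>v\<in>-{0 :: 'a ^ 4}. card {xs \<in> ?t. set xs \<subseteq> roots v})"
  proof (rule sum.cong)
    fix v :: "'a ^ 4"
    have "{xs \<in> ?t. set xs \<subseteq> roots v} = {xs. length xs = k \<and> distinct xs \<and> set xs \<subseteq> roots v}" by blast
    then show "(if k \<le> nroots v then \<Prod>{nroots v - k + 1..nroots v} else 0) = card {xs \<in> ?t. set xs \<subseteq> roots v}"
      using card_distinct_lists[of "roots v" k] by simp
  qed simp
  also have "\<dots> = (CARD('a) ^ (4 - k) - 1) * card ?t"
    by (rule sum_multicount) (use c ft in auto)
  finally show ?thesis by (simp only: ct)
qed

text \<open>The moments of order 3, 2, 1, 0 form a triangular system. The summand q^2 - 1 for one
  zero is the contribution (q - 1)(q + 1) of the vectors on the cubic.\<close>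

lemma form_counts:
  fixes q :: real
  assumes three: "(3::'a::{field,finite}) \<noteq> 0" and q: "CARD('a) \<ge> 3"
  defines "q \<equiv> real CARD('a)"
  shows "real (form_count TYPE('a) 3) = (q - 1) * ((q^3 - q) / 6)"
    and "real (form_count TYPE('a) 2) = (q - 1) * (q^2 + q)"
    and "real (form_count TYPE('a) 1) = (q - 1) * ((q^3 - q) / 2) + (q^2 - 1)"
    and "real (form_count TYPE('a) 0) = (q - 1) * ((q^3 - q) / 3)"
proof -
  let ?c = "form_count TYPE('a)"
  let ?n = "CARD('a)"
  have i: "{..3::nat} = {0,1,2,3}" by auto
  have p: "{Suc (Suc 0)..3} = {2,3::nat}" "{Suc 0..2} = {1,2::nat}" "{Suc 0..3} = {1,2,3::nat}" "{Suc (Suc 0)..2} = {2::nat}" by auto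
  have p2: "{?n + 1 - 1 + 1..?n + 1} = {?n + 1}" "{?n + 1 - 2 + 1..?n + 1} = {?n, ?n + 1}" "{?n + 1 - 3 + 1..?n + 1} = {?n - 1, ?n, ?n + 1}"
    using q by auto
  have m0: "?c 0 + ?c 1 + ?c 2 + ?c 3 = ?n^4 - 1"
    using root_moment[OF three q, of 0] by (simp add: i)
  have m1: "?c 1 + 2 * ?c 2 + 3 * ?c 3 = (?n^3 - 1) * (?n + 1)"
    using root_moment[OF three q, of 1] unfolding p2 by (simp add: i p)
  have m2: "2 * ?c 2 + 6 * ?c 3 = (?n^2 - 1) * (?n * (?n + 1))"
    using root_moment[OF three q, of 2] unfolding p2 by (simp add: i p)
  have "?n - 1 \<noteq> ?n" "?n - 1 \<noteq> ?n + 1" using q by linarith+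
  then have p3: "\<Prod>{?n - 1, ?n, ?n + 1} = (?n - 1) * (?n * (?n + 1))" by simp
  have m3: "6 * ?c 3 = (?n - 1) * ((?n - 1) * (?n * (?n + 1)))"
    using root_moment[OF three q, of 3] unfolding p2 p3 by (simp add: i p)
  have g: "1 \<le> ?n" "1 \<le> ?n^2" "1 \<le> ?n^3" "1 \<le> ?n^4" using q by auto
  have s: "real (?n - 1) = q - 1" "real (?n^2 - 1) = q^2 - 1" "real (?n^3 - 1) = q^3 - 1" "real (?n^4 - 1) = q^4 - 1"
      "real ?n = q"
    using g by (simp_all add: q_def of_nat_diff)
  note r = m0[THEN arg_cong[of _ _ real]] m1[THEN arg_cong[of _ _ real]] m2[THEN arg_cong[of _ _ real]] m3[THEN arg_cong[of _ _ real]]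
  have r3: "6 * real (?c 3) = (q - 1) * ((q - 1) * (q * (q + 1)))"
    using r(4) by (simp only: of_nat_mult of_nat_add of_nat_numeral of_nat_1 s)
  have r2: "2 * real (?c 2) + 6 * real (?c 3) = (q^2 - 1) * (q * (q + 1))"
    using r(3) by (simp only: of_nat_mult of_nat_add of_nat_numeral of_nat_1 s)
  have r1: "real (?c 1) + 2 * real (?c 2) + 3 * real (?c 3) = (q^3 - 1) * (q + 1)"
    using r(2) by (simp only: of_nat_mult of_nat_add of_nat_numeral of_nat_1 s)
  have r0: "real (?c 0) + real (?c 1) + real (?c 2) + real (?c 3) = q^4 - 1"
    using r(1) by (simp only: of_nat_mult of_nat_add of_nat_numeral of_nat_1 s)
  show e3: "real (?c 3) = (q - 1) * ((q^3 - q) / 6)"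
    using r3 by (simp add: algebra_simps power2_eq_square power3_eq_cube)
  show e2: "real (?c 2) = (q - 1) * (q^2 + q)"
    using r2 e3 by (simp add: algebra_simps power2_eq_square power3_eq_cube)
  show e1: "real (?c 1) = (q - 1) * ((q^3 - q) / 2) + (q^2 - 1)"
  proof -
    have "real (?c 1) = (q^3 - 1) * (q + 1) - 2 * ((q - 1) * (q^2 + q)) - 3 * ((q - 1) * ((q^3 - q) / 6))"
      using r1 unfolding e2 e3 by linarith
    also have "\<dots> = (q - 1) * ((q^3 - q) / 2) + (q^2 - 1)"
      by (simp add: field_simps power2_eq_square power3_eq_cube)
    finally show ?thesis .
  qed
  show "real (?c 0) = (q - 1) * ((q^3 - q) / 3)"
  proof -
    have "real (?c 0) = q^4 - 1 - ((q - 1) * ((q^3 - q) / 2) + (q^2 - 1)) - (q - 1) * (q^2 + q) - (q - 1) * ((q^3 - q) / 6)"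
      using r0 unfolding e1 e2 e3 by linarith
    also have "\<dots> = (q - 1) * ((q^3 - q) / 3)"
      by (simp add: field_simps power2_eq_square power3_eq_cube power4_eq_xxxx)
    finally show ?thesis .
  qed
qed

section \<open>From vectors to points\<close>

lemma card_proj: "(v :: 'a::{field,finite} ^ 4) \<noteq> 0 \<Longrightarrow> card (proj v) = CARD('a) - 1"
proof -
  assume v: "v \<noteq> 0"
  have "proj v = (\<lambda>k. k *s v) ` (- {0})" by (auto simp: proj_def)
  moreover have "inj_on (\<lambda>k. k *s v) (- {0})" using v by (auto intro!: inj_onI)
  ultimately show ?thesis by (simp add: card_image Compl_eq_Diff_UNIV)
qed

lemma mem_proj_eq: "w \<in> proj v \<Longrightarrow> proj w = proj v"
proof -
  assume "w \<in> proj v"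
  then obtain k where "k \<noteq> 0" "w = k *s v" unfolding proj_def by blast
  then show ?thesis by (simp add: proj_smult)
qed

lemma card_points_vectors:
  fixes Q :: "('a::{field,finite} ^ 4) set \<Rightarrow> bool"
  shows "(CARD('a) - 1) * card {P \<in> PG3_points. Q P} = card {v. v \<noteq> 0 \<and> Q (proj v)}"
proof -
  have U: "\<Union> {P \<in> PG3_points. Q P} = {v. v \<noteq> 0 \<and> Q (proj v)}"
  proof (intro equalityI subsetI)
    fix v assume "v \<in> \<Union> {P \<in> PG3_points. Q P}"
    then obtain P where P: "P \<in> PG3_points" "Q P" "v \<in> P" by auto
    obtain w where w: "w \<noteq> 0" "P = proj w" using P(1) by (rule PG3_pointsE)
    then have "v \<noteq> 0" using P(3) by (auto simp: proj_def)
    then show "v \<in> {v. v \<noteq> 0 \<and> Q (proj v)}" using mem_proj_eq[of v w] P w by simp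
  next
    fix v assume "v \<in> {v. v \<noteq> 0 \<and> Q (proj v)}"
    then show "v \<in> \<Union> {P \<in> PG3_points. Q P}" using proj_self[of v] by (intro UnionI[of "proj v"]) auto
  qed
  have "(CARD('a) - 1) * card {P \<in> PG3_points. Q P} = card (\<Union> {P \<in> PG3_points. Q P})"
  proof (rule card_partition)
    fix P assume "P \<in> {P \<in> PG3_points. Q P}"
    then show "card P = CARD('a) - 1" using card_proj PG3_pointsE by blast
  next
    fix P R assume "P \<in> {P \<in> PG3_points. Q P}" "R \<in> {P \<in> PG3_points. Q P}" "P \<noteq> R"
    then show "P \<inter> R = {}" using mem_proj_eq PG3_pointsE by (metis (no_types, lifting) disjoint_iff mem_Collect_eq)
  qed auto
  then show ?thesis unfolding U .
qed

lemma card_cubic_vectors: "card {v :: 'a::{field,finite} ^ 4. v \<noteq> 0 \<and> proj v \<in> twisted_cubic} = (CARD('a) - 1) * (CARD('a) + 1)"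
proof -
  have "{P :: ('a ^ 4) set. P \<in> PG3_points \<and> P \<in> twisted_cubic} = twisted_cubic"
    unfolding twisted_cubic_eq by auto
  moreover have "card (twisted_cubic :: ('a ^ 4) set set) = CARD('a) + 1"
    unfolding twisted_cubic_eq using card_image[OF proj_curve_vec_inj[where 'a = 'a]] by (simp add: card_UNIV_option)
  ultimately show ?thesis using card_points_vectors[of "\<lambda>P :: ('a ^ 4) set. P \<in> twisted_cubic"] by simp
qed

definition num_points :: "(('a::field ^ 4) set \<Rightarrow> bool) \<Rightarrow> nat" where
  "num_points pt = card {P \<in> PG3_points. pt P}"

lemma num_points_types:
  fixes q :: real
  assumes three: "(3::'a::{field,finite}) \<noteq> 0" and q: "CARD('a) \<ge> 3"
  defines "q \<equiv> real CARD('a)"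
  shows "real (num_points (is_Gamma_point 3 :: ('a ^ 4) set \<Rightarrow> bool)) = (q^3 - q) / 6"
    and "real (num_points (is_T_point :: ('a ^ 4) set \<Rightarrow> bool)) = q^2 + q"
    and "real (num_points (is_Gamma_point 1 :: ('a ^ 4) set \<Rightarrow> bool)) = (q^3 - q) / 2"
    and "real (num_points (is_Gamma_point 0 :: ('a ^ 4) set \<Rightarrow> bool)) = (q^3 - q) / 3"
proof -
  let ?T = "is_T_point :: ('a ^ 4) set \<Rightarrow> bool"
  let ?G = "\<lambda>m. is_Gamma_point m :: ('a ^ 4) set \<Rightarrow> bool"
  have q1: "q - 1 \<noteq> 0" using q by (simp add: q_def)
  have key: "(q - 1) * real (num_points pt) = real (card {v. v \<noteq> 0 \<and> pt (proj v)})" for pt :: "('a ^ 4) set \<Rightarrow> bool"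
    using card_points_vectors[of pt, THEN arg_cong[of _ _ real]] q by (simp add: num_points_def q_def of_nat_diff)
  have nC: "nroots v = m \<Longrightarrow> m \<noteq> 1 \<Longrightarrow> proj v \<notin> twisted_cubic" for v :: "'a ^ 4" and m
    using nroots_cubic_point[OF three] by blast
  have G: "{v :: 'a ^ 4. v \<noteq> 0 \<and> is_Gamma_point m (proj v)} = {v. v \<noteq> 0 \<and> nroots v = m}" if "m \<noteq> 1" for m
    using is_Gamma_point_iff[OF three] nC that by blast
  have T: "{v :: 'a ^ 4. v \<noteq> 0 \<and> is_T_point (proj v)} = {v. v \<noteq> 0 \<and> nroots v = 2}"
    using is_T_point_iff[OF three] by blast
  have G1: "{v :: 'a ^ 4. v \<noteq> 0 \<and> is_Gamma_point 1 (proj v)} = {v. v \<noteq> 0 \<and> nroots v = 1} - {v. v \<noteq> 0 \<and> proj v \<in> twisted_cubic}"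
    using is_Gamma_point_iff[OF three] by blast
  have sub: "{v :: 'a ^ 4. v \<noteq> 0 \<and> proj v \<in> twisted_cubic} \<subseteq> {v. v \<noteq> 0 \<and> nroots v = 1}"
    using nroots_cubic_point[OF three] by blast
  have "real (card {v :: 'a ^ 4. v \<noteq> 0 \<and> is_Gamma_point 1 (proj v)}) = real (form_count TYPE('a) 1) - (q^2 - 1)"
    unfolding G1 form_count_def using card_Diff_subset[OF _ sub] card_mono[OF _ sub] card_cubic_vectors[where 'a = 'a] q
    by (simp add: of_nat_diff q_def algebra_simps power2_eq_square)
  then have "(q - 1) * real (num_points (?G 1)) = (q - 1) * ((q^3 - q) / 2)"
    unfolding key using form_counts(3)[OF three q] unfolding q_def[symmetric] by simp
  then show "real (num_points (?G 1)) = (q^3 - q) / 2" using q1 mult_left_cancel by blast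
  have "(q - 1) * real (num_points ?T) = (q - 1) * (q^2 + q)"
    unfolding key T using form_counts(2)[OF three q] unfolding q_def[symmetric] form_count_def .
  then show "real (num_points ?T) = q^2 + q" using q1 mult_left_cancel by blast
  have "(q - 1) * real (num_points (?G 3)) = (q - 1) * ((q^3 - q) / 6)"
    unfolding key using G[of 3] form_counts(1)[OF three q] unfolding q_def[symmetric] form_count_def by simp
  then show "real (num_points (?G 3)) = (q^3 - q) / 6" using q1 mult_left_cancel by blast
  have "(q - 1) * real (num_points (?G 0)) = (q - 1) * ((q^3 - q) / 3)"
    unfolding key using G[of 0] form_counts(4)[OF three q] unfolding q_def[symmetric] form_count_def by simp
  then show "real (num_points (?G 0)) = (q^3 - q) / 3" using q1 mult_left_cancel by blast
qed

section \<open>The points of the line\<close>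

abbreviation ell_vec :: "'a::field \<Rightarrow> 'a ^ 4" where "ell_vec b \<equiv> vec4 1 0 b 1"

lemma proj_in_ell_L_iff:
  assumes "v \<noteq> 0" shows "proj v \<in> ell_L \<longleftrightarrow> v $ 0 = v $ 3 \<and> v $ 1 = 0"
proof -
  obtain x0 x1 x2 x3 where x: "v = vec4 x0 x1 x2 x3" by (rule vec4_exhaust)
  show ?thesis unfolding ell_L_def proj_in_line_through_iff[OF assms] by (auto simp: x)
qed

lemma ell_L_subset_points: "(ell_L :: ('a::field ^ 4) set set) \<subseteq> PG3_points"
proof
  fix P :: "('a ^ 4) set" assume "P \<in> ell_L"
  then obtain a b where "P = proj (vec4 a 0 b a)" "a \<noteq> 0 \<or> b \<noteq> 0"
    unfolding ell_L_def line_through_def by auto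
  then show "P \<in> PG3_points" by auto
qed

lemma ell_L_eq: "ell_L = insert (proj (vec4 0 0 1 0)) (range (\<lambda>b. proj (ell_vec b :: 'a::field ^ 4)))"
proof (intro equalityI subsetI)
  fix P :: "('a ^ 4) set" assume P: "P \<in> ell_L"
  obtain v where v: "v \<noteq> 0" "P = proj v" using P ell_L_subset_points PG3_pointsE by blast
  obtain x0 x1 x2 x3 where x: "v = vec4 x0 x1 x2 x3" by (rule vec4_exhaust)
  have e: "x1 = 0" "x3 = x0" using P v proj_in_ell_L_iff[OF v(1)] by (auto simp: x)
  show "P \<in> insert (proj (vec4 0 0 1 0)) (range (\<lambda>b. proj (ell_vec b)))"
  proof (cases "x0 = 0")
    case True
    then have "v = x2 *s vec4 0 0 1 0" "x2 \<noteq> 0" using x e v by auto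
    then show ?thesis using v by (simp add: proj_smult del: vec4_arith)
  next
    case False
    then have "v = x0 *s ell_vec (x2/x0)" using x e by simp
    then show ?thesis using v False by (simp add: proj_smult del: vec4_arith)
  qed
next
  fix P :: "('a ^ 4) set" assume "P \<in> insert (proj (vec4 0 0 1 0)) (range (\<lambda>b. proj (ell_vec b)))"
  then show "P \<in> ell_L" by (auto simp: proj_in_ell_L_iff)
qed

lemma ell_L_not_cubic:
  assumes "P \<in> ell_L" shows "P \<notin> twisted_cubic"
proof -
  have "proj (curve_vec z) \<notin> ell_L" for z :: "'a option"
    by (cases z) (auto simp: proj_in_ell_L_iff curve_vec_def)
  then show ?thesis using assms unfolding twisted_cubic_eq by blast
qed

lemma P_num_ell_L:
  "P_num pt (ell_L :: ('a::{field,finite} ^ 4) set set)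
    = (if pt (proj (vec4 0 0 1 0)) then 1 else 0) + card {b. pt (proj (ell_vec b))}"
proof -
  have inj: "inj (\<lambda>b. proj (ell_vec b :: 'a ^ 4))" by (rule injI) (auto simp: proj_eq_iff)
  have n: "proj (ell_vec b) \<noteq> proj (vec4 0 0 1 0)" for b :: 'a by (auto simp: proj_eq_iff)
  let ?A = "if pt (proj (vec4 0 0 1 0)) then {proj (vec4 0 0 1 0 :: 'a ^ 4)} else {}"
  let ?B = "(\<lambda>b. proj (ell_vec b :: 'a ^ 4)) ` {b. pt (proj (ell_vec b))}"
  have "{P \<in> ell_L. pt P} = ?A \<union> ?B" unfolding ell_L_eq by auto
  moreover have "?A \<inter> ?B = {}" using n by auto
  ultimately have "P_num pt ell_L = card ?A + card ?B" unfolding P_num_def by (simp add: card_Un_disjoint)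
  also have "card ?B = card {b. pt (proj (ell_vec b))}" using inj by (meson card_image inj_on_subset subset_UNIV)
  finally show ?thesis by simp
qed

lemma nroots_tangent_vec: "(3::'a::field) \<noteq> 0 \<Longrightarrow> nroots (vec4 0 0 1 0 :: 'a ^ 4) = 2"
proof -
  assume "(3::'a) \<noteq> 0"
  then have "roots (vec4 0 0 1 0 :: 'a ^ 4) = {None, Some 0}" unfolding roots_eq by (auto simp: cubic_form_def)
  then show ?thesis by simp
qed

definition ell_count :: "'a::{field,finite} itself \<Rightarrow> nat \<Rightarrow> nat" where
  "ell_count _ m = card {b :: 'a. nroots (ell_vec b) = m}"

lemma nroots_ell_vec: "nroots (ell_vec b) = card {t. 1 + 3*b*t^2 = t^3}"
proof -
  have "roots (ell_vec b) = Some ` {t. 1 + 3*b*t^2 = t^3}"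
    unfolding roots_eq by (simp add: cubic_form_def)
  then show ?thesis by (simp add: card_image)
qed

lemma P_num_ell_L_types:
  assumes three: "(3::'a::{field,finite}) \<noteq> 0"
  shows "P_num is_T_point (ell_L :: ('a ^ 4) set set) = 1 + ell_count TYPE('a) 2"
    and "m \<noteq> 2 \<Longrightarrow> P_num (is_Gamma_point m) (ell_L :: ('a ^ 4) set set) = ell_count TYPE('a) m"
    and "P_num is_C_point (ell_L :: ('a ^ 4) set set) = 0"
proof -
  have nz: "vec4 0 0 1 0 \<noteq> (0 :: 'a ^ 4)" "ell_vec b \<noteq> (0 :: 'a ^ 4)" for b by auto
  have nC: "proj (vec4 0 0 1 0 :: 'a ^ 4) \<notin> twisted_cubic" "proj (ell_vec b :: 'a ^ 4) \<notin> twisted_cubic" for b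
    using ell_L_not_cubic unfolding ell_L_eq by blast+
  show "P_num is_T_point (ell_L :: ('a ^ 4) set set) = 1 + ell_count TYPE('a) 2"
    unfolding P_num_ell_L ell_count_def is_T_point_iff[OF three nz(1)] is_T_point_iff[OF three nz(2)]
    by (simp add: nroots_tangent_vec[OF three])
  show "P_num (is_Gamma_point m) (ell_L :: ('a ^ 4) set set) = ell_count TYPE('a) m" if "m \<noteq> 2"
    unfolding P_num_ell_L ell_count_def is_Gamma_point_iff[OF three nz(1)] is_Gamma_point_iff[OF three nz(2)]
    using nC that by (simp add: nroots_tangent_vec[OF three])
  show "P_num is_C_point (ell_L :: ('a ^ 4) set set) = 0"
    unfolding P_num_def is_C_point_def using ell_L_not_cubic by auto
qed

text \<open>The second equation counts the pairs (b, t) with 1 + 3bt^2 = t^3: every nonzero t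
  belongs to exactly one b, and t = 0 to none.\<close>

lemma ell_count_sums:
  assumes three: "(3::'a::{field,finite}) \<noteq> 0"
  shows "ell_count TYPE('a) 0 + ell_count TYPE('a) 1 + ell_count TYPE('a) 2 + ell_count TYPE('a) 3 = CARD('a)"
    and "ell_count TYPE('a) 1 + 2 * ell_count TYPE('a) 2 + 3 * ell_count TYPE('a) 3 = CARD('a) - 1"
proof -
  let ?c = "ell_count TYPE('a)"
  have le: "nroots (ell_vec b :: 'a ^ 4) \<le> 3" for b by (rule nroots_le_3[OF three]) simp
  have S: "(\<Sum>b::'a\<in>UNIV. f (nroots (ell_vec b))) = (\<Sum>m\<le>3. ?c m * f m)" for f :: "nat \<Rightarrow> nat"
  proof -
    have "(\<Sum>b::'a\<in>UNIV. f (nroots (ell_vec b))) = (\<Sum>m\<le>3. \<Sum>b\<in>{b \<in> UNIV. nroots (ell_vec b :: 'a ^ 4) = m}. f (nroots (ell_vec b)))"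
      by (rule sum.group[symmetric]) (use le in auto)
    also have "\<dots> = (\<Sum>m\<le>3. \<Sum>b\<in>{b \<in> UNIV. nroots (ell_vec b :: 'a ^ 4) = m}. f m)"
      by (intro sum.cong) auto
    finally show ?thesis by (simp add: ell_count_def)
  qed
  have i: "{..3::nat} = {0,1,2,3}" by auto
  show "?c 0 + ?c 1 + ?c 2 + ?c 3 = CARD('a)"
    using S[of "\<lambda>_. 1"] by (simp add: i)
  have "(\<Sum>b::'a\<in>UNIV. nroots (ell_vec b)) = (\<Sum>b::'a\<in>UNIV. card {t \<in> - {0}. 1 + 3*b*t^2 = t^3})"
  proof (rule sum.cong)
    fix b :: 'a
    have "{t. 1 + 3*b*t^2 = t^3} = {t \<in> - {0}. 1 + 3*b*t^2 = t^3}" by auto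
    then show "nroots (ell_vec b) = card {t \<in> - {0}. 1 + 3*b*t^2 = t^3}" unfolding nroots_ell_vec by simp
  qed simp
  also have "\<dots> = 1 * card (- {0::'a})"
  proof (rule sum_multicount)
    have "card {b \<in> UNIV. 1 + 3*b*t^2 = t^3} = 1" if t: "t \<noteq> 0" for t :: 'a
    proof -
      have "{b \<in> UNIV. 1 + 3*b*t^2 = t^3} = {(t^3 - 1) / (3*t^2)}" using t three by (auto simp: field_simps)
      then show ?thesis by simp
    qed
    then show "\<forall>t\<in>- {0::'a}. card {b \<in> UNIV. 1 + 3*b*t^2 = t^3} = 1" by blast
  qed auto
  also have "\<dots> = CARD('a) - 1" by (simp add: Compl_eq_Diff_UNIV)
  finally show "?c 1 + 2 * ?c 2 + 3 * ?c 3 = CARD('a) - 1"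
    using S[of "\<lambda>n. n"] by (simp add: i)
qed

text \<open>Since x1 = 0, the tangent equations force the double zero to be 2b; what remains of them
  is 4b^3 = -1.\<close>

lemma nroots_ell_vec_2_iff:
  assumes three: "(3::'a::{field,finite}) \<noteq> 0"
  shows "nroots (ell_vec b :: 'a ^ 4) = 2 \<longleftrightarrow> 4 * b^3 = -1"
proof
  assume "nroots (ell_vec b :: 'a ^ 4) = 2"
  then obtain z where z: "on_tangent_at (ell_vec b) z" using nroots_2_on_tangent[OF three] by blast
  then obtain t where "z = Some t" by (cases z) (auto simp: on_tangent_at_def)
  then have e: "2*t*b = t^2" "1 = 3*t^2*b - 2*t^3" using z by (auto simp: on_tangent_at_def)
  have "t \<noteq> 0" using e(2) by auto
  then have "t = 2*b" using e(1) by (simp add: power2_eq_square)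
  then have "1 = - (4 * b^3)" using e(2) by (simp add: power2_eq_square power3_eq_cube algebra_simps)
  then show "4 * b^3 = -1" by (metis minus_minus)
next
  assume b: "4 * b^3 = -1"
  have "3*(2*b)^2*b - 2*(2*b)^3 = - (4 * b^3)" by (simp add: power2_eq_square power3_eq_cube algebra_simps)
  then have "1 = 3*(2*b)^2*b - 2*(2*b)^3" using b by simp
  then have t: "on_tangent_at (ell_vec b) (Some (2*b))"
    by (simp add: on_tangent_at_def power2_eq_square)
  have "proj (ell_vec b :: 'a ^ 4) \<notin> twisted_cubic" by (rule ell_L_not_cubic) (simp add: ell_L_eq)
  then show "nroots (ell_vec b :: 'a ^ 4) = 2" using nroots_on_tangent[OF three _ t] by simp
qed

text \<open>For nonzero t let f t be the b for which t is a zero. Dividing by x - t leaves t^2 x^2 +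
  x + t up to a factor, and y = t^2 x turns this into y^2 + y + t^3. If that has no root, t is the
  only zero; the converse has to exclude a triple zero.\<close>

lemma ell_count_1:
  assumes three: "(3::'a::{field,finite}) \<noteq> 0"
  shows "ell_count TYPE('a) 1 = card {t :: 'a. \<not> (\<exists>y. y^2 + y + t^3 = 0)}"
proof -
  define f :: "'a \<Rightarrow> 'a" where "f t = (t^3 - 1) / (3*t^2)" for t
  have fb: "1 + 3*b*t^2 = t^3 \<longleftrightarrow> t \<noteq> 0 \<and> b = f t" for b t
    using three by (cases "t = 0") (auto simp: f_def field_simps)
  have fac: "t^2 * (t^2 * (x^3 - 1 - 3 * f t * x^2)) = (x - t) * ((t^2*x)^2 + t^2*x + t^3)" if "t \<noteq> 0" for x t
  proof -
    have "3 * f t * t^2 = t^3 - 1" using that three by (simp add: f_def)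
    moreover have "t^2 * (x^3 - 1 - 3 * f t * x^2) = t^2 * x^3 - t^2 - (3 * f t * t^2) * x^2"
      by (simp add: algebra_simps)
    ultimately have "t^2 * (x^3 - 1 - 3 * f t * x^2) = t^2 * x^3 - t^2 - (t^3 - 1) * x^2" by simp
    then have "t^2 * (t^2 * (x^3 - 1 - 3 * f t * x^2)) = t^2 * (t^2 * x^3 - t^2 - (t^3 - 1) * x^2)" by simp
    also have "\<dots> = (x - t) * ((t^2*x)^2 + t^2*x + t^3)"
      by (simp add: power2_eq_square power3_eq_cube algebra_simps)
    finally show ?thesis .
  qed
  let ?T = "{t :: 'a. \<not> (\<exists>y. y^2 + y + t^3 = 0)}"
  have nz: "t \<noteq> 0" if "t \<in> ?T" for t
  proof
    assume "t = 0"
    then have "0^2 + 0 + t^3 = 0" by simp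
    then show False using that by blast
  qed
  have fT: "{x. 1 + 3 * f t * x^2 = x^3} = {t}" if "t \<in> ?T" for t
  proof -
    have t: "t \<noteq> 0" using nz that .
    have "x = t" if x: "1 + 3 * f t * x^2 = x^3" for x
    proof -
      have "x^3 - 1 - 3 * f t * x^2 = 0" unfolding x[symmetric] by simp
      then have "(x - t) * ((t^2*x)^2 + t^2*x + t^3) = 0" using fac[OF t, of x] by simp
      then show ?thesis using \<open>t \<in> ?T\<close> by auto
    qed
    moreover have "1 + 3 * f t * t^2 = t^3" using fb t by blast
    ultimately show ?thesis by blast
  qed
  have "bij_betw f ?T {b. nroots (ell_vec b) = 1}"
    unfolding bij_betw_def
  proof
    show "inj_on f ?T"
    proof (rule inj_onI)
      fix t t' assume t: "t \<in> ?T" and t': "t' \<in> ?T" and e: "f t = f t'"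
      have "{x. 1 + 3 * f t * x^2 = x^3} = {x. 1 + 3 * f t' * x^2 = x^3}" by (simp only: e)
      then have "{t} = {t'}" unfolding fT[OF t] fT[OF t'] .
      then show "t = t'" by blast
    qed
    show "f ` ?T = {b. nroots (ell_vec b) = 1}"
    proof (intro equalityI subsetI)
      fix b :: 'a assume "b \<in> {b. nroots (ell_vec b) = 1}"
      then obtain t where R: "{t. 1 + 3*b*t^2 = t^3} = {t}" unfolding nroots_ell_vec by (auto simp: card_1_singleton_iff)
      then have "1 + 3*b*t^2 = t^3" by blast
      then have t: "t \<noteq> 0" "b = f t" using fb by auto
      have "\<not> (y^2 + y + t^3 = 0)" for y
      proof
        \<comment> \<open>A root w yields the zero w / t^2 of the cubic, which must be t.\<close>
        have *: "w = t^3" if "w^2 + w + t^3 = 0" for w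
        proof -
          define x where "x = w / t^2"
          have w: "w = t^2 * x" using t by (simp add: x_def)
          have "t^2 * (t^2 * (x^3 - 1 - 3 * f t * x^2)) = 0" unfolding fac[OF t(1)] using that by (simp add: w)
          then have "x^3 - 1 - 3 * f t * x^2 = 0" using t(1) by simp
          then have "1 + 3*b*x^2 = x^3" using t(2) by (simp add: algebra_simps)
          then have "x = t" using R by blast
          then show ?thesis using w by (simp add: power2_eq_square power3_eq_cube)
        qed
        assume y: "y^2 + y + t^3 = 0"
        \<comment> \<open>Both roots y and -1 - y would equal t^3; then 2t^3 = -1 and t^3 = -2, so 3
          = 0.\<close>
        have "(-1 - y)^2 + (-1 - y) + t^3 = y^2 + y + t^3" by (simp add: power2_eq_square algebra_simps)
        then have "-1 - y = t^3" using y * by simp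
        moreover have yt: "y = t^3" using y * by blast
        ultimately have 1: "2 * t^3 = -1" by (simp add: algebra_simps)
        have "t^3 * (t^3 + 2) = 0" using y unfolding yt by (simp add: power2_eq_square algebra_simps)
        then have "t^3 = -2" using t by (simp add: eq_neg_iff_add_eq_0)
        then have "(4::'a) = 1" using 1 by simp
        moreover have "(3::'a) = 4 - 1" by simp
        ultimately show False using three by simp
      qed
      then show "b \<in> f ` ?T" using t by blast
    qed (use fT in \<open>auto simp: nroots_ell_vec\<close>)
  qed
  then show ?thesis unfolding ell_count_def by (simp add: bij_betw_same_card)
qed

section \<open>The orbit of the line\<close>

lemma orbit_L_eq:
  assumes q: "CARD('a::{field,finite}) \<ge> 5"
  shows "(orbit_L :: ('a ^ 4) set set set) = {proj_map (sym3 a b c d) ` ell_L | a b c d. a*d - b*c \<noteq> 0}"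
proof (intro equalityI subsetI)
  fix l :: "('a ^ 4) set set" assume "l \<in> orbit_L"
  then obtain A where A: "A \<in> Gq" "l = proj_map A ` ell_L" unfolding orbit_L_def by blast
  show "l \<in> {proj_map (sym3 a b c d) ` ell_L | a b c d. a*d - b*c \<noteq> 0}"
  proof (rule Gq_sym3[OF q A(1)])
    fix a b c d k
    assume k: "a*d - b*c \<noteq> 0" "k \<noteq> 0" "\<And>v. A *v v = k *s (sym3 a b c d *v v)"
    have "proj_map A P = proj_map (sym3 a b c d) P" if P: "P \<in> ell_L" for P
    proof -
      obtain v where "P = proj v" using P ell_L_subset_points PG3_pointsE by blast
      then show ?thesis by (simp add: proj_map_proj k proj_smult)
    qed
    then have "l = proj_map (sym3 a b c d) ` ell_L" unfolding A(2) by (rule image_cong[OF refl])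
    then show ?thesis using k by blast
  qed
next
  fix l :: "('a ^ 4) set set" assume "l \<in> {proj_map (sym3 a b c d) ` ell_L | a b c d. a*d - b*c \<noteq> 0}"
  then show "l \<in> orbit_L" unfolding orbit_L_def using sym3_in_Gq by blast
qed

lemma orbit_LE:
  assumes "CARD('a::{field,finite}) \<ge> 5" "l \<in> (orbit_L :: ('a ^ 4) set set set)"
  obtains a b c d where "a*d - b*c \<noteq> 0" "l = proj_map (sym3 a b c d) ` ell_L"
  using assms unfolding orbit_L_eq[OF assms(1)] by blast

lemma proj_map_sym3_adj:
  assumes "a*d - b*c \<noteq> 0"
  shows "proj_map (sym3 d (-b) (-c) a) (proj_map (sym3 a b c d) (proj v)) = proj v"
    "proj_map (sym3 a b c d) (proj_map (sym3 d (-b) (-c) a) (proj v)) = proj v"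
  using assms by (simp_all add: proj_map_proj sym3_adj proj_smult)

lemma proj_in_sym3_line_iff:
  assumes "a*d - b*c \<noteq> 0"
  shows "proj v \<in> proj_map (sym3 a b c d) ` l \<longleftrightarrow> proj (sym3 d (-b) (-c) a *v v) \<in> l"
proof -
  have "proj v \<in> proj_map (sym3 a b c d) ` l \<longleftrightarrow>
      proj_map (sym3 a b c d) (proj (sym3 d (-b) (-c) a *v v)) \<in> proj_map (sym3 a b c d) ` l"
    using proj_map_sym3_adj(2)[OF assms, of v] by (simp add: proj_map_proj)
  also have "\<dots> \<longleftrightarrow> proj (sym3 d (-b) (-c) a *v v) \<in> l"
    by (rule inj_image_mem_iff[OF proj_map_inj[OF sym3_inj[OF assms]]])
  finally show ?thesis .
qed

lemma sym3_line_subset_points: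
  assumes "a*d - b*c \<noteq> 0" "l \<subseteq> PG3_points"
  shows "proj_map (sym3 a b c d) ` l \<subseteq> PG3_points"
proof
  fix P assume "P \<in> proj_map (sym3 a b c d) ` l"
  then obtain R where R: "R \<in> PG3_points" "P = proj_map (sym3 a b c d) R" using assms(2) by blast
  obtain v where "v \<noteq> 0" "R = proj v" using R(1) by (rule PG3_pointsE)
  then show "P \<in> PG3_points" using R sym3_eq_0[OF assms(1)] by (simp add: proj_map_proj)
qed

section \<open>Counts that are constant along the orbit\<close>

definition invariant_type :: "(('a::field ^ 4) set \<Rightarrow> bool) \<Rightarrow> bool" where
  "invariant_type pt \<longleftrightarrow> (\<forall>v w. sym3_equiv v w \<longrightarrow> v \<noteq> 0 \<longrightarrow> pt (proj v) = pt (proj w))"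

lemma invariant_types:
  assumes three: "(3::'a::{field,finite}) \<noteq> 0"
  shows "invariant_type (is_T_point :: ('a ^ 4) set \<Rightarrow> bool)"
    and "invariant_type (is_Gamma_point m :: ('a ^ 4) set \<Rightarrow> bool)"
    and "invariant_type (is_C_point :: ('a ^ 4) set \<Rightarrow> bool)"
proof -
  have *: "w \<noteq> 0 \<and> nroots w = nroots v \<and> (proj w \<in> twisted_cubic \<longleftrightarrow> proj v \<in> twisted_cubic)"
    if "sym3_equiv v w" "v \<noteq> 0" for v w :: "'a ^ 4"
    using sym3_equiv_nonzero[OF that(1)] sym3_equiv_nroots[OF that(1)] sym3_equiv_twisted_cubic[OF that(1)] that(2)
    by blast
  show "invariant_type (is_T_point :: ('a ^ 4) set \<Rightarrow> bool)"
    unfolding invariant_type_def by (intro allI impI) (use * in \<open>simp add: is_T_point_iff[OF three]\<close>)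
  show "invariant_type (is_Gamma_point m :: ('a ^ 4) set \<Rightarrow> bool)"
    unfolding invariant_type_def by (intro allI impI) (use * in \<open>simp add: is_Gamma_point_iff[OF three]\<close>)
  show "invariant_type (is_C_point :: ('a ^ 4) set \<Rightarrow> bool)"
    unfolding invariant_type_def is_C_point_def by (intro allI impI) (use * in simp)
qed

lemma sym3_equiv_self: "a*d - b*c \<noteq> 0 \<Longrightarrow> sym3_equiv v (sym3 a b c d *v v)"
  by (rule sym3_equivI[of a d b c 1]) simp_all

lemma P_num_orbit_L:
  fixes pt :: "('a::{field,finite} ^ 4) set \<Rightarrow> bool"
  assumes q: "CARD('a) \<ge> 5" and l: "l \<in> orbit_L" and inv: "invariant_type pt"
  shows "P_num pt l = P_num pt ell_L"
proof -
  obtain a b c d where g: "a*d - b*c \<noteq> 0" "l = proj_map (sym3 a b c d) ` ell_L" using orbit_LE[OF q l] .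
  have "pt (proj_map (sym3 a b c d) P) = pt P" if P: "P \<in> ell_L" for P
  proof -
    obtain v where "v \<noteq> 0" "P = proj v" using P ell_L_subset_points PG3_pointsE by blast
    then show ?thesis using inv sym3_equiv_self[OF g(1), of v] unfolding invariant_type_def by (simp add: proj_map_proj)
  qed
  then have "{P \<in> l. pt P} = proj_map (sym3 a b c d) ` {P \<in> ell_L. pt P}" unfolding g(2) by auto
  moreover have "inj_on (proj_map (sym3 a b c d)) {P \<in> ell_L. pt P}"
    by (rule inj_on_subset[OF proj_map_inj[OF sym3_inj[OF g(1)]]]) simp
  ultimately show ?thesis unfolding P_num_def by (simp add: card_image)
qed

lemma orbit_L_sym3:
  assumes q: "CARD('a::{field,finite}) \<ge> 5" and l: "l \<in> (orbit_L :: ('a ^ 4) set set set)" and g: "a*d - b*c \<noteq> 0"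
  shows "proj_map (sym3 a b c d) ` l \<in> orbit_L"
proof -
  obtain a' b' c' d' where g': "a'*d' - b'*c' \<noteq> 0" "l = proj_map (sym3 a' b' c' d') ` ell_L" using orbit_LE[OF q l] .
  let ?M = "sym3 (a*a' + b*c') (a*b' + b*d') (c*a' + d*c') (c*b' + d*d')"
  have "proj_map (sym3 a b c d) ` l = proj_map ?M ` ell_L"
  proof -
    have "proj_map (sym3 a b c d) (proj_map (sym3 a' b' c' d') P) = proj_map ?M P" if P: "P \<in> ell_L" for P
    proof -
      obtain v where "P = proj v" using P ell_L_subset_points PG3_pointsE by blast
      then show ?thesis by (simp add: proj_map_proj sym3_comp)
    qed
    then show ?thesis unfolding g'(2) image_image by (rule image_cong[OF refl])
  qed
  moreover have "(a*a' + b*c') * (c*b' + d*d') - (a*b' + b*d') * (c*a' + d*c') = (a*d - b*c) * (a'*d' - b'*c')"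
    by (simp add: algebra_simps)
  then have "(a*a' + b*c') * (c*b' + d*d') - (a*b' + b*d') * (c*a' + d*c') \<noteq> 0" using g g' by simp
  ultimately show ?thesis unfolding orbit_L_eq[OF q] by blast
qed

lemma L_num_sym3_le:
  assumes q: "CARD('a::{field,finite}) \<ge> 5" and g: "a*d - b*c \<noteq> (0::'a)"
  shows "L_num (proj v) \<le> L_num (proj (sym3 a b c d *v v))"
proof -
  let ?f = "\<lambda>l. proj_map (sym3 a b c d) ` l"
  have "inj (proj_map (sym3 a b c d))" using proj_map_inj[OF sym3_inj[OF g]] .
  then have inj: "inj ?f" unfolding inj_def[of ?f] by (simp add: inj_image_eq_iff)
  have "?f ` {l \<in> orbit_L. proj v \<in> l} \<subseteq> {l \<in> orbit_L. proj (sym3 a b c d *v v) \<in> l}"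
    using orbit_L_sym3[OF q _ g] by (auto simp: proj_map_proj[symmetric])
  then have "card (?f ` {l \<in> orbit_L. proj v \<in> l}) \<le> card {l \<in> orbit_L. proj (sym3 a b c d *v v) \<in> l}"
    by (intro card_mono) auto
  moreover have "card (?f ` {l \<in> orbit_L. proj v \<in> l}) = card {l \<in> orbit_L. proj v \<in> l}"
    using inj by (meson card_image inj_on_subset subset_UNIV)
  ultimately show ?thesis unfolding L_num_def by simp
qed

lemma L_num_sym3_equiv:
  assumes q: "CARD('a::{field,finite}) \<ge> 5" and e: "sym3_equiv v (w :: 'a ^ 4)"
  shows "L_num (proj v) = L_num (proj w)"
proof -
  have le: "L_num (proj v) \<le> L_num (proj w)" if e: "sym3_equiv v w" for v w :: "'a ^ 4"
    using e
  proof (rule sym3_equivE)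
    fix a b c d k assume g: "a*d - b*c \<noteq> 0" "k \<noteq> 0" "sym3 a b c d *v v = k *s w"
    show ?thesis using L_num_sym3_le[OF q g(1), of v] unfolding g(3) proj_smult[OF g(2)] .
  qed
  show ?thesis using le[OF e] le[OF sym3_equiv_sym[OF e]] by simp
qed

lemma double_count:
  fixes pt :: "('a::{field,finite} ^ 4) set \<Rightarrow> bool"
  assumes q: "CARD('a) \<ge> 5" and inv: "invariant_type pt"
    and L: "\<And>P. P \<in> PG3_points \<Longrightarrow> pt P \<Longrightarrow> L_num P = L"
  shows "num_points pt * L = card (orbit_L :: ('a ^ 4) set set set) * P_num pt ell_L"
proof -
  let ?A = "{P \<in> PG3_points. pt P}"
  have sub: "l \<subseteq> PG3_points" if "l \<in> orbit_L" for l :: "('a ^ 4) set set"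
    by (rule orbit_LE[OF q that]) (use sym3_line_subset_points[OF _ ell_L_subset_points] in blast)
  have "num_points pt * L = (\<Sum>P\<in>?A. L_num P)" using L by (simp add: num_points_def)
  also have "\<dots> = (\<Sum>P\<in>?A. card {l \<in> orbit_L. P \<in> l})" unfolding L_num_def ..
  also have "\<dots> = P_num pt ell_L * card (orbit_L :: ('a ^ 4) set set set)"
  proof (rule sum_multicount)
    show "\<forall>l\<in>orbit_L. card {P \<in> ?A. P \<in> l} = P_num pt ell_L"
    proof
      fix l :: "('a ^ 4) set set" assume l: "l \<in> orbit_L"
      have "{P \<in> ?A. P \<in> l} = {P \<in> l. pt P}" using sub[OF l] by blast
      then show "card {P \<in> ?A. P \<in> l} = P_num pt ell_L" using P_num_orbit_L[OF q l inv] by (simp add: P_num_def)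
    qed
  qed auto
  finally show ?thesis by simp
qed

section \<open>Lines of the orbit through a T-point\<close>

lemma proj_map_line_through: "proj_map A ` line_through u w = line_through (A *v u) (A *v w)"
proof -
  have e: "A *v (a *s u + b *s w) = a *s (A *v u) + b *s (A *v w)" for a b
    by (simp add: matrix_vector_right_distrib vec.scale)
  show ?thesis unfolding line_through_def by (auto simp: image_iff proj_map_proj e) (metis e proj_map_proj)+
qed

text \<open>A T-point \<open>ell_vec b\<close> has double zero 2b and simple zero -b. Sending 0 and
  infinity there fixes the substitution up to one scale; the scale chosen makes it trace-free, an
  involution that exchanges this T-point with (0, 0, 1, 0).\<close>

lemma ell_L_tangent_transitive:
  assumes three: "(3::'a::{field,finite}) \<noteq> 0" and v: "proj v \<in> ell_L" "v \<noteq> 0" "nroots (v :: 'a ^ 4) = 2"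
  obtains a b c d where "a*d - b*c \<noteq> 0" "proj_map (sym3 a b c d) ` ell_L = ell_L"
     "proj (sym3 a b c d *v vec4 0 0 1 0) = proj v"
proof (cases "proj v = proj (vec4 0 0 1 0)")
  case True
  have "proj_map (sym3 1 0 0 1) P = P" if P: "P \<in> ell_L" for P :: "('a ^ 4) set"
  proof -
    obtain w where "P = proj w" using P ell_L_subset_points PG3_pointsE by blast
    then show ?thesis by (simp add: proj_map_proj sym3_scalar)
  qed
  then have "proj_map (sym3 1 0 0 1) ` ell_L = (ell_L :: ('a ^ 4) set set)" by simp
  moreover have "proj (sym3 1 0 0 1 *v vec4 0 0 1 0) = proj v" using True by (simp add: sym3_scalar)
  ultimately show ?thesis using that[of 1 1 0 0] by simp
next
  case False
  then obtain b where b: "proj v = proj (ell_vec b)" using v(1) unfolding ell_L_eq by blast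
  have "nroots (ell_vec b) = 2" using b v(3) roots_smult unfolding proj_eq_iff by metis
  then have b3: "4 * b^3 = -1" using nroots_ell_vec_2_iff[OF three] by blast
  then have "b \<noteq> 0" by auto
  \<comment> \<open>the substitution sends the double root 0 to 2b and the simple root at infinity to -b\<close>
  let ?M = "sym3 (-b) (2*b^2) 1 b"
  have det: "(-b) * b - (2*b^2) * 1 \<noteq> 0"
  proof -
    have "(-b) * b - (2*b^2) * 1 = - (3 * b^2)" by (simp add: power2_eq_square)
    then show ?thesis using three \<open>b \<noteq> 0\<close> by simp
  qed
  \<comment> \<open>The factor 4b^3 is kept intact so that it can be rewritten to -1.\<close>
  have "?M *v vec4 0 0 1 0 = vec4 (3*b^2 * - (4 * b^3)) 0 (3*b^2 * b) (3*b^2)"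
    by (simp add: sym3_mult_vec power2_eq_square power3_eq_cube)
  then have e2: "?M *v vec4 0 0 1 0 = (3*b^2) *s ell_vec b" unfolding b3 by simp
  have "?M *v vec4 1 0 0 1 = vec4 (2 * b^3 * (4 * b^3) - b^3) (b^2 * (1 + 4 * b^3)) (- b + 2*b^2*b^2) (1 + b^3)"
    by (simp add: sym3_mult_vec power2_eq_square power3_eq_cube algebra_simps)
  also have "2 * b^3 * (4 * b^3) - b^3 = 1 + b^3"
  proof -
    have "2 * b^3 * (4 * b^3) - b^3 = - (4 * b^3) + b^3" by (subst b3) simp
    then show ?thesis unfolding b3 by simp
  qed
  finally have e0: "?M *v vec4 1 0 0 1 = vec4 (1 + b^3) 0 (- b + 2*b^2*b^2) (1 + b^3)" using b3 by simp
  have "proj_map ?M ` ell_L \<subseteq> ell_L"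
  proof
    fix P assume P: "P \<in> proj_map ?M ` ell_L"
    have "P \<in> PG3_points" using P sym3_line_subset_points[OF det ell_L_subset_points] by blast
    then obtain w where w: "w \<noteq> 0" "P = proj w" by (rule PG3_pointsE)
    have "proj w \<in> line_through (?M *v vec4 1 0 0 1) (?M *v vec4 0 0 1 0)"
      using P w unfolding ell_L_def proj_map_line_through by simp
    then obtain k m where "w = k *s (?M *v vec4 1 0 0 1) + m *s (?M *v vec4 0 0 1 0)"
      unfolding proj_in_line_through_iff[OF w(1)] by blast
    then show "P \<in> ell_L" unfolding w(2) proj_in_ell_L_iff[OF w(1)] unfolding e0 e2 by simp
  qed
  moreover have "inj_on (proj_map ?M) ell_L" using proj_map_inj[OF sym3_inj[OF det]] inj_on_subset by blast
  moreover have "finite (ell_L :: ('a ^ 4) set set)" unfolding ell_L_eq by simp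
  ultimately have "proj_map ?M ` ell_L = ell_L" by (intro endo_inj_surj)
  moreover have "proj (?M *v vec4 0 0 1 0) = proj v" unfolding e2 b using three \<open>b \<noteq> 0\<close> by (intro proj_smult) simp
  ultimately show ?thesis using that[OF det] by blast
qed

lemma line_through_smult:
  assumes "k \<noteq> 0" "m \<noteq> 0" shows "line_through (k *s u) (m *s w) = line_through u w"
proof -
  have "line_through (k *s u) (m *s w) \<subseteq> line_through u w" if "k \<noteq> 0" "m \<noteq> 0" for k m u w
  proof
    fix P assume "P \<in> line_through (k *s u) (m *s w)"
    then obtain a b where "P = proj ((a*k) *s u + (b*m) *s w)" "a \<noteq> 0 \<or> b \<noteq> 0"
      unfolding line_through_def by (auto simp: vector_smult_assoc)
    moreover then have "a*k \<noteq> 0 \<or> b*m \<noteq> 0" using that by auto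
    ultimately show "P \<in> line_through u w" unfolding line_through_def by blast
  qed
  from this[of k m u w] this[of "inverse k" "inverse m" "k *s u" "m *s w"] show ?thesis
    using assms by (auto simp: vector_smult_assoc)
qed

text \<open>The form 3t^2 s has its double zero at 0 and its simple zero at infinity; a substitution
  fixing the point fixes both parameters and is therefore diagonal.\<close>

lemma sym3_fixing_tangent_vec:
  assumes three: "(3::'a::field) \<noteq> 0" and g: "a*d - b*c \<noteq> (0::'a)"
    and fix_vec: "proj (sym3 a b c d *v vec4 0 0 1 0) = proj (vec4 0 0 1 0)"
  shows "a \<noteq> 0" "d \<noteq> 0" "b = 0" "c = 0"
proof -
  obtain k where "sym3 a b c d *v vec4 0 0 1 0 = k *s vec4 0 0 1 0" using fix_vec[symmetric] unfolding proj_eq_iff by blast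
  then have e: "a*b^2 = 0" "2*a*b*d + b^2*c = 0" "c*d^2 = 0" using three by (auto simp: sym3_mult_vec)
  show "a \<noteq> 0" using e g by auto
  then show "b = 0" using e(1) by simp
  then show "d \<noteq> 0" using g by auto
  then show "c = 0" using e(3) by simp
qed

text \<open>If g maps the line to a line through (0, 0, 1, 0), a symmetry of the line corrects g to
  a substitution fixing that point, hence a diagonal one with entries alpha, delta. It produces the
  line with x = (alpha/delta)^3, whence the cubes.\<close>

lemma lines_through_tangent_vec:
  assumes three: "(3::'a::{field,finite}) \<noteq> 0" and q: "CARD('a) \<ge> 5"
  shows "{l \<in> (orbit_L :: ('a ^ 4) set set set). proj (vec4 0 0 1 0) \<in> l}
     = (\<lambda>x. line_through (vec4 x 0 0 1) (vec4 0 0 1 0)) ` (\<lambda>x. x^3) ` (- {0})"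
proof (intro equalityI subsetI)
  fix l :: "('a ^ 4) set set" assume l: "l \<in> {l \<in> orbit_L. proj (vec4 0 0 1 0) \<in> l}"
  then have lo: "l \<in> orbit_L" by blast
  obtain a b c d where g: "a*d - b*c \<noteq> 0" "l = proj_map (sym3 a b c d) ` ell_L" using orbit_LE[OF q lo] .
  define v where "v = sym3 d (-b) (-c) a *v vec4 0 0 1 0"
  have det: "d * a - (-b) * (-c) \<noteq> 0" using g(1) by (simp add: algebra_simps)
  have vl: "proj v \<in> ell_L" using l proj_in_sym3_line_iff[OF g(1), of "vec4 0 0 1 0" ell_L] g(2) by (simp add: v_def)
  have v0: "v \<noteq> 0" unfolding v_def sym3_eq_0[OF det] by simp
  have vn: "nroots v = 2" unfolding v_def nroots_sym3[OF det] by (rule nroots_tangent_vec[OF three])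
  obtain a' b' c' d' where h: "a'*d' - b'*c' \<noteq> 0" "proj_map (sym3 a' b' c' d') ` ell_L = (ell_L :: ('a ^ 4) set set)"
     "proj (sym3 a' b' c' d' *v vec4 0 0 1 0) = proj v"
    using ell_L_tangent_transitive[OF three vl v0 vn] .
  define \<alpha> \<beta> \<gamma> \<delta> where "\<alpha> = a*a' + b*c'" and "\<beta> = a*b' + b*d'" and "\<gamma> = c*a' + d*c'" and "\<delta> = c*b' + d*d'"
  have comp: "sym3 a b c d *v (sym3 a' b' c' d' *v w) = sym3 \<alpha> \<beta> \<gamma> \<delta> *v w" for w
    by (simp add: sym3_comp \<alpha>_def \<beta>_def \<gamma>_def \<delta>_def)
  have "\<alpha>*\<delta> - \<beta>*\<gamma> = (a*d - b*c) * (a'*d' - b'*c')" by (simp add: \<alpha>_def \<beta>_def \<gamma>_def \<delta>_def algebra_simps)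
  then have det': "\<alpha>*\<delta> - \<beta>*\<gamma> \<noteq> 0" using g h by simp
  have "proj (sym3 \<alpha> \<beta> \<gamma> \<delta> *v vec4 0 0 1 0) = proj_map (sym3 a b c d) (proj v)"
    unfolding h(3)[symmetric] by (simp only: proj_map_proj comp)
  also have "\<dots> = proj (vec4 0 0 1 0)"
    using proj_map_sym3_adj(2)[OF g(1), of "vec4 0 0 1 0"] by (simp add: v_def proj_map_proj)
  finally have fixed: "proj (sym3 \<alpha> \<beta> \<gamma> \<delta> *v vec4 0 0 1 0) = proj (vec4 0 0 1 0)" .
  note f = sym3_fixing_tangent_vec[OF three det' fixed]
  have "l = proj_map (sym3 a b c d) ` proj_map (sym3 a' b' c' d') ` ell_L" using g h by simp
  also have "\<dots> = line_through (sym3 \<alpha> \<beta> \<gamma> \<delta> *v vec4 1 0 0 1) (sym3 \<alpha> \<beta> \<gamma> \<delta> *v vec4 0 0 1 0)"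
    unfolding ell_L_def proj_map_line_through comp ..
  also have "\<dots> = line_through (\<delta>^3 *s vec4 ((\<alpha>/\<delta>)^3) 0 0 1) ((\<alpha>*\<delta>^2) *s vec4 0 0 1 0)"
    using f by (simp add: sym3_mult_vec power_divide)
  also have "\<dots> = line_through (vec4 ((\<alpha>/\<delta>)^3) 0 0 1) (vec4 0 0 1 0)"
    using f by (intro line_through_smult) auto
  finally show "l \<in> (\<lambda>x. line_through (vec4 x 0 0 1) (vec4 0 0 1 0)) ` (\<lambda>x. x^3) ` (- {0})"
    using f by auto
next
  fix l :: "('a ^ 4) set set" assume "l \<in> (\<lambda>x. line_through (vec4 x 0 0 1) (vec4 0 0 1 0)) ` (\<lambda>x. x^3) ` (- {0})"
  then obtain a where a: "a \<noteq> 0" "l = line_through (vec4 (a^3) 0 0 1) (vec4 0 0 1 0)" by auto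
  have "proj_map (sym3 a 0 0 1) ` ell_L = line_through (1 *s vec4 (a^3) 0 0 1) (a *s vec4 0 0 1 0)"
    unfolding ell_L_def proj_map_line_through by (simp add: sym3_mult_vec)
  also have "\<dots> = l" unfolding a(2) using a(1) by (intro line_through_smult) auto
  finally have e: "proj_map (sym3 a 0 0 1) ` ell_L = l" .
  have "sym3 a 0 0 1 \<in> Gq" by (rule sym3_in_Gq) (use a(1) in simp)
  then have "l \<in> orbit_L" unfolding orbit_L_def e[symmetric] by blast
  moreover have "proj (vec4 0 0 1 0) \<in> l" unfolding a(2)
    by (subst proj_in_line_through_iff, simp, rule exI[of _ 0], rule exI[of _ 1]) simp
  ultimately show "l \<in> {l \<in> orbit_L. proj (vec4 0 0 1 0) \<in> l}" by blast
qed

lemma L_num_tangent_vec: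
  assumes three: "(3::'a::{field,finite}) \<noteq> 0" and q: "CARD('a) \<ge> 5"
  shows "L_num (proj (vec4 0 0 1 0 :: 'a ^ 4)) = card ((\<lambda>x::'a. x^3) ` (- {0}))"
proof -
  let ?l = "\<lambda>x::'a. line_through (vec4 x 0 0 1) (vec4 0 0 1 0)"
  have "inj ?l"
  proof (rule injI)
    fix x y assume "?l x = ?l y"
    moreover have "proj (vec4 x 0 0 1) \<in> ?l x"
      by (subst proj_in_line_through_iff, simp, rule exI[of _ 1], rule exI[of _ 0]) simp
    ultimately have "proj (vec4 x 0 0 1) \<in> ?l y" by simp
    then show "x = y" by (subst (asm) proj_in_line_through_iff) auto
  qed
  then show ?thesis unfolding L_num_def lines_through_tangent_vec[OF three q]
    by (meson card_image inj_on_subset subset_UNIV)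
qed

text \<open>Cubing is a homomorphism of the multiplicative group, so a nonempty fibre is a coset of
  its kernel.\<close>

lemma card_cube_fiber:
  fixes y :: "'a::{field,finite}"
  assumes "y \<in> (\<lambda>x. x^3) ` (- {0})"
  shows "card {x \<in> - {0}. x^3 = y} = card {x::'a. x^3 = 1}"
proof -
  obtain z where z: "z \<noteq> 0" "y = z^3" using assms by auto
  have "bij_betw ((*) z) {x. x^3 = 1} {x \<in> - {0}. x^3 = y}"
    by (rule bij_betw_byWitness[where f' = "\<lambda>x. x / z"])
       (use z in \<open>auto simp: power_mult_distrib power_divide\<close>)
  then show ?thesis by (simp add: bij_betw_same_card)
qed

lemma card_cubes:
  "card ((\<lambda>x::'a::{field,finite}. x^3) ` (- {0})) * card {x::'a. x^3 = 1} = CARD('a) - 1"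
proof -
  have "CARD('a) - 1 = (\<Sum>x\<in>-{0::'a}. 1)" by (simp add: Compl_eq_Diff_UNIV)
  also have "\<dots> = (\<Sum>y\<in>(\<lambda>x::'a. x^3) ` (- {0}). \<Sum>x\<in>{x \<in> - {0}. x^3 = y}. 1)"
    by (rule sum.image_gen) simp
  also have "\<dots> = (\<Sum>y\<in>(\<lambda>x::'a. x^3) ` (- {0}). card {x::'a. x^3 = 1})"
    by (rule sum.cong) (use card_cube_fiber in auto)
  finally show ?thesis by simp
qed

section \<open>Duality and double counting\<close>

text \<open>The alternating form of the polarity: a point v lies on the polar plane of w exactly
  when it vanishes.\<close>

definition polar_form :: "'a::field ^ 4 \<Rightarrow> 'a ^ 4 \<Rightarrow> 'a" where
  "polar_form w v = (\<Sum>i\<in>UNIV. polar_vec w $ i * v $ i)"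

lemma polar_form_vec4:
  "polar_form (vec4 w0 w1 w2 w3) (vec4 v0 v1 v2 v3) = w3 * v0 - 3 * w2 * v1 + 3 * w1 * v2 - w0 * v3"
  by (simp add: polar_form_def sum_index4 polar_vec_def)

lemma polar_form_linear:
  "polar_form w (k *s u + m *s v) = k * polar_form w u + m * polar_form w v"
  "polar_form (k *s w) v = k * polar_form w v"
  by (simp_all add: polar_form_def sum_index4 polar_vec_def algebra_simps)

lemma polar_form_sym3:
  "polar_form (sym3 a b c d *v w) (sym3 a b c d *v v) = (a*d - b*c)^3 * polar_form w v"
proof -
  obtain w0 w1 w2 w3 where w: "w = vec4 w0 w1 w2 w3" by (rule vec4_exhaust)
  obtain v0 v1 v2 v3 where v: "v = vec4 v0 v1 v2 v3" by (rule vec4_exhaust)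
  show ?thesis unfolding w v sym3_mult_vec polar_form_vec4
    by (simp add: power2_eq_square power3_eq_cube algebra_simps)
qed

text \<open>Substitutions scale the form by the cube of the determinant, so only the line l_L itself
  matters. The vectors orthogonal to (1, 0, 0, 1) and (0, 0, 1, 0) satisfy y3 = y0 and 3 y1 = 0,
  which are the equations of l_L: it is its own polar.\<close>

lemma orbit_line_subset_plane_iff:
  assumes three: "(3::'a::{field,finite}) \<noteq> 0" and q: "CARD('a) \<ge> 5"
    and l: "l \<in> (orbit_L :: ('a ^ 4) set set set)" and w: "w \<noteq> 0"
  shows "l \<subseteq> plane (polar_vec w) \<longleftrightarrow> proj w \<in> l"
proof -
  obtain a b c d where g: "a*d - b*c \<noteq> 0" "l = proj_map (sym3 a b c d) ` ell_L" using orbit_LE[OF q l] .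
  let ?M = "sym3 a b c d"
  define y where "y = sym3 d (-b) (-c) a *v w"
  have det: "d * a - (-b) * (-c) \<noteq> 0" using g(1) by (simp add: algebra_simps)
  have y0: "y \<noteq> 0" unfolding y_def sym3_eq_0[OF det] using w .
  have B: "polar_form w (?M *v v) = polar_form y v" for v
  proof -
    have "(a*d - b*c)^3 * polar_form w (?M *v v) = polar_form (?M *v y) (?M *v v)"
      unfolding y_def sym3_adj polar_form_linear ..
    then show ?thesis unfolding polar_form_sym3 using g(1) by simp
  qed
  have plane_iff: "proj v \<in> plane (polar_vec w) \<longleftrightarrow> polar_form w v = 0" if "v \<noteq> 0" for v
    using proj_in_plane_iff[OF that] by (simp add: polar_form_def)
  let ?u = "vec4 1 0 0 1 :: 'a ^ 4" and ?e = "vec4 0 0 1 0 :: 'a ^ 4"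
  have lt: "l = line_through (?M *v ?u) (?M *v ?e)" unfolding g(2) ell_L_def proj_map_line_through ..
  have nz: "?M *v ?u \<noteq> 0" "?M *v ?e \<noteq> 0" unfolding sym3_eq_0[OF g(1)] by simp_all
  have "l \<subseteq> plane (polar_vec w) \<longleftrightarrow> polar_form w (?M *v ?u) = 0 \<and> polar_form w (?M *v ?e) = 0"
  proof
    assume s: "l \<subseteq> plane (polar_vec w)"
    have "proj (?M *v ?u) \<in> l" unfolding lt proj_in_line_through_iff[OF nz(1)]
      by (rule exI[of _ 1], rule exI[of _ 0]) simp
    moreover have "proj (?M *v ?e) \<in> l" unfolding lt proj_in_line_through_iff[OF nz(2)]
      by (rule exI[of _ 0], rule exI[of _ 1]) simp
    ultimately show "polar_form w (?M *v ?u) = 0 \<and> polar_form w (?M *v ?e) = 0"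
      using s plane_iff nz by blast
  next
    assume z: "polar_form w (?M *v ?u) = 0 \<and> polar_form w (?M *v ?e) = 0"
    show "l \<subseteq> plane (polar_vec w)"
    proof
      fix P assume P: "P \<in> l"
      then have "P \<in> PG3_points" using sym3_line_subset_points[OF g(1) ell_L_subset_points] g(2) by blast
      then obtain v where v: "v \<noteq> 0" "P = proj v" by (rule PG3_pointsE)
      then obtain k m where km: "v = k *s (?M *v ?u) + m *s (?M *v ?e)"
        using P unfolding lt v(2) proj_in_line_through_iff[OF v(1)] by blast
      have "polar_form w v = 0" unfolding km polar_form_linear(1) using z by simp
      then show "P \<in> plane (polar_vec w)" using plane_iff v by blast
    qed
  qed
  also have "\<dots> \<longleftrightarrow> y $ 0 = y $ 3 \<and> y $ 1 = 0"
  proof -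
    obtain x0 x1 x2 x3 where x: "y = vec4 x0 x1 x2 x3" by (rule vec4_exhaust)
    show ?thesis unfolding B x polar_form_vec4 using three by auto
  qed
  also have "\<dots> \<longleftrightarrow> proj y \<in> ell_L" using proj_in_ell_L_iff[OF y0] by simp
  also have "\<dots> \<longleftrightarrow> proj w \<in> l" unfolding g(2) proj_in_sym3_line_iff[OF g(1)] y_def ..
  finally show ?thesis .
qed

definition dual_types :: "(('a::field ^ 4) set \<Rightarrow> bool) \<Rightarrow> (('a ^ 4) set set \<Rightarrow> bool) \<Rightarrow> bool" where
  "dual_types pt pl \<longleftrightarrow> (\<forall>v. v \<noteq> 0 \<longrightarrow> pl (plane (polar_vec v)) = pt (proj v))"

lemma PG3_planesE:
  assumes "(3::'a::field) \<noteq> 0" "\<pi> \<in> (PG3_planes :: ('a ^ 4) set set set)"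
  obtains v where "v \<noteq> 0" "\<pi> = plane (polar_vec v)"
proof -
  obtain c where c: "c \<noteq> 0" "\<pi> = plane c" using assms(2) unfolding PG3_planes_def by blast
  obtain v where v: "c = polar_vec v" using polar_vec_surj[OF assms(1)] .
  then have "v \<noteq> 0" using c polar_vec_eq_0_iff[OF assms(1)] by simp
  then show ?thesis using that c v by blast
qed

lemma plane_polar_in_planes:
  "(3::'a::field) \<noteq> 0 \<Longrightarrow> (v :: 'a ^ 4) \<noteq> 0 \<Longrightarrow> plane (polar_vec v) \<in> PG3_planes"
  unfolding PG3_planes_def using polar_vec_eq_0_iff by blast

lemma Pi_num_eq_P_num:
  assumes three: "(3::'a::{field,finite}) \<noteq> 0" and q: "CARD('a) \<ge> 5"
    and l: "l \<in> (orbit_L :: ('a ^ 4) set set set)" and dual: "dual_types pt pl"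
  shows "Pi_num pl l = P_num pt l"
proof -
  \<comment> \<open>The polarity as a map on points; proportional representatives give the same
    plane.\<close>
  define f :: "('a ^ 4) set \<Rightarrow> ('a ^ 4) set set" where "f P = plane (polar_vec (SOME v. v \<noteq> 0 \<and> P = proj v))" for P
  have f: "f (proj v) = plane (polar_vec v)" if v: "v \<noteq> 0" for v
  proof -
    define u where "u = (SOME u. u \<noteq> 0 \<and> proj v = proj u)"
    have u: "u \<noteq> 0 \<and> proj v = proj u" unfolding u_def by (rule someI[of _ v]) (use v in simp)
    have "f (proj v) = plane (polar_vec u)" unfolding f_def u_def ..
    then show ?thesis using plane_polar_eq_iff[OF three v, of u] u by metis
  qed
  have lP: "l \<subseteq> PG3_points"
    by (rule orbit_LE[OF q l]) (use sym3_line_subset_points[OF _ ell_L_subset_points] in blast)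
  have im: "f ` {P \<in> l. pt P} = {\<pi> \<in> PG3_planes. pl \<pi> \<and> l \<subseteq> \<pi>}"
  proof (intro equalityI subsetI)
    fix \<pi> assume "\<pi> \<in> f ` {P \<in> l. pt P}"
    then obtain P where P: "P \<in> l" "pt P" "\<pi> = f P" by blast
    obtain v where v: "v \<noteq> 0" "P = proj v" using P(1) lP PG3_pointsE by blast
    have "\<pi> = plane (polar_vec v)" using f[OF v(1)] P v by simp
    then show "\<pi> \<in> {\<pi> \<in> PG3_planes. pl \<pi> \<and> l \<subseteq> \<pi>}"
      using orbit_line_subset_plane_iff[OF three q l v(1)] plane_polar_in_planes[OF three v(1)]
        dual P v unfolding dual_types_def by blast
  next
    fix \<pi> assume p: "\<pi> \<in> {\<pi> \<in> PG3_planes. pl \<pi> \<and> l \<subseteq> \<pi>}"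
    then have "\<pi> \<in> PG3_planes" by blast
    then obtain v where v: "v \<noteq> 0" "\<pi> = plane (polar_vec v)" by (rule PG3_planesE[OF three])
    have "proj v \<in> l" "pt (proj v)"
      using orbit_line_subset_plane_iff[OF three q l v(1)] dual p v unfolding dual_types_def by blast+
    then show "\<pi> \<in> f ` {P \<in> l. pt P}" using f[OF v(1)] v(2) by blast
  qed
  have "inj_on f {P \<in> l. pt P}"
  proof (rule inj_onI)
    fix P R assume PR: "P \<in> {P \<in> l. pt P}" "R \<in> {P \<in> l. pt P}" "f P = f R"
    obtain v where v: "v \<noteq> 0" "P = proj v" using PR(1) lP PG3_pointsE by blast
    obtain w where w: "w \<noteq> 0" "R = proj w" using PR(2) lP PG3_pointsE by blast
    show "P = R" using PR(3) f[OF v(1)] f[OF w(1)] plane_polar_eq_iff[OF three v(1) w(1)] v w by simp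
  qed
  then have "card (f ` {P \<in> l. pt P}) = card {P \<in> l. pt P}" by (rule card_image)
  then show ?thesis unfolding Pi_num_def P_num_def im .
qed

lemma Lambda_num_eq_L_num:
  assumes three: "(3::'a::{field,finite}) \<noteq> 0" and q: "CARD('a) \<ge> 5" and v: "(v :: 'a ^ 4) \<noteq> 0"
  shows "Lambda_num (plane (polar_vec v)) = L_num (proj v)"
proof -
  have "{l \<in> orbit_L. l \<subseteq> plane (polar_vec v)} = {l \<in> orbit_L. proj v \<in> l}"
    using orbit_line_subset_plane_iff[OF three q _ v] by blast
  then show ?thesis by (simp add: Lambda_num_def L_num_def)
qed

text \<open>For m other than 1 the number of zeros already places the point off the cubic; for m = 1
  this condition corresponds to excluding the Gamma-planes, the polars of the cubic points.\<close>

lemma dual_types_list: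
  assumes three: "(3::'a::field) \<noteq> 0"
  shows "dual_types (is_T_point :: ('a ^ 4) set \<Rightarrow> bool) (is_dC_plane 2)"
    and "m \<noteq> 1 \<Longrightarrow> dual_types (is_Gamma_point m :: ('a ^ 4) set \<Rightarrow> bool) (is_dC_plane m)"
    and "dual_types (is_Gamma_point 1 :: ('a ^ 4) set \<Rightarrow> bool) is_1bar_plane"
    and "dual_types (is_C_point :: ('a ^ 4) set \<Rightarrow> bool) is_Gamma_plane"
proof -
  note pp = plane_polar_in_planes[OF three]
  show "dual_types (is_T_point :: ('a ^ 4) set \<Rightarrow> bool) (is_dC_plane 2)"
    unfolding dual_types_def is_dC_plane_def card_plane_cubic_points using is_T_point_iff[OF three] pp by blast
  show "dual_types (is_Gamma_point m :: ('a ^ 4) set \<Rightarrow> bool) (is_dC_plane m)" if "m \<noteq> 1"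
    unfolding dual_types_def is_dC_plane_def card_plane_cubic_points
    using is_Gamma_point_iff[OF three] pp nroots_cubic_point[OF three] that by blast
  show "dual_types (is_Gamma_point 1 :: ('a ^ 4) set \<Rightarrow> bool) is_1bar_plane"
    unfolding dual_types_def is_1bar_plane_def card_plane_cubic_points
    using is_Gamma_point_iff[OF three] pp plane_polar_in_Gamma_iff[OF three] by blast
  show "dual_types (is_C_point :: ('a ^ 4) set \<Rightarrow> bool) is_Gamma_plane"
    unfolding dual_types_def is_Gamma_plane_def is_C_point_def using plane_polar_in_Gamma_iff[OF three] by blast
qed

lemma orbit_valuesI:
  assumes three: "(3::'a::{field,finite}) \<noteq> 0" and q: "CARD('a) \<ge> 5"
    and inv: "invariant_type pt" and dual: "dual_types pt pl"
    and a: "real (P_num pt (ell_L :: ('a ^ 4) set set)) = a"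
    and b: "\<And>P :: ('a ^ 4) set. P \<in> PG3_points \<Longrightarrow> pt P \<Longrightarrow> real (L_num P) = b"
  shows "orbit_values pt pl a b"
  unfolding orbit_values_def
proof (intro conjI ballI impI)
  fix l :: "('a ^ 4) set set" assume l: "l \<in> orbit_L"
  show "real (P_num pt l) = a" using P_num_orbit_L[OF q l inv] a by simp
  then show "real (Pi_num pl l) = a" using Pi_num_eq_P_num[OF three q l dual] by simp
next
  fix P :: "('a ^ 4) set" assume "P \<in> PG3_points" "pt P"
  then show "real (L_num P) = b" by (rule b)
next
  fix \<pi> :: "('a ^ 4) set set" assume p: "\<pi> \<in> PG3_planes" "pl \<pi>"
  obtain v where v: "v \<noteq> 0" "\<pi> = plane (polar_vec v)" using p(1) by (rule PG3_planesE[OF three])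
  then show "real (Lambda_num \<pi>) = b"
    using Lambda_num_eq_L_num[OF three q v(1)] b[of "proj v"] dual p unfolding dual_types_def by simp
qed

section \<open>Orbit size and incidence numbers in terms of n_1, n_2 and k\<close>

lemma L_num_Gamma_points_eq:
  assumes three: "(3::'a::{field,finite}) \<noteq> 0" and q: "CARD('a) \<ge> 5"
    and P: "is_Gamma_point m P" "is_Gamma_point m R" and "P \<in> (PG3_points :: ('a ^ 4) set set)" "R \<in> (PG3_points :: ('a ^ 4) set set)"
  shows "L_num P = L_num R"
proof -
  obtain v where v: "v \<noteq> 0" "P = proj v" using assms(5) by (rule PG3_pointsE)
  obtain w where w: "w \<noteq> 0" "R = proj w" using assms(6) by (rule PG3_pointsE)
  have "sym3_equiv v w"
    using P unfolding v w is_Gamma_point_iff[OF three v(1)] is_Gamma_point_iff[OF three w(1)]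
    using sym3_equiv_same_type[OF three v(1) w(1)] by simp
  then show ?thesis unfolding v w by (rule L_num_sym3_equiv[OF q])
qed

lemma L_num_T_point:
  assumes three: "(3::'a::{field,finite}) \<noteq> 0" and q: "CARD('a) \<ge> 5"
    and P: "P \<in> (PG3_points :: ('a ^ 4) set set)" "is_T_point P"
  shows "L_num P * card {x::'a. x^3 = 1} = CARD('a) - 1"
proof -
  obtain v where v: "v \<noteq> 0" "P = proj v" using P(1) by (rule PG3_pointsE)
  have n: "nroots v = 2" using P(2) v is_T_point_iff[OF three v(1)] by simp
  have "L_num P = L_num (proj (vec4 0 0 1 0 :: 'a ^ 4))"
    unfolding v by (rule L_num_sym3_equiv[OF q two_roots_equiv[OF three n v(1)]])
  then show ?thesis using L_num_tangent_vec[OF three q] card_cubes by simp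
qed

lemma card_cube_roots_nonzero: "card {x::'a::{field,finite}. x^3 = 1} \<noteq> 0"
proof -
  have "(1::'a) \<in> {x. x^3 = 1}" by simp
  then show ?thesis by (metis card_eq_0_iff empty_iff finite)
qed

lemma orbit_values_T:
  assumes three: "(3::'a::{field,finite}) \<noteq> 0" and q: "CARD('a) \<ge> 5"
  shows "orbit_values (is_T_point :: ('a ^ 4) set \<Rightarrow> bool) (is_dC_plane 2)
     (1 + real (ell_count TYPE('a) 2)) ((real CARD('a) - 1) / real (card {x::'a. x^3 = 1}))"
proof (rule orbit_valuesI[OF three q invariant_types(1)[OF three] dual_types_list(1)[OF three]])
  show "real (P_num is_T_point (ell_L :: ('a ^ 4) set set)) = 1 + real (ell_count TYPE('a) 2)"
    unfolding P_num_ell_L_types(1)[OF three] by simp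
next
  fix P :: "('a ^ 4) set" assume P: "P \<in> PG3_points" "is_T_point P"
  have e: "L_num P * card {x::'a. x^3 = 1} = CARD('a) - 1" by (rule L_num_T_point[OF three q P])
  then have "real (L_num P) * real (card {x::'a. x^3 = 1}) = real CARD('a) - 1"
    using q by (simp flip: of_nat_mult add: of_nat_diff)
  then show "real (L_num P) = (real CARD('a) - 1) / real (card {x::'a. x^3 = 1})"
    using card_cube_roots_nonzero[where 'a = 'a] by (simp add: nonzero_eq_divide_eq)
qed

text \<open>Each of the q^2 + q T-points lies on (q - 1)/k lines of the orbit, k being the number of
  cube roots of unity, and each line carries 1 + n_2 T-points.\<close>

lemma card_orbit_L:
  assumes three: "(3::'a::{field,finite}) \<noteq> 0" and q: "CARD('a) \<ge> 5"
  shows "real (card (orbit_L :: ('a ^ 4) set set set)) =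
    (real CARD('a)^3 - real CARD('a)) / (real (card {x::'a. x^3 = 1}) * (1 + real (ell_count TYPE('a) 2)))"
proof -
  let ?O = "orbit_L :: ('a ^ 4) set set set"
  define k where "k = card {x::'a. x^3 = 1}"
  define n where "n = real CARD('a)"
  have k: "k \<noteq> 0" unfolding k_def by (rule card_cube_roots_nonzero)
  have L: "L_num P = (CARD('a) - 1) div k" if "P \<in> PG3_points" "is_T_point P" for P :: "('a ^ 4) set"
    using L_num_T_point[OF three q that] k unfolding k_def by (metis nonzero_mult_div_cancel_right)
  have e: "num_points (is_T_point :: ('a ^ 4) set \<Rightarrow> bool) * ((CARD('a) - 1) div k)
      = card ?O * P_num is_T_point (ell_L :: ('a ^ 4) set set)"
    by (rule double_count[OF q invariant_types(1)[OF three] L])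
  have "k dvd CARD('a) - 1" using card_cubes[where 'a = 'a] unfolding k_def by (metis dvd_triv_right)
  then have d: "real ((CARD('a) - 1) div k) = (n - 1) / real k" using q by (simp add: real_of_nat_div n_def of_nat_diff)
  have q3: "CARD('a) \<ge> 3" using q by simp
  have "(n^2 + n) * ((n - 1) / real k) = real (card ?O) * (1 + real (ell_count TYPE('a) 2))"
    using e[THEN arg_cong[of _ _ real]] num_points_types(2)[OF three q3] d
    unfolding P_num_ell_L_types(1)[OF three] by (simp add: n_def distrib_left)
  then show ?thesis using k unfolding k_def[symmetric] n_def[symmetric]
    by (simp add: field_simps power2_eq_square power3_eq_cube add_nonneg_eq_0_iff)
qed

text \<open>There are (q^3 - q)/c points of the type, with c = 6, 2 or 3, and the orbit size has the
  same numerator, so q^3 - q cancels in the double count.\<close>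

lemma orbit_values_Gamma:
  assumes three: "(3::'a::{field,finite}) \<noteq> 0" and q: "CARD('a) \<ge> 5"
    and dual: "dual_types (is_Gamma_point m :: ('a ^ 4) set \<Rightarrow> bool) pl" and m: "m \<noteq> 2"
    and num: "real (num_points (is_Gamma_point m :: ('a ^ 4) set \<Rightarrow> bool)) = (real CARD('a)^3 - real CARD('a)) / c" and c: "c > 0"
  shows "orbit_values (is_Gamma_point m :: ('a ^ 4) set \<Rightarrow> bool) pl (real (ell_count TYPE('a) m))
     (c * real (ell_count TYPE('a) m) / (real (card {x::'a. x^3 = 1}) * (1 + real (ell_count TYPE('a) 2))))"
proof (rule orbit_valuesI[OF three q invariant_types(2)[OF three] dual])
  show "real (P_num (is_Gamma_point m) (ell_L :: ('a ^ 4) set set)) = real (ell_count TYPE('a) m)"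
    unfolding P_num_ell_L_types(2)[OF three m] ..
next
  fix P :: "('a ^ 4) set" assume P: "P \<in> PG3_points" "is_Gamma_point m P"
  let ?n = "real (ell_count TYPE('a) m)"
  let ?w = "real (card {x::'a. x^3 = 1}) * (1 + real (ell_count TYPE('a) 2))"
  define n where "n = real CARD('a)"
  have "n^3 - n = n * ((n - 1) * (n + 1))" by (simp add: power3_eq_cube algebra_simps)
  moreover have "n * ((n - 1) * (n + 1)) > 0" using q by (intro mult_pos_pos) (auto simp: n_def)
  ultimately have n: "n^3 - n > 0" by simp
  have e: "num_points (is_Gamma_point m :: ('a ^ 4) set \<Rightarrow> bool) * L_num P
      = card (orbit_L :: ('a ^ 4) set set set) * P_num (is_Gamma_point m) (ell_L :: ('a ^ 4) set set)"
    by (rule double_count[OF q invariant_types(2)[OF three]])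
       (use L_num_Gamma_points_eq[OF three q _ P(2) _ P(1)] in blast)
  have "(n^3 - n) / c * real (L_num P) = (n^3 - n) / (?w) * ?n"
    using e[THEN arg_cong[of _ _ real]] num card_orbit_L[OF three q]
    unfolding P_num_ell_L_types(2)[OF three m] by (simp add: n_def)
  then have "(n^3 - n) * (real (L_num P) / c) = (n^3 - n) * (?n / (?w))"
    by (simp add: field_simps)
  then have "real (L_num P) / c = ?n / (?w)"
    using n by (metis less_irrefl mult_left_cancel)
  then show "real (L_num P) = c * ?n / (?w)"
    using c by (simp add: field_simps)
qed

lemma all_orbit_values:
  fixes n :: "nat \<Rightarrow> real" and k q :: real
  assumes three: "(3::'a::{field,finite}) \<noteq> 0" and q5: "CARD('a) \<ge> 5"
  defines "n \<equiv> \<lambda>m. real (ell_count TYPE('a) m)" and "k \<equiv> real (card {x::'a. x^3 = 1})" and "q \<equiv> real CARD('a)"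
  shows "orbit_values (is_T_point :: ('a ^ 4) set \<Rightarrow> bool) (is_dC_plane 2) (1 + n 2) ((q - 1) / k) \<and>
    orbit_values (is_Gamma_point 3 :: ('a ^ 4) set \<Rightarrow> bool) (is_dC_plane 3) (n 3) (6 * n 3 / (k * (1 + n 2))) \<and>
    orbit_values (is_Gamma_point 1 :: ('a ^ 4) set \<Rightarrow> bool) is_1bar_plane (n 1) (2 * n 1 / (k * (1 + n 2))) \<and>
    orbit_values (is_Gamma_point 0 :: ('a ^ 4) set \<Rightarrow> bool) (is_dC_plane 0) (n 0) (3 * n 0 / (k * (1 + n 2)))"
proof -
  have q3: "CARD('a) \<ge> 3" using q5 by simp
  note N = num_points_types[OF three q3]
  note G = orbit_values_Gamma[OF three q5]
  show ?thesis unfolding n_def k_def q_def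
    using orbit_values_T[OF three q5]
      G[OF dual_types_list(2)[OF three, of 3] _ N(1)] G[OF dual_types_list(3)[OF three] _ N(3)]
      G[OF dual_types_list(2)[OF three, of 0] _ N(4)] by simp
qed

lemma ell_count_values:
  assumes three: "(3::'a::{field,finite}) \<noteq> 0"
  shows "real (ell_count TYPE('a) 3) = (real CARD('a) - 1 - real (ell_count TYPE('a) 1) - 2 * real (ell_count TYPE('a) 2)) / 3"
    and "real (ell_count TYPE('a) 0) = (2 * real CARD('a) + 1 - 2 * real (ell_count TYPE('a) 1) - real (ell_count TYPE('a) 2)) / 3"
proof -
  let ?n = "\<lambda>m. real (ell_count TYPE('a) m)"
  have 1: "?n 0 + ?n 1 + ?n 2 + ?n 3 = real CARD('a)"
    using ell_count_sums(1)[OF three] by (metis of_nat_add)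
  have 2: "?n 1 + 2 * ?n 2 + 3 * ?n 3 = real CARD('a) - 1"
    using ell_count_sums(2)[OF three, THEN arg_cong[of _ _ real]] CARD_field_gt_1[where 'a = 'a] by (simp add: of_nat_diff)
  show "?n 3 = (real CARD('a) - 1 - ?n 1 - 2 * ?n 2) / 3"
    using 2 by simp
  then show "?n 0 = (2 * real CARD('a) + 1 - 2 * ?n 1 - ?n 2) / 3"
    using 1 by (simp add: field_simps)
qed

lemma vanishing_counts:
  assumes three: "(3::'a::{field,finite}) \<noteq> 0" and q: "CARD('a) \<ge> 5"
  shows "(\<forall>l\<in>(orbit_L :: ('a ^ 4) set set set). Pi_num is_Gamma_plane l = 0 \<and> P_num is_C_point l = 0) \<and>
    (\<forall>\<pi>\<in>(Gamma_planes :: ('a ^ 4) set set set). Lambda_num \<pi> = 0) \<and>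
    (\<forall>P\<in>(twisted_cubic :: ('a ^ 4) set set). L_num P = 0)"
proof -
  have 1: "P_num is_C_point l = 0" if "l \<in> orbit_L" for l :: "('a ^ 4) set set"
    using P_num_orbit_L[OF q that invariant_types(3)[OF three]] P_num_ell_L_types(3)[OF three] by simp
  have 2: "Pi_num is_Gamma_plane l = 0" if "l \<in> orbit_L" for l :: "('a ^ 4) set set"
    using Pi_num_eq_P_num[OF three q that dual_types_list(4)[OF three]] 1[OF that] by simp
  have 3: "L_num P = 0" if P: "P \<in> twisted_cubic" for P :: "('a ^ 4) set"
  proof -
    have "P \<notin> l" if l: "l \<in> orbit_L" for l
      using 1[OF l] P unfolding P_num_def is_C_point_def by auto
    then have "{l \<in> orbit_L. P \<in> l} = {}" by blast
    then show ?thesis unfolding L_num_def by simp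
  qed
  have 4: "Lambda_num \<pi> = 0" if p: "\<pi> \<in> Gamma_planes" for \<pi> :: "('a ^ 4) set set"
  proof -
    have "\<pi> \<in> PG3_planes" using p unfolding Gamma_planes_eq PG3_planes_def using osc_vec_nonzero by blast
    then obtain v where v: "v \<noteq> 0" "\<pi> = plane (polar_vec v)" by (rule PG3_planesE[OF three])
    then have "proj v \<in> twisted_cubic" using p plane_polar_in_Gamma_iff[OF three v(1)] by simp
    then show ?thesis unfolding v Lambda_num_eq_L_num[OF three q v(1)] by (rule 3)
  qed
  show ?thesis using 1 2 3 4 by blast
qed

section \<open>Cubes, squares and Artin-Schreier values in finite fields\<close>

lemma prime_eq_0_imp_dvd_CARD:
  assumes "Factorial_Ring.prime p" "of_nat p = (0::'a::{field,finite})"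
  shows "p dvd CARD('a)"
proof -
  have "CHAR('a) dvd p" using assms(2) by (simp add: of_nat_eq_0_iff_char_dvd)
  moreover have "CHAR('a) \<noteq> 1" by simp
  ultimately have "CHAR('a) = p" using assms(1) by (metis prime_nat_iff)
  then show ?thesis using CHAR_dvd_CARD[where 'a = 'a] by simp
qed

lemma field_power_pred_card:
  assumes "(x::'a::{field,finite}) \<noteq> 0" shows "x ^ (CARD('a) - 1) = 1"
proof -
  have "x ^ CARD('a) = x"
    using power_card_mult_closed[of "UNIV :: 'a set" x] by simp
  moreover have "CARD('a) = Suc (CARD('a) - 1)" using CARD_field_gt_1[where 'a = 'a] by simp
  ultimately have "x * x ^ (CARD('a) - 1) = x * 1" by (metis mult.right_neutral power_Suc)
  then show ?thesis using assms mult_left_cancel by blast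
qed

text \<open>Here q - 1 = 3j + 1 is coprime to 3, so the relations x^3 = 1 and x^(q - 1) = 1 leave
  only x = 1.\<close>

lemma cube_roots_q2:
  assumes "CARD('a::{field,finite}) mod 3 = 2"
  shows "{x::'a. x^3 = 1} = {1}" and "bij (\<lambda>x::'a. x^3)"
proof -
  have one: "x = 1" if x: "x^3 = 1" for x :: 'a
  proof -
    define j where "j = CARD('a) div 3"
    have j: "CARD('a) - 1 = 3 * j + 1" using assms unfolding j_def by presburger
    have "x \<noteq> 0" using x by auto
    then have "1 = x ^ (3 * j + 1)" using field_power_pred_card[of x] j by simp
    also have "\<dots> = (x^3)^j * x" by (simp add: power_mult)
    finally show ?thesis using x by simp
  qed
  then show "{x::'a. x^3 = 1} = {1}" by auto
  have "inj (\<lambda>x::'a. x^3)"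
  proof (rule injI)
    fix x y :: 'a assume e: "x^3 = y^3"
    show "x = y"
    proof (cases "y = 0")
      case True
      then show ?thesis using e by simp
    next
      case False
      then have "(x / y)^3 = 1" using e by (simp add: power_divide)
      then show ?thesis using one[of "x / y"] False by simp
    qed
  qed
  then show "bij (\<lambda>x::'a. x^3)" by (simp add: bij_def finite_UNIV_inj_surj)
qed

text \<open>With q - 1 = 3j, the polynomial x^(j+1) - x has at most j + 1 < q zeros, so some nonzero
  x has x^j different from 1; the cube of x^j is x^(q - 1) = 1.\<close>

lemma cube_root_of_unity_q1:
  assumes "CARD('a::{field,finite}) mod 3 = 1"
  obtains \<omega> :: "'a::{field,finite}" where "\<omega>^3 = 1" "\<omega> \<noteq> 1"
proof -
  define j where "j = CARD('a) div 3"
  have j: "CARD('a) - 1 = 3 * j" "CARD('a) = 3 * j + 1" using assms unfolding j_def by presburger+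
  have "j \<noteq> 0" using CARD_field_gt_1[where 'a = 'a] j by auto
  have "\<exists>x::'a. x \<noteq> 0 \<and> x^j \<noteq> 1"
  proof (rule ccontr)
    assume "\<not> ?thesis"
    then have "\<And>x::'a. x ^ Suc j = x" by (metis mult.right_neutral power_Suc mult_zero_left)
    then have "{x::'a. x ^ Suc j = x} = UNIV" by blast
    then have "CARD('a) \<le> Suc j" using card_power_fixed(2)[of "Suc j", where 'b = 'a] \<open>j \<noteq> 0\<close> by simp
    then show False using j(2) \<open>j \<noteq> 0\<close> by simp
  qed
  then obtain x :: 'a where x: "x \<noteq> 0" "x^j \<noteq> 1" by blast
  have "(x^j)^3 = x ^ (3 * j)" by (simp add: power_mult mult.commute)
  then have "(x^j)^3 = 1" using field_power_pred_card[OF x(1)] j by simp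
  then show ?thesis using that x by blast
qed

lemma card_cube_roots_q1:
  assumes "CARD('a::{field,finite}) mod 3 = 1"
  shows "card {x::'a. x^3 = 1} = 3"
proof -
  obtain \<omega> :: 'a where w: "\<omega>^3 = 1" "\<omega> \<noteq> 1" using cube_root_of_unity_q1[OF assms] .
  have "{x::'a. x^3 = 1} = {t. -1 + 0*t + 0*t^2 + 1*t^3 = 0}" by (auto simp: eq_neg_iff_add_eq_0 algebra_simps)
  then have le: "card {x::'a. x^3 = 1} \<le> 3" using card_roots_cubic_poly(1)[of "-1::'a" 0 0 1] by simp
  have w2: "\<omega> * \<omega>^2 = 1" using w(1) by (simp add: power2_eq_square power3_eq_cube mult.assoc)
  have "\<omega> \<noteq> 0" using w by auto
  have "\<omega>^2 \<noteq> 1" using w2 w(2) by auto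
  moreover have "\<omega>^2 \<noteq> \<omega>" using w(2) \<open>\<omega> \<noteq> 0\<close> by (simp add: power2_eq_square)
  ultimately have "card {1, \<omega>, \<omega>^2} = 3" using w(2) by auto
  moreover have "(\<omega>^2)^3 = (\<omega>^3)^2" by (simp flip: power_mult)
  then have "{1, \<omega>, \<omega>^2} \<subseteq> {x. x^3 = 1}" using w(1) by simp
  then have "card {1, \<omega>, \<omega>^2} \<le> card {x::'a. x^3 = 1}" by (intro card_mono) auto
  ultimately show ?thesis using le by simp
qed

section \<open>Points of the line with two zeros, and with one zero in odd characteristic\<close>

lemma ell_count_2_eq:
  assumes three: "(3::'a::{field,finite}) \<noteq> 0"
  shows "ell_count TYPE('a) 2 = card {b::'a. 4 * b^3 = -1}"
  unfolding ell_count_def nroots_ell_vec_2_iff[OF three] ..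

lemma ell_count_2_even:
  assumes three: "(3::'a::{field,finite}) \<noteq> 0" and two: "(2::'a) = 0"
  shows "ell_count TYPE('a) 2 = 0"
proof -
  have "(4::'a) = 2 * 2" by simp
  then have "(4::'a) = 0" using two by simp
  then show ?thesis unfolding ell_count_2_eq[OF three] by simp
qed

text \<open>As (-2b)^3 = -2 (4b^3), the map b -> -2b turns 4b^3 = -1 into x^3 = 2, whose solutions
  are absent or form a coset of the cube roots of unity.\<close>

lemma ell_count_2_odd:
  assumes three: "(3::'a::{field,finite}) \<noteq> 0" and two: "(2::'a) \<noteq> 0"
  shows "ell_count TYPE('a) 2 = (if two_is_cube TYPE('a) then card {x::'a. x^3 = 1} else 0)"
proof -
  have "bij_betw (\<lambda>b. - 2 * b) {b::'a. 4 * b^3 = -1} {x. x^3 = 2}"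
  proof (rule bij_betw_byWitness[where f' = "\<lambda>x. - x / 2"])
    have e: "(- 2 * b)^3 = - 2 * (4 * b^3)" for b :: 'a by (simp add: power3_eq_cube)
    have "(- 2 * b)^3 = 2" if "4 * b^3 = -1" for b :: 'a unfolding e that by simp
    then show "(\<lambda>b. - 2 * b) ` {b::'a. 4 * b^3 = -1} \<subseteq> {x. x^3 = 2}" by blast
    have "- 2 * (4 * (- x / 2)^3) = x^3" for x :: 'a using e[of "- x / 2"] two by simp
    then have "- 2 * (4 * (- x / 2)^3) = - 2 * (- 1)" if "x^3 = 2" for x :: 'a using that by simp
    then have "4 * (- x / 2)^3 = - 1" if "x^3 = 2" for x :: 'a using that two by (metis mult_left_cancel neg_equal_0_iff_equal)
    then show "(\<lambda>x. - x / 2) ` {x::'a. x^3 = 2} \<subseteq> {b. 4 * b^3 = -1}" by auto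
  qed (use two in auto)
  then have e: "ell_count TYPE('a) 2 = card {x::'a. x^3 = 2}" unfolding ell_count_2_eq[OF three] by (rule bij_betw_same_card)
  show ?thesis
  proof (cases "two_is_cube TYPE('a)")
    case True
    then obtain z :: 'a where z: "z^3 = 2" unfolding two_is_cube_def by blast
    then have "z \<noteq> 0" using two by auto
    have "bij_betw ((*) z) {x. x^3 = 1} {x. x^3 = 2}"
      by (rule bij_betw_byWitness[where f' = "\<lambda>x. x / z"])
         (use z \<open>z \<noteq> 0\<close> two in \<open>auto simp: power_mult_distrib power_divide\<close>)
    then show ?thesis using e True by (simp add: bij_betw_same_card)
  next
    case False
    then have "{x::'a. x^3 = 2} = {}" unfolding two_is_cube_def by blast
    then show ?thesis using e False by simp
  qed
qed

text \<open>Completing the square: y^2 + y + t^3 has discriminant 1 - 4t^3, and t = -beta gives the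
  expression in \<open>N_q\<close>.\<close>

lemma ell_count_1_odd:
  assumes three: "(3::'a::{field,finite}) \<noteq> 0" and two: "(2::'a) \<noteq> 0"
  shows "ell_count TYPE('a) 1 = N_q TYPE('a)"
proof -
  have sq: "(\<exists>y. y^2 + y + (- \<beta>)^3 = 0) \<longleftrightarrow> (\<exists>y. y^2 = 1 + 4 * \<beta>^3)" for \<beta> :: 'a
  proof
    assume "\<exists>y. y^2 + y + (- \<beta>)^3 = 0"
    then obtain y where y: "y^2 + y - \<beta>^3 = 0" by auto
    have "(2*y + 1)^2 = 1 + 4 * \<beta>^3 + 4 * (y^2 + y - \<beta>^3)" by (simp add: power2_eq_square algebra_simps)
    then have "(2*y + 1)^2 = 1 + 4 * \<beta>^3" unfolding y by simp
    then show "\<exists>y. y^2 = 1 + 4 * \<beta>^3" by blast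
  next
    assume "\<exists>y. y^2 = 1 + 4 * \<beta>^3"
    then obtain z where z: "z^2 = 1 + 4 * \<beta>^3" by blast
    define y where "y = (z - 1) / 2"
    have "2*y = z - 1" using two by (simp add: y_def)
    then have zy: "z = 2*y + 1" by simp
    have "2 * 2 * (y^2 + y + (- \<beta>)^3) = z^2 - 1 - 4 * \<beta>^3" unfolding zy by (simp add: power2_eq_square algebra_simps)
    also have "\<dots> = 0" using z by simp
    finally show "\<exists>y. y^2 + y + (- \<beta>)^3 = 0" using two by (metis mult_eq_0_iff)
  qed
  have "bij_betw uminus {\<beta>::'a. \<not> (\<exists>y. y^2 = 1 + 4 * \<beta>^3)} {t. \<not> (\<exists>y. y^2 + y + t^3 = 0)}"
  proof (rule bij_betw_byWitness[where f' = uminus])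
    show "uminus ` {\<beta>::'a. \<not> (\<exists>y. y^2 = 1 + 4 * \<beta>^3)} \<subseteq> {t. \<not> (\<exists>y. y^2 + y + t^3 = 0)}" using sq by blast
    show "uminus ` {t::'a. \<not> (\<exists>y. y^2 + y + t^3 = 0)} \<subseteq> {\<beta>. \<not> (\<exists>y. y^2 = 1 + 4 * \<beta>^3)}"
    proof
      fix \<beta> :: 'a assume "\<beta> \<in> uminus ` {t::'a. \<not> (\<exists>y. y^2 + y + t^3 = 0)}"
      then obtain t where t: "\<not> (\<exists>y. y^2 + y + t^3 = 0)" "\<beta> = - t" by blast
      then have "\<not> (\<exists>y. y^2 + y + (- \<beta>)^3 = 0)" by simp
      then show "\<beta> \<in> {\<beta>. \<not> (\<exists>y. y^2 = 1 + 4 * \<beta>^3)}" unfolding sq by blast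
    qed
  qed auto
  then show ?thesis unfolding ell_count_1[OF three] N_q_def by (simp add: bij_betw_same_card)
qed

lemma card_nonsquares:
  assumes two: "(2::'a::{field,finite}) \<noteq> 0"
  shows "2 * card {x::'a. \<not> (\<exists>y. y^2 = x)} = CARD('a) - 1"
proof -
  let ?S = "(\<lambda>x::'a. x^2) ` (- {0})"
  have fib: "card {x \<in> - {0}. x^2 = y} = 2" if y: "y \<in> ?S" for y
  proof -
    obtain z where z: "z \<noteq> 0" "y = z^2" using y by auto
    have "{x \<in> - {0}. x^2 = y} = {z, - z}" using z by (auto simp: power2_eq_iff)
    moreover have "z \<noteq> - z"
    proof
      assume "z = - z"
      then have "2 * z = 0" by (metis add.right_inverse mult_2)
      then show False using two z by simp
    qed
    ultimately show ?thesis by simp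
  qed
  have "CARD('a) - 1 = (\<Sum>x\<in>-{0::'a}. 1)" by (simp add: Compl_eq_Diff_UNIV)
  also have "\<dots> = (\<Sum>y\<in>?S. \<Sum>x\<in>{x \<in> - {0}. x^2 = y}. 1)" by (rule sum.image_gen) simp
  also have "\<dots> = (\<Sum>y\<in>?S. 2)" by (rule sum.cong) (use fib in auto)
  finally have S: "2 * card ?S = CARD('a) - 1" by simp
  have e: "{x::'a. \<not> (\<exists>y. y^2 = x)} = - (insert 0 ?S)"
  proof (intro equalityI subsetI)
    fix x :: 'a assume "x \<in> - (insert 0 ?S)"
    then have "x \<noteq> 0" "x \<notin> ?S" by auto
    then have "y^2 \<noteq> x" for y by (cases "y = 0") auto
    then show "x \<in> {x. \<not> (\<exists>y. y^2 = x)}" by blast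
  next
    fix x :: 'a assume x: "x \<in> {x. \<not> (\<exists>y. y^2 = x)}"
    have "(0::'a)^2 = 0" by simp
    then have "x \<noteq> 0" using x by blast
    then show "x \<in> - (insert 0 ?S)" using x by blast
  qed
  have "(0::'a) \<notin> ?S" by auto
  then have "card (insert 0 ?S) = card ?S + 1" by simp
  then have "card {x::'a. \<not> (\<exists>y. y^2 = x)} = CARD('a) - (card ?S + 1)" unfolding e
    by (simp add: Compl_eq_Diff_UNIV card_Diff_subset)
  then show ?thesis using S by simp
qed

text \<open>Cubing is bijective for q = 2 mod 3, so 1 + 4 beta^3 runs once through the field and
  \<open>N_q\<close> counts the nonsquares.\<close>

lemma N_q_odd_q2:
  assumes two: "(2::'a::{field,finite}) \<noteq> 0" and q: "CARD('a) mod 3 = 2"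
  shows "2 * N_q TYPE('a) = CARD('a) - 1"
proof -
  have four: "(4::'a) \<noteq> 0"
  proof -
    have "(4::'a) = 2 * 2" by simp
    then show ?thesis using two by (metis mult_eq_0_iff)
  qed
  have i: "inj (\<lambda>\<beta>::'a. 1 + 4 * \<beta>^3)"
  proof (rule injI)
    fix x y :: 'a assume "1 + 4 * x^3 = 1 + 4 * y^3"
    then have "x^3 = y^3" using four by simp
    then show "x = y" using bij_is_inj[OF cube_roots_q2(2)[OF q]] by (rule injD[rotated])
  qed
  have b: "bij (\<lambda>\<beta>::'a. 1 + 4 * \<beta>^3)" using i by (simp add: bij_def finite_UNIV_inj_surj)
  have "(\<lambda>\<beta>::'a. 1 + 4 * \<beta>^3) ` {\<beta>. \<not> (\<exists>y. y^2 = 1 + 4 * \<beta>^3)} = {x. \<not> (\<exists>y. y^2 = x)}"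
  proof (intro equalityI subsetI)
    fix x :: 'a assume x: "x \<in> {x. \<not> (\<exists>y. y^2 = x)}"
    obtain \<beta> where "x = 1 + 4 * \<beta>^3" using surjD[OF bij_is_surj[OF b], of x] by blast
    then show "x \<in> (\<lambda>\<beta>::'a. 1 + 4 * \<beta>^3) ` {\<beta>. \<not> (\<exists>y. y^2 = 1 + 4 * \<beta>^3)}" using x by blast
  qed auto
  then have "card {x::'a. \<not> (\<exists>y. y^2 = x)} = N_q TYPE('a)" unfolding N_q_def
    using card_image[OF inj_on_subset[OF i subset_UNIV], of "{\<beta>. \<not> (\<exists>y. y^2 = 1 + 4 * \<beta>^3)}"] by (simp only:)
  then show ?thesis using card_nonsquares[OF two] by simp
qed

section \<open>Artin-Schreier values and a cubic character sum in characteristic 2\<close>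

lemma char_2_add_self: "(2::'a::field) = 0 \<Longrightarrow> x + x = (0::'a)"
  by (metis mult_2 mult_zero_left)

lemma char_2_add_eq_0_iff: "(2::'a::field) = 0 \<Longrightarrow> x + y = (0::'a) \<longleftrightarrow> x = y"
  using char_2_add_self by (metis add.assoc add.right_neutral add.left_neutral)

text \<open>In a finite field of characteristic 2 these are the elements of absolute trace
  0.\<close>

definition artin_schreier :: "'a::field set" where
  "artin_schreier = range (\<lambda>y. y^2 + y)"

text \<open>The map y -> y^2 + y is additive with kernel {0, 1}, so each value is taken exactly
  twice.\<close>

lemma card_artin_schreier:
  assumes two: "(2::'a::{field,finite}) = 0"
  shows "2 * card (artin_schreier :: 'a set) = CARD('a)"
proof -
  have fib: "card {x \<in> UNIV. x^2 + x = y} = 2" if y: "y \<in> artin_schreier" for y :: 'a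
  proof -
    obtain z where z: "y = z^2 + z" using y unfolding artin_schreier_def by auto
    have "x^2 + x = y \<longleftrightarrow> x = z \<or> x = z + 1" for x
    proof -
      have "(x^2 + x) + y = (x + z) * (x + (z + 1)) + (x + x) * - z"
        unfolding z by (simp add: power2_eq_square algebra_simps)
      then have "(x^2 + x) + y = (x + z) * (x + (z + 1))" using char_2_add_self[OF two, of x] by simp
      then show ?thesis using char_2_add_eq_0_iff[OF two] by (metis mult_eq_0_iff)
    qed
    then have "{x \<in> UNIV. x^2 + x = y} = {z, z + 1}" by blast
    then show ?thesis by simp
  qed
  have "CARD('a) = (\<Sum>x::'a\<in>UNIV. 1)" by simp
  also have "\<dots> = (\<Sum>y\<in>artin_schreier. \<Sum>x\<in>{x \<in> UNIV. x^2 + x = (y::'a)}. 1)"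
    unfolding artin_schreier_def by (rule sum.image_gen) simp
  also have "\<dots> = (\<Sum>y\<in>(artin_schreier :: 'a set). 2)" by (rule sum.cong) (use fib in auto)
  finally show ?thesis by simp
qed

lemma artin_schreier_add:
  assumes two: "(2::'a::{field,finite}) = 0" and "a \<in> artin_schreier" "b \<in> (artin_schreier :: 'a set)"
  shows "a + b \<in> artin_schreier"
proof -
  obtain y z where yz: "a = y^2 + y" "b = z^2 + z" using assms(2,3) unfolding artin_schreier_def by auto
  have "(y + z)^2 + (y + z) = a + b + (y + y) * z" unfolding yz by (simp add: power2_eq_square algebra_simps)
  then have "a + b = (y + z)^2 + (y + z)" using char_2_add_self[OF two, of y] by simp
  then show ?thesis unfolding artin_schreier_def by blast
qed

text \<open>An additive subgroup of index 2: translation by an element outside carries it onto its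
  complement, so two elements outside have their sum inside.\<close>

lemma artin_schreier_add_iff:
  assumes two: "(2::'a::{field,finite}) = 0"
  shows "a + b \<in> (artin_schreier :: 'a set) \<longleftrightarrow> (a \<in> artin_schreier \<longleftrightarrow> b \<in> artin_schreier)"
proof -
  have cancel: "a + b + a = b" "a + b + b = a" for a b :: 'a
    using char_2_add_self[OF two, of a] char_2_add_self[OF two, of b]
    by (metis add.assoc add.commute add.right_neutral)+
  have "a + b \<in> artin_schreier" if n: "a \<notin> artin_schreier" "b \<notin> artin_schreier"
  proof -
    let ?H = "artin_schreier :: 'a set"
    have inj: "inj ((+) a)" by (simp add: inj_def)
    have "?H \<inter> ((+) a ` ?H) = {}"
    proof (rule ccontr)
      assume "?H \<inter> ((+) a ` ?H) \<noteq> {}"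
      then obtain h where h: "h \<in> ?H" "a + h \<in> ?H" by blast
      then have "a + h + h \<in> ?H" using artin_schreier_add[OF two] by blast
      then show False using n cancel by simp
    qed
    then have "card (?H \<union> (+) a ` ?H) = card ?H + card ?H"
      using card_image[OF inj_on_subset[OF inj], of ?H] by (simp add: card_Un_disjoint)
    then have "card (?H \<union> (+) a ` ?H) = CARD('a)" using card_artin_schreier[OF two] by simp
    then have "?H \<union> (+) a ` ?H = UNIV" by (simp add: card_eq_UNIV_imp_eq_UNIV)
    then obtain h where h: "b = a + h" "h \<in> ?H" using n by blast
    have "a + b = h" using cancel(1)[of a h] unfolding h(1) by (simp only: add.commute[of a])
    then show ?thesis using h(2) by (simp only:)
  qed
  moreover have "b \<in> artin_schreier" if "a + b \<in> artin_schreier" "a \<in> artin_schreier"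
    using artin_schreier_add[OF two that] cancel by simp
  moreover have "a \<in> artin_schreier" if "a + b \<in> artin_schreier" "b \<in> artin_schreier"
    using artin_schreier_add[OF two that] cancel by simp
  ultimately show ?thesis using artin_schreier_add[OF two] by blast
qed

lemma ell_count_1_even:
  assumes three: "(3::'a::{field,finite}) \<noteq> 0" and two: "(2::'a) = 0"
  shows "ell_count TYPE('a) 1 = card {t::'a. t^3 \<notin> artin_schreier}"
proof -
  have "y^2 + y + t^3 = 0 \<longleftrightarrow> t^3 = y^2 + y" for y t :: 'a
    using char_2_add_eq_0_iff[OF two, of "y^2 + y" "t^3"] by auto
  then have "(\<exists>y. y^2 + y + t^3 = 0) \<longleftrightarrow> t^3 \<in> artin_schreier" for t :: 'a
    unfolding artin_schreier_def by (simp add: image_iff)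
  then show ?thesis unfolding ell_count_1[OF three] by simp
qed

lemma ell_count_1_even_q2:
  assumes three: "(3::'a::{field,finite}) \<noteq> 0" and two: "(2::'a) = 0" and q: "CARD('a) mod 3 = 2"
  shows "2 * ell_count TYPE('a) 1 = CARD('a)"
proof -
  note b = cube_roots_q2(2)[OF q]
  have "(\<lambda>t::'a. t^3) ` {t. t^3 \<notin> artin_schreier} = - artin_schreier"
  proof (intro equalityI subsetI)
    fix x :: 'a assume x: "x \<in> - artin_schreier"
    obtain t where "x = t^3" using surjD[OF bij_is_surj[OF b], of x] by blast
    then show "x \<in> (\<lambda>t::'a. t^3) ` {t. t^3 \<notin> artin_schreier}" using x by blast
  qed auto
  moreover have "inj_on (\<lambda>t::'a. t^3) {t. t^3 \<notin> artin_schreier}"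
    by (rule inj_on_subset[OF bij_is_inj[OF b]]) simp
  ultimately have "card {t::'a. t^3 \<notin> artin_schreier} = card (- (artin_schreier :: 'a set))"
    using card_image by fastforce
  then have "ell_count TYPE('a) 1 = CARD('a) - card (artin_schreier :: 'a set)"
    unfolding ell_count_1_even[OF three two] by (simp add: Compl_eq_Diff_UNIV card_Diff_subset)
  then show ?thesis using card_artin_schreier[OF two] by simp
qed

text \<open>In a finite field of characteristic 2, the additive character (-1)^Tr(x), expressed
  without the trace.\<close>

definition as_char :: "'a::field \<Rightarrow> int" where
  "as_char x = (if x \<in> artin_schreier then 1 else -1)"

lemma as_char_add:
  "(2::'a::{field,finite}) = 0 \<Longrightarrow> as_char (x + y :: 'a) = as_char x * as_char y"
  using artin_schreier_add_iff[of x y] by (simp add: as_char_def)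

lemma as_char_square:
  assumes two: "(2::'a::{field,finite}) = 0" shows "as_char ((x::'a)^2) = as_char x"
proof -
  have "x^2 + x \<in> artin_schreier" unfolding artin_schreier_def by blast
  then show ?thesis using artin_schreier_add_iff[OF two, of "x^2" x] by (simp add: as_char_def)
qed

lemma sum_as_char:
  assumes "finite A" shows "(\<Sum>x\<in>A. as_char (f x)) = int (card A) - 2 * int (card {x \<in> A. f x \<notin> artin_schreier})"
proof -
  have "(\<Sum>x\<in>A. as_char (f x)) = (\<Sum>x\<in>A. 1 - 2 * (if f x \<notin> artin_schreier then 1 else 0))"
    by (rule sum.cong) (auto simp: as_char_def)
  also have "\<dots> = int (card A) - 2 * (\<Sum>x\<in>A. if f x \<notin> artin_schreier then 1 else 0)"
    by (simp add: sum_subtractf sum_distrib_left)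
  also have "(\<Sum>x\<in>A. if f x \<notin> artin_schreier then 1 else 0) = int (card {x \<in> A. f x \<notin> artin_schreier})"
    using assms by (simp add: sum.If_cases Collect_conj_eq)
  finally show ?thesis .
qed

text \<open>Orthogonality: multiplication by a nonzero e permutes the field, and the character takes
  1 and -1 equally often.\<close>

lemma sum_as_char_mult:
  assumes two: "(2::'a::{field,finite}) = 0"
  shows "(\<Sum>x\<in>UNIV. as_char (x * e :: 'a)) = (if e = 0 then int CARD('a) else 0)"
proof (cases "e = 0")
  case True
  have "(0::'a) \<in> artin_schreier" unfolding artin_schreier_def by (rule range_eqI[of _ _ 0]) simp
  then show ?thesis using True by (simp add: as_char_def)
next
  case False
  have "(\<Sum>x\<in>UNIV. as_char (x * e)) = (\<Sum>x\<in>(UNIV :: 'a set). as_char x)"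
    by (rule sum.reindex_bij_witness[of _ "\<lambda>x. x / e" "\<lambda>x. x * e"]) (use False in auto)
  also have "\<dots> = int CARD('a) - 2 * int (card {x \<in> UNIV. (x::'a) \<notin> artin_schreier})"
    using sum_as_char[of "UNIV :: 'a set" "\<lambda>x. x"] by simp
  also have "{x \<in> UNIV. (x::'a) \<notin> artin_schreier} = - artin_schreier" by blast
  also have "card (- (artin_schreier :: 'a set)) = CARD('a) - card (artin_schreier :: 'a set)"
    by (simp add: Compl_eq_Diff_UNIV card_Diff_subset)
  also have "\<dots> = card (artin_schreier :: 'a set)" using card_artin_schreier[OF two] by simp
  also have "int CARD('a) - 2 * int (card (artin_schreier :: 'a set)) = 0"
    using card_artin_schreier[OF two, symmetric] by simp
  finally show ?thesis using False by simp
qed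

text \<open>Squaring the sum and putting y = x + d separates the factor at d^3 from an inner sum
  over x^2 d + x d^2. Invariance of the character under squaring makes the latter linear in x^2 with
  coefficient d + d^4, so only the four solutions of d^4 = d survive, each with inner sum q.\<close>

lemma cubic_char_sum_square:
  assumes two: "(2::'a::{field,finite}) = 0" and q: "CARD('a) mod 3 = 1"
  shows "(\<Sum>t\<in>(UNIV::'a set). as_char (t^3))^2 = 4 * int CARD('a)"
proof -
  let ?c = "as_char :: 'a \<Rightarrow> int"
  have sqbij: "bij (\<lambda>x::'a. x^2)"
  proof -
    have "inj (\<lambda>x::'a. x^2)"
    proof (rule injI)
      fix x y :: 'a assume e: "x^2 = y^2"
      have "(x + y)^2 = (x^2 + y^2) + 2 * (x * y)" by (simp add: power2_eq_square algebra_simps)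
      also have "\<dots> = 0" using e two char_2_add_self[OF two, of "y^2"] by simp
      finally show "x = y" using char_2_add_eq_0_iff[OF two] by simp
    qed
    then show ?thesis by (simp add: bij_def finite_UNIV_inj_surj)
  qed
  have inner: "(\<Sum>x\<in>UNIV. ?c (x^2*d + x*d^2)) = (if d^4 = d then int CARD('a) else 0)" for d
  proof -
    have "?c (x^2*d + x*d^2) = ?c (x^2 * (d + d^4))" for x
    proof -
      have "?c (x*d^2) = ?c ((x*d^2)^2)" using as_char_square[OF two] by simp
      also have "(x*d^2)^2 = x^2*d^4" by (simp add: power_mult_distrib flip: power_mult)
      finally show ?thesis using as_char_add[OF two] by (simp add: distrib_left)
    qed
    then have "(\<Sum>x\<in>UNIV. ?c (x^2*d + x*d^2)) = (\<Sum>x\<in>UNIV. ?c (x^2 * (d + d^4)))" by simp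
    also have "\<dots> = (\<Sum>x\<in>UNIV. ?c (x * (d + d^4)))"
      using sum.reindex_bij_betw[OF sqbij, of "\<lambda>x. ?c (x * (d + d^4))"] .
    also have "\<dots> = (if d^4 = d then int CARD('a) else 0)"
      unfolding sum_as_char_mult[OF two] using char_2_add_eq_0_iff[OF two, of d "d^4"] by auto
    finally show ?thesis .
  qed
  have "(\<Sum>t\<in>UNIV. ?c (t^3))^2 = (\<Sum>x\<in>UNIV. \<Sum>y\<in>UNIV. ?c (x^3) * ?c (y^3))"
    unfolding power2_eq_square sum_product ..
  also have "\<dots> = (\<Sum>x\<in>UNIV. \<Sum>d\<in>UNIV. ?c (x^3) * ?c ((x + d)^3))"
  proof (rule sum.cong[OF refl])
    fix x :: 'a
    show "(\<Sum>y\<in>UNIV. ?c (x^3) * ?c (y^3)) = (\<Sum>d\<in>UNIV. ?c (x^3) * ?c ((x + d)^3))"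
      by (rule sum.reindex_bij_witness[of _ "\<lambda>d. x + d" "\<lambda>y. y - x"]) auto
  qed
  also have "\<dots> = (\<Sum>x\<in>UNIV. \<Sum>d\<in>UNIV. ?c (d^3) * ?c (x^2*d + x*d^2))"
  proof (intro sum.cong[OF refl])
    fix x d :: 'a
    have "x^3 + (x + d)^3 = d^3 + (x^2*d + x*d^2) + 2 * (x^3 + x^2*d + x*d^2)"
      by (simp add: power2_eq_square power3_eq_cube algebra_simps)
    then show "?c (x^3) * ?c ((x + d)^3) = ?c (d^3) * ?c (x^2*d + x*d^2)"
      unfolding as_char_add[OF two, symmetric] using two by simp
  qed
  also have "\<dots> = (\<Sum>d\<in>UNIV. \<Sum>x\<in>UNIV. ?c (d^3) * ?c (x^2*d + x*d^2))" by (rule sum.swap)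
  also have "\<dots> = (\<Sum>d\<in>UNIV. ?c (d^3) * (if d^4 = d then int CARD('a) else 0))"
    unfolding sum_distrib_left[symmetric] inner ..
  also have "\<dots> = (\<Sum>d\<in>{d::'a. d^4 = d}. int CARD('a))"
  proof -
    have "?c (d^3) * (if d^4 = d then int CARD('a) else 0) = (if d^4 = d then int CARD('a) else 0)" for d
    proof (cases "d^4 = d")
      case True
      \<comment> \<open>A surviving d has d^3 equal to 0 or 1, and 1 = omega^2 + omega for a
        primitive cube root of unity omega, so its sign is +1.\<close>
      have "d^3 \<in> artin_schreier"
      proof (cases "d = 0")
        case True
        have "(0::'a)^3 = 0^2 + 0" by simp
        then show ?thesis unfolding artin_schreier_def True by blast
      next
        case False
        have "d * d^3 = d * 1" using True by (simp add: eval_nat_numeral)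
        then have d: "d^3 = 1" using False mult_left_cancel by blast
        obtain \<omega> :: 'a where w: "\<omega>^3 = 1" "\<omega> \<noteq> 1" using cube_root_of_unity_q1[OF q] .
        have "(\<omega> - 1) * (\<omega>^2 + \<omega> + 1) = \<omega>^3 - 1" by (simp add: power2_eq_square power3_eq_cube algebra_simps)
        then have "\<omega>^2 + \<omega> + 1 = 0" using w by simp
        then have "1 = \<omega>^2 + \<omega>" using char_2_add_eq_0_iff[OF two] by metis
        then show ?thesis unfolding d artin_schreier_def by (rule range_eqI)
      qed
      then show ?thesis by (simp add: as_char_def)
    qed simp
    then have "(\<Sum>d\<in>UNIV. ?c (d^3) * (if d^4 = d then int CARD('a) else 0)) =
        (\<Sum>d::'a\<in>UNIV. if d^4 = d then int CARD('a) else 0)" by (simp only:)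
    then show ?thesis by (simp add: sum.If_cases)
  qed
  also have "\<dots> = int (card {d::'a. d^4 = d}) * int CARD('a)" by simp
  also have "card {d::'a. d^4 = d} = 4"
  proof -
    have "d^4 = d \<longleftrightarrow> d = 0 \<or> d^3 = 1" for d :: 'a
    proof -
      have "d^4 = d * d^3" by (simp add: eval_nat_numeral)
      then show ?thesis by auto
    qed
    then have "{d::'a. d^4 = d} = insert 0 {d. d^3 = 1}" by auto
    then show ?thesis using card_cube_roots_q1[OF q] by simp
  qed
  finally show ?thesis by simp
qed

text \<open>The term t = 0 contributes 1, and every nonzero cube is attained three times.\<close>

lemma cubic_char_sum_mod_3:
  assumes two: "(2::'a::{field,finite}) = 0" and q: "CARD('a) mod 3 = 1"
  shows "(\<Sum>t\<in>(UNIV::'a set). as_char (t^3)) mod 3 = 1"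
proof -
  have fib: "card {x \<in> - {0}. x^3 = y} = 3" if "y \<in> (\<lambda>x. x^3) ` (- {0})" for y :: 'a
    using card_cube_fiber[OF that] card_cube_roots_q1[OF q] by simp
  have "(\<Sum>t\<in>(UNIV::'a set). as_char (t^3)) = as_char ((0::'a)^3) + (\<Sum>t\<in>UNIV - {0::'a}. as_char (t^3))"
    by (rule sum.remove) auto
  also have "as_char ((0::'a)^3) = 1"
    using sum_as_char_mult[OF two, of 0] by (simp add: as_char_def split: if_splits)
  also have "UNIV - {0::'a} = - {0}" by auto
  also have "(\<Sum>t\<in>- {0::'a}. as_char (t^3)) = (\<Sum>y\<in>(\<lambda>x::'a. x^3) ` (- {0}). \<Sum>t\<in>{t \<in> - {0}. t^3 = y}. as_char (t^3))"
    by (rule sum.image_gen) simp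
  also have "\<dots> = (\<Sum>y\<in>(\<lambda>x::'a. x^3) ` (- {0}). 3 * as_char y)"
  proof (rule sum.cong[OF refl])
    fix y :: 'a assume y: "y \<in> (\<lambda>x. x^3) ` (- {0})"
    have "(\<Sum>t\<in>{t \<in> - {0}. t^3 = y}. as_char (t^3)) = (\<Sum>t\<in>{t \<in> - {0}. t^3 = y}. as_char y)"
      by (rule sum.cong) auto
    then show "(\<Sum>t\<in>{t \<in> - {0}. t^3 = y}. as_char (t^3)) = 3 * as_char y" using fib[OF y] by simp
  qed
  also have "\<dots> = 3 * (\<Sum>y\<in>(\<lambda>x::'a. x^3) ` (- {0}). as_char y)" by (simp add: sum_distrib_left)
  finally show ?thesis by simp
qed

text \<open>The square determines S = (-2)^(m+1) up to sign, and since -2 = 1 mod 3 the residue of S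
  selects the sign. On the other hand S = q - 2 n_1, because each t counted by n_1 contributes -1
  instead of 1.\<close>

lemma ell_count_1_even_q1:
  assumes three: "(3::'a::{field,finite}) \<noteq> 0" and two: "(2::'a) = 0" and q: "CARD('a) mod 3 = 1"
    and m: "CARD('a) = 2 ^ (2 * m)"
  shows "real (ell_count TYPE('a) 1) = real CARD('a) / 2 + (-2) ^ m"
proof -
  define S where "S = (\<Sum>t\<in>(UNIV::'a set). as_char (t^3))"
  have "int CARD('a) = (2::int) ^ (2 * m)" using m by simp
  then have "S^2 = 4 * 2 ^ (2 * m)" using cubic_char_sum_square[OF two q] by (simp add: S_def)
  also have "\<dots> = ((-2) ^ Suc m)^2" by (simp add: power_mult power2_eq_square flip: power_mult_distrib)
  finally have cases: "S = (-2) ^ Suc m \<or> S = - ((-2) ^ Suc m)" by (simp only: power2_eq_iff)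
  have S3: "S mod 3 = 1" unfolding S_def by (rule cubic_char_sum_mod_3[OF two q])
  have m3: "(-2::int) ^ n mod 3 = 1" for n
  proof (induction n)
    case (Suc n)
    have "(-2::int) ^ Suc n = -2 * (-2) ^ n" by simp
    then show ?case using Suc by presburger
  qed simp
  have "S = (-2) ^ Suc m"
  proof (rule ccontr)
    assume "S \<noteq> (-2) ^ Suc m"
    then have "S = - ((-2) ^ Suc m)" using cases by blast
    then show False using S3 m3[of "Suc m"] by presburger
  qed
  moreover have "S = int CARD('a) - 2 * int (ell_count TYPE('a) 1)"
    unfolding S_def ell_count_1_even[OF three two] using sum_as_char[of "UNIV :: 'a set" "\<lambda>t. t^3"] by simp
  ultimately have "int CARD('a) - 2 * int (ell_count TYPE('a) 1) = (-2) ^ Suc m" by simp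
  then have "of_int (int CARD('a) - 2 * int (ell_count TYPE('a) 1)) = (of_int ((-2) ^ Suc m) :: real)" by (simp only:)
  then have "real CARD('a) - 2 * real (ell_count TYPE('a) 1) = (-2) ^ Suc m" by simp
  then show ?thesis by simp
qed

section \<open>Assembling the five cases\<close>

lemma orbit_values_cong:
  "orbit_values pt pl a b \<Longrightarrow> a = a' \<Longrightarrow> b = b' \<Longrightarrow> orbit_values pt pl a' b'"
  by simp

text \<open>The numbers of points with three zeros and with none are eliminated here, so each case
  only has to supply x1, x2 and k.\<close>

lemma all_orbit_values_eq:
  assumes three: "(3::'a::{field,finite}) \<noteq> 0" and q5: "CARD('a) \<ge> 5" and q: "q = real CARD('a)"
    and x1: "real (ell_count TYPE('a) 1) = x1" and x2: "real (ell_count TYPE('a) 2) = x2"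
    and k: "real (card {x::'a. x^3 = 1}) = k"
  shows "orbit_values (is_T_point :: ('a ^ 4) set \<Rightarrow> bool) (is_dC_plane 2) (1 + x2) ((q - 1) / k)"
    and "orbit_values (is_Gamma_point 3 :: ('a ^ 4) set \<Rightarrow> bool) (is_dC_plane 3)
      ((q - 1 - x1 - 2 * x2) / 3) (6 * ((q - 1 - x1 - 2 * x2) / 3) / (k * (1 + x2)))"
    and "orbit_values (is_Gamma_point 1 :: ('a ^ 4) set \<Rightarrow> bool) is_1bar_plane x1 (2 * x1 / (k * (1 + x2)))"
    and "orbit_values (is_Gamma_point 0 :: ('a ^ 4) set \<Rightarrow> bool) (is_dC_plane 0)
      ((2 * q + 1 - 2 * x1 - x2) / 3) (3 * ((2 * q + 1 - 2 * x1 - x2) / 3) / (k * (1 + x2)))"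
  using all_orbit_values[OF three q5] unfolding ell_count_values[OF three] x1 x2 k q by blast+

theorem theorem4p7:
  fixes q :: nat and N :: real
  assumes "q = CARD('a::{field,finite})"
    and "q \<ge> 5" and "q mod 3 \<noteq> 0"
    and "N = real (N_q TYPE('a))"
  shows
   "(\<forall>l\<in>(orbit_L :: ('a ^ 4) set set set). Pi_num is_Gamma_plane l = 0 \<and> P_num is_C_point l = 0) \<and>
    (\<forall>\<pi>\<in>(Gamma_planes :: ('a ^ 4) set set set). Lambda_num \<pi> = 0) \<and>
    (\<forall>P\<in>(twisted_cubic :: ('a ^ 4) set set). L_num P = 0) \<and>
    (odd q \<and> q mod 3 = 2 \<longrightarrow>
       orbit_values (is_T_point :: ('a ^ 4) set \<Rightarrow> bool) (is_dC_plane 2) 2 (real q - 1) \<and>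
       orbit_values (is_Gamma_point 3 :: ('a ^ 4) set \<Rightarrow> bool) (is_dC_plane 3) ((real q - 5) / 6) ((real q - 5) / 2) \<and>
       orbit_values (is_Gamma_point 1 :: ('a ^ 4) set \<Rightarrow> bool) is_1bar_plane ((real q - 1) / 2) ((real q - 1) / 2) \<and>
       orbit_values (is_Gamma_point 0 :: ('a ^ 4) set \<Rightarrow> bool) (is_dC_plane 0) ((real q + 1) / 3) ((real q + 1) / 2)) \<and>
    (\<forall>m::nat. q = 2 ^ (2 * m + 1) \<longrightarrow>
       orbit_values (is_T_point :: ('a ^ 4) set \<Rightarrow> bool) (is_dC_plane 2) 1 (real q - 1) \<and>
       orbit_values (is_Gamma_point 3 :: ('a ^ 4) set \<Rightarrow> bool) (is_dC_plane 3) ((real q - 2) / 6) (real q - 2) \<and>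
       orbit_values (is_Gamma_point 1 :: ('a ^ 4) set \<Rightarrow> bool) is_1bar_plane (real q / 2) (real q) \<and>
       orbit_values (is_Gamma_point 0 :: ('a ^ 4) set \<Rightarrow> bool) (is_dC_plane 0) ((real q + 1) / 3) (real q + 1)) \<and>
    (odd q \<and> q mod 3 = 1 \<and> \<not> two_is_cube TYPE('a) \<longrightarrow>
       orbit_values (is_T_point :: ('a ^ 4) set \<Rightarrow> bool) (is_dC_plane 2) 1 ((real q - 1) / 3) \<and>
       orbit_values (is_Gamma_point 3 :: ('a ^ 4) set \<Rightarrow> bool) (is_dC_plane 3) ((real q - 1 - N) / 3) (2 / 3 * (real q - 1 - N)) \<and>
       orbit_values (is_Gamma_point 1 :: ('a ^ 4) set \<Rightarrow> bool) is_1bar_plane N (2 / 3 * N) \<and>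
       orbit_values (is_Gamma_point 0 :: ('a ^ 4) set \<Rightarrow> bool) (is_dC_plane 0) ((2 * real q + 1 - 2 * N) / 3) ((2 * real q + 1 - 2 * N) / 3)) \<and>
    (odd q \<and> q mod 3 = 1 \<and> two_is_cube TYPE('a) \<longrightarrow>
       orbit_values (is_T_point :: ('a ^ 4) set \<Rightarrow> bool) (is_dC_plane 2) 4 ((real q - 1) / 3) \<and>
       orbit_values (is_Gamma_point 3 :: ('a ^ 4) set \<Rightarrow> bool) (is_dC_plane 3) ((real q - 7 - N) / 3) ((real q - 7 - N) / 6) \<and>
       orbit_values (is_Gamma_point 1 :: ('a ^ 4) set \<Rightarrow> bool) is_1bar_plane N (N / 6) \<and>
       orbit_values (is_Gamma_point 0 :: ('a ^ 4) set \<Rightarrow> bool) (is_dC_plane 0) (2 / 3 * (real q - 1 - N)) ((real q - 1 - N) / 6)) \<and>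
    (\<forall>m::nat. q = 2 ^ (2 * m) \<longrightarrow>
       orbit_values (is_T_point :: ('a ^ 4) set \<Rightarrow> bool) (is_dC_plane 2) 1 ((real q - 1) / 3) \<and>
       orbit_values (is_Gamma_point 3 :: ('a ^ 4) set \<Rightarrow> bool) (is_dC_plane 3)
          ((real q / 2 - 1 - (-2) ^ m) / 3) (2 / 3 * (real q / 2 - 1 - (-2) ^ m)) \<and>
       orbit_values (is_Gamma_point 1 :: ('a ^ 4) set \<Rightarrow> bool) is_1bar_plane
          (real q / 2 + (-2) ^ m) (2 / 3 * (real q / 2 + (-2) ^ m)) \<and>
       orbit_values (is_Gamma_point 0 :: ('a ^ 4) set \<Rightarrow> bool) (is_dC_plane 0)
          ((real q + 1 + (-2) ^ (m + 1)) / 3) ((real q + 1 + (-2) ^ (m + 1)) / 3))"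
proof -
  \<comment> \<open>Matching against the statement names the hypothesis and the conclusion of each
    case.\<close>
  let "?V1 \<and> ?V2 \<and> ?V3 \<and> (?h1 \<longrightarrow> ?C1) \<and> (\<forall>m. ?h2 m \<longrightarrow> ?C2 m)
    \<and> (?h3 \<longrightarrow> ?C3) \<and> (?h4 \<longrightarrow> ?C4) \<and> (\<forall>m. ?h5 m \<longrightarrow> ?C5 m)" = ?thesis
  have q5: "CARD('a) \<ge> 5" and rq: "real q = real CARD('a)" using assms by simp_all
  have three: "(3::'a) \<noteq> 0"
  proof
    assume "(3::'a) = 0"
    then have "3 dvd CARD('a)" using prime_eq_0_imp_dvd_CARD[of 3, where 'a = 'a] by simp
    then show False using assms(1,3) by presburger
  qed
  have odd_two: "(2::'a) \<noteq> 0" if "odd q"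
  proof
    assume "(2::'a) = 0"
    then have "2 dvd CARD('a)" using prime_eq_0_imp_dvd_CARD[of 2, where 'a = 'a] by simp
    then show False using that assms(1) by simp
  qed
  have even_two: "(2::'a) = 0" if "q = 2 ^ n" for n
  proof -
    \<comment> \<open>The number q = 2^n is 0 in the field, so 2 is nilpotent there.\<close>
    have "of_nat CARD('a) = (0::'a)" using CHAR_dvd_CARD[where 'a = 'a] by (simp add: of_nat_eq_0_iff_char_dvd)
    then have "(2::'a) ^ n = 0" using that assms(1) by simp
    then show ?thesis by simp
  qed
  have four_mod: "(4::nat) ^ m mod 3 = 1" for m
  proof (induction m)
    case (Suc m)
    have "(4::nat) ^ Suc m = 4 * 4 ^ m" by simp
    then show ?case using Suc by presburger
  qed simp
  have k1: "real (card {x::'a. x^3 = 1}) = 1" if "q mod 3 = 2"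
    using cube_roots_q2(1)[where 'a = 'a] that assms(1) by simp
  have k3: "real (card {x::'a. x^3 = 1}) = 3" if "q mod 3 = 1"
    using card_cube_roots_q1[where 'a = 'a] that assms(1) by simp
  note values_eq = all_orbit_values_eq[OF three q5 rq]
  have vanish: "?V1 \<and> ?V2 \<and> ?V3"
    by (rule vanishing_counts[OF three q5])
  have case1: "?h1 \<longrightarrow> ?C1"
  proof (rule impI)
    assume h: "odd q \<and> q mod 3 = 2"
    have two: "(2::'a) \<noteq> 0" using h odd_two by blast
    have q2: "CARD('a) mod 3 = 2" using h assms(1) by simp
    have "2 * real (N_q TYPE('a)) = real q - 1"
      using N_q_odd_q2[OF two q2, THEN arg_cong[of _ _ real]] assms(1,2) by (simp add: of_nat_diff)
    then have x1: "real (ell_count TYPE('a) 1) = (real q - 1) / 2" unfolding ell_count_1_odd[OF three two] by simp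
    \<comment> \<open>Cubing is bijective, so 2 has exactly one cube root and the line carries 1 + 1
      T-points.\<close>
    have "two_is_cube TYPE('a)"
      unfolding two_is_cube_def using surjD[OF bij_is_surj[OF cube_roots_q2(2)[OF q2]], of 2] by metis
    then have x2: "real (ell_count TYPE('a) 2) = 1"
      unfolding ell_count_2_odd[OF three two] using k1 h by simp
    have k: "real (card {x::'a. x^3 = 1}) = 1" using k1 h by blast
    note v = values_eq[OF x1 x2 k]
    \<comment> \<open>With x1, x2 and k inserted, both values of each type are linear in q, so only
      linear real identities remain.\<close>
    show ?C1
      by (intro conjI; (rule orbit_values_cong[OF v(1)] | rule orbit_values_cong[OF v(2)]
        | rule orbit_values_cong[OF v(3)] | rule orbit_values_cong[OF v(4)]); argo)
  qed
  have case2: "\<forall>m. ?h2 m \<longrightarrow> ?C2 m"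
  proof (intro allI impI)
    fix m :: nat assume h: "q = 2 ^ (2 * m + 1)"
    have two: "(2::'a) = 0" using even_two h by blast
    have "q = 2 * 4 ^ m" using h by (simp add: power_mult)
    then have q2: "q mod 3 = 2" using four_mod[of m] by presburger
    then have "CARD('a) mod 3 = 2" using assms(1) by simp
    then have x1: "real (ell_count TYPE('a) 1) = real q / 2"
      using ell_count_1_even_q2[OF three two, THEN arg_cong[of _ _ real]] rq by simp
    have x2: "real (ell_count TYPE('a) 2) = 0" using ell_count_2_even[OF three two] by simp
    note v = values_eq[OF x1 x2 k1[OF q2]]
    show "?C2 m"
      by (intro conjI; (rule orbit_values_cong[OF v(1)] | rule orbit_values_cong[OF v(2)]
        | rule orbit_values_cong[OF v(3)] | rule orbit_values_cong[OF v(4)]); argo)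
  qed
  have case3: "?h3 \<longrightarrow> ?C3"
  proof (rule impI)
    assume h: "odd q \<and> q mod 3 = 1 \<and> \<not> two_is_cube TYPE('a)"
    have two: "(2::'a) \<noteq> 0" using h odd_two by blast
    have x1: "real (ell_count TYPE('a) 1) = N" unfolding ell_count_1_odd[OF three two] assms(4) ..
    have x2: "real (ell_count TYPE('a) 2) = 0" unfolding ell_count_2_odd[OF three two] using h by simp
    have k: "real (card {x::'a. x^3 = 1}) = 3" using k3 h by blast
    note v = values_eq[OF x1 x2 k]
    show ?C3
      by (intro conjI; (rule orbit_values_cong[OF v(1)] | rule orbit_values_cong[OF v(2)]
        | rule orbit_values_cong[OF v(3)] | rule orbit_values_cong[OF v(4)]); argo)
  qed
  have case4: "?h4 \<longrightarrow> ?C4"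
  proof (rule impI)
    assume h: "odd q \<and> q mod 3 = 1 \<and> two_is_cube TYPE('a)"
    have two: "(2::'a) \<noteq> 0" using h odd_two by blast
    have x1: "real (ell_count TYPE('a) 1) = N" unfolding ell_count_1_odd[OF three two] assms(4) ..
    have k: "real (card {x::'a. x^3 = 1}) = 3" using k3 h by blast
    \<comment> \<open>The three cube roots of 2 give three T-points besides (0, 0, 1, 0), hence the
      value 4.\<close>
    then have x2: "real (ell_count TYPE('a) 2) = 3" unfolding ell_count_2_odd[OF three two] using h by simp
    note v = values_eq[OF x1 x2 k]
    show ?C4
      by (intro conjI; (rule orbit_values_cong[OF v(1)] | rule orbit_values_cong[OF v(2)]
        | rule orbit_values_cong[OF v(3)] | rule orbit_values_cong[OF v(4)]); argo)
  qed
  have case5: "\<forall>m. ?h5 m \<longrightarrow> ?C5 m"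
  proof (intro allI impI)
    fix m :: nat assume h: "q = 2 ^ (2 * m)"
    have two: "(2::'a) = 0" using even_two h by blast
    have "q = 4 ^ m" using h by (simp add: power_mult)
    then have q1: "q mod 3 = 1" using four_mod[of m] by simp
    then have c1: "CARD('a) mod 3 = 1" using assms(1) by simp
    \<comment> \<open>With this name, (-2)^(m + 1) becomes the term -2 r and the identities stay
      linear.\<close>
    define r where "r = (-2::real) ^ m"
    have r: "(-2) ^ m = r" "(-2) ^ (m + 1) = -2 * r" by (simp_all add: r_def)
    have x1: "real (ell_count TYPE('a) 1) = real q / 2 + r" unfolding r(1)[symmetric]
      using ell_count_1_even_q1[OF three two c1 h[unfolded assms(1)]] rq by simp
    have x2: "real (ell_count TYPE('a) 2) = 0" using ell_count_2_even[OF three two] by simp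
    note v = values_eq[OF x1 x2 k3[OF q1]]
    show "?C5 m"
      unfolding r
      by (intro conjI; (rule orbit_values_cong[OF v(1)] | rule orbit_values_cong[OF v(2)]
        | rule orbit_values_cong[OF v(3)] | rule orbit_values_cong[OF v(4)]); argo)
  qed
  show ?thesis
    using vanish case1 case2 case3 case4 case5 by (elim conjE) (intro conjI; assumption)
qed

end
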